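(* As $n\to\infty$, $$\eta_2(n)\sim\frac{1}{4\sqrt3}\,e^{\frac{\pi}{6}\sqrt{24n-1}}.$$
   Context: The rank of a partition is its largest part minus its number of parts; $N(m,n)$ is the number of partitions of $n$ with rank $m$; $\eta_2(n):=\sum_{m\in\mathbb{Z}}\binom{m}{2}N(m,n)$ with $\binom m2=\frac{m(m-1)}2$ for every integer $m$. *)

theory Defs
  imports Complex_Main "HOL-Library.Multiset" "HOL-Library.Groups_Big_Fun"
    "HOL-Library.Landau_Symbols"
begin

definition partitions_of :: "nat \<Rightarrow> nat multiset set" where
  "partitions_of n = {p. 0 \<notin># p \<and> sum_mset p = n}"

(* The empty partition (the only partition of 0) has no largest part; its rank is 0. *)
definition partition_rank :: "nat multiset \<Rightarrow> int" where
  "partition_rank p =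
     (if p = {#} then 0 else int (Max (set_mset p)) - int (size p))"

definition rank_count :: "int \<Rightarrow> nat \<Rightarrow> nat" where
  "rank_count m n = card {p \<in> partitions_of n. partition_rank p = m}"

(* Sum_any is the sum over all integers m of a function of finite support
   (and 0 if the support is infinite); the support is finite here, see
   finite_rank_count_support below.  The binder syntax is avoided because it
   clashes with that of suminf.  The division by 2 is exact. *)
definition eta2 :: "nat \<Rightarrow> int" where
  "eta2 n = Sum_any (\<lambda>m::int. (m * (m - 1) div 2) * int (rank_count m n))"

lemma size_le_sum_mset: "0 \<notin># p \<Longrightarrow> size p \<le> sum_mset p" for p :: "nat multiset"
  by (induction p) auto

lemma finite_partitions_of: "finite (partitions_of n)"
proof (rule finite_subset)
  show "partitions_of n \<subseteq> mset ` {xs. set xs \<subseteq> {..n} \<and> length xs \<le> n}"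
  proof
    fix p assume p: "p \<in> partitions_of n"
    obtain xs where xs: "p = mset xs" by (metis ex_mset)
    have "set xs \<subseteq> {..n}"
      using p unfolding xs partitions_of_def
      by (auto simp: sum_mset_sum_list member_le_sum_list)
    moreover have "length xs \<le> n"
      using size_le_sum_mset[of p] p unfolding xs partitions_of_def by auto
    ultimately show "p \<in> mset ` {xs. set xs \<subseteq> {..n} \<and> length xs \<le> n}"
      using xs by blast
  qed
qed (simp add: finite_lists_length_le)

lemma finite_rank_count_support: "finite {m. rank_count m n \<noteq> 0}"
proof (rule finite_subset)
  show "{m. rank_count m n \<noteq> 0} \<subseteq> partition_rank ` partitions_of n"
    by (auto simp: rank_count_def card_eq_0_iff)
qed (simp add: finite_partitions_of)

end

theory Submission
  imports Defs "HOL-Probability.Probability" "HOL-Real_Asymp.Real_Asymp"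
begin

text \<open>Write $p(n)$ for the number of partitions of $n$. The theorem follows from two facts: $\eta_2(n) \sim n\,p(n)$, and the
Hardy-Ramanujan formula $p(n) \sim e^{\pi\sqrt{2n/3}} / (4 \sqrt 3\, n)$.

The first fact is combinatorial. Cut a partition along its Durfee square, of side $d$, and conjugate the piece to the right of
the square. What is left is a pair $(A, B)$ of partitions with parts in $1..d$, and the rank of the partition is $|A| - |B|$,
where $|A|$ counts parts. Exchanging $A$ and $B$ shows that the ranks sum to $0$, whence $\eta_2(n) = \sum (|A|^2 - |A| |B|)$.
Expand the sizes into multiplicities. A term that involves two different part sizes $i \neq j$ has the same sum whether the two
parts are prescribed in the same component or in different ones, so these terms cancel, and the diagonal terms give
(eta2_eq_durfee_sum)
\[ \eta_2(n) = \sum_{i,k \geq 1} k \cdot \#\{\mbox{partitions of } n - ik \mbox{ with Durfee side at least } i\}. \]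
Without the condition on the Durfee side the right-hand side is $n\,p(n)$. The difference of the two is $o(n\,p(n))$: by
the monotonicity of $p$ the terms with $i > J$ contribute $O(1/J)\, n\,p(n)$ up to a term of smaller order, and those with
$i \leq J$ count only partitions with bounded Durfee side, of which there are polynomially many (eta2_asymp_n_num_partitions).

The second fact is proved by a local limit argument that needs the generating function $P$ of $p$ only through the Dirichlet
series $\log P(e^{-z}) = \sum_m (\sigma(m)/m)\, e^{-mz}$, whose coefficients are positive. Here $\sigma(m)$ is the sum of the
divisors of $m$, and the series comes from the recurrence $n\,p(n) = \sum_m \sigma(m) p(n-m)$ read as a differential equation.
Put $x = \pi/\sqrt{6n}$. Fourier inversion on the circle of radius $e^{-x}$ gives
\[ p(n) = \frac{e^{nx} P(e^{-x})}{2\pi} \int_{-\pi}^{\pi} \frac{P(e^{-x+it})}{P(e^{-x})} e^{-int}\, dt. \]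
Scaled by $t = x^{3/2} v$ the integrand tends to $e^{-\pi^2 v^2/6}$. To see this, expand the exponent to second order in $t$: by
positivity all coefficients and the remainder are values at $t = 0$ of the series with weights $m\,\sigma(m)$ and the like, and
these are found by rearranging them into Lambert series. An integrable majorant comes from $\sigma(m) \geq m$, which compares the
real part of the exponent with a geometric series. There remains $P(e^{-x})$ itself, where the trapezoidal rule for
$\log((1 - e^{-t})/t)$ together with Stirling's formula yields $\log P(e^{-x}) = \pi^2/(6x) + \frac12 \log(x/2\pi) + O(x)$
(log_gf_estimate). Collecting the factors gives the Hardy-Ramanujan formula (hardy_ramanujan).\<close>

section \<open>Conjugation of partitions\<close>

definition parts_ge :: "nat multiset \<Rightarrow> nat \<Rightarrow> nat" where
  "parts_ge p i = size {#x \<in># p. i \<le> x#}"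

definition largest :: "nat multiset \<Rightarrow> nat" where
  "largest p = Max (insert 0 (set_mset p))"

definition conjugate :: "nat multiset \<Rightarrow> nat multiset" where
  "conjugate p = image_mset (parts_ge p) (mset_set {1..largest p})"

lemma le_largest: "x \<in># p \<Longrightarrow> x \<le> largest p"
  by (simp add: largest_def)

lemma largest_le_iff: "largest p \<le> m \<longleftrightarrow> (\<forall>x\<in>#p. x \<le> m)"
  by (simp add: largest_def)

lemma parts_ge_antimono: "i \<le> j \<Longrightarrow> parts_ge p j \<le> parts_ge p i"
  unfolding parts_ge_def by (intro size_mset_mono filter_mset_mono_strong) auto

lemma parts_ge_pos_iff: "parts_ge p i > 0 \<longleftrightarrow> (\<exists>x\<in>#p. i \<le> x)"
  by (auto simp: parts_ge_def nonempty_has_size[symmetric])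

lemma parts_ge_le_size: "parts_ge p i \<le> size p"
  by (simp add: parts_ge_def size_filter_mset_lesseq)

lemma parts_ge_diff: "parts_ge p i = count p i + parts_ge p (Suc i)"
  unfolding parts_ge_def by (induction p) auto

text \<open>The multiplicity of a part is a difference of two consecutive values of parts_ge, so a partition is determined by these values.\<close>

lemma parts_ge_eqI:
  assumes "0 \<notin># p" "0 \<notin># q" "\<And>i. i \<ge> 1 \<Longrightarrow> parts_ge p i = parts_ge q i"
  shows "p = q"
proof (rule multiset_eqI)
  fix i
  show "count p i = count q i"
  proof (cases "i = 0")
    case True
    then show ?thesis using assms(1,2) by (metis count_inI)
  next
    case False
    then show ?thesis
      using parts_ge_diff[of p i] parts_ge_diff[of q i] assms(3)[of i] assms(3)[of "Suc i"] by simp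
  qed
qed

lemma size_conjugate [simp]: "size (conjugate p) = largest p"
  by (simp add: conjugate_def)

lemma parts_ge_pos_iff_largest: "i \<ge> 1 \<Longrightarrow> parts_ge p i > 0 \<longleftrightarrow> i \<le> largest p"
  unfolding parts_ge_pos_iff largest_def by (subst Max_ge_iff) auto

lemma zero_notin_conjugate [simp]: "0 \<notin># conjugate p"
  using parts_ge_pos_iff_largest[of _ p] by (fastforce simp: conjugate_def)

text \<open>In a Young diagram both sides say that the cell in row $j$ and column $i$ is present. Since the column lengths decrease, the
columns of length at least $j$ form an initial segment $1..s$, and $i$ lies in it exactly if $i \leq s$. This symmetry between
$i$ and $j$ is what makes conjugation an involution.\<close>

lemma parts_ge_conjugate_iff:
  assumes "i \<ge> 1" "j \<ge> 1"
  shows "i \<le> parts_ge (conjugate p) j \<longleftrightarrow> j \<le> parts_ge p i"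
proof -
  define S where "S = {i \<in> {1..largest p}. j \<le> parts_ge p i}"
  have eq: "parts_ge (conjugate p) j = card S"
    unfolding parts_ge_def[of "conjugate p"] unfolding conjugate_def filter_mset_image_mset
    by (simp add: S_def del: One_nat_def)
  have down: "i' \<in> S" if "i \<in> S" "1 \<le> i'" "i' \<le> i" for i i'
    using that parts_ge_antimono[of i' i p] by (auto simp: S_def)
  have fin: "finite S" by (simp add: S_def)
  have "i \<le> card S \<longleftrightarrow> i \<in> S"
  proof
    assume "i \<in> S"
    then have "{1..i} \<subseteq> S" using down by auto
    from card_mono[OF fin this] show "i \<le> card S" by simp
  next
    assume le: "i \<le> card S"
    show "i \<in> S"
    proof (rule ccontr)
      assume "i \<notin> S"
      then have "x < i" if "x \<in> S" for x
        using down[OF that, of i] assms by (meson not_le_imp_less)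
      then have "S \<subseteq> {1..<i}"
        by (auto simp: S_def)
      then have "card S \<le> i - 1" using card_mono[of "{1..<i}" S] by simp
      with le assms show False by simp
    qed
  qed
  moreover have "i \<in> S \<longleftrightarrow> j \<le> parts_ge p i"
    using assms parts_ge_pos_iff_largest[of i p] by (auto simp: S_def)
  ultimately show ?thesis by (simp add: eq)
qed

lemma conjugate_conjugate:
  assumes "0 \<notin># p"
  shows "conjugate (conjugate p) = p"
proof (rule parts_ge_eqI)
  fix i :: nat assume i: "i \<ge> 1"
  have "j \<le> parts_ge (conjugate (conjugate p)) i \<longleftrightarrow> j \<le> parts_ge p i" if "j \<ge> 1" for j
    using i that by (simp add: parts_ge_conjugate_iff)
  then have "j \<le> parts_ge (conjugate (conjugate p)) i \<longleftrightarrow> j \<le> parts_ge p i" for j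
    by (cases "j = 0") auto
  then show "parts_ge (conjugate (conjugate p)) i = parts_ge p i"
    by (meson order_antisym order_refl)
qed (use assms in auto)

lemma largest_conjugate: "0 \<notin># p \<Longrightarrow> largest (conjugate p) = size p"
  using size_conjugate[of "conjugate p"] by (simp add: conjugate_conjugate)

lemma sum_parts_ge: "(\<forall>x\<in>#p. x \<le> m) \<Longrightarrow> (\<Sum>i=1..m. parts_ge p i) = sum_mset p"
proof (induction p)
  case empty
  then show ?case by (simp add: parts_ge_def)
next
  case (add x p)
  have *: "parts_ge (add_mset x p) i = (if i \<le> x then 1 else 0) + parts_ge p i" for i
    by (simp add: parts_ge_def)
  have "{i. 1 \<le> i \<and> i \<le> m \<and> i \<le> x} = {1..x}" using add.prems by auto
  then have "(\<Sum>i=1..m. if i \<le> x then 1 else 0 :: nat) = x"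
    by (simp add: sum.If_cases Int_def)
  then show ?case using add unfolding * sum.distrib by simp
qed

lemma sum_conjugate [simp]: "sum_mset (conjugate p) = sum_mset p"
proof -
  have "sum_mset (conjugate p) = (\<Sum>i=1..largest p. parts_ge p i)"
    by (simp add: conjugate_def sum_unfold_sum_mset)
  also have "\<dots> = sum_mset p" by (rule sum_parts_ge) (auto simp: le_largest)
  finally show ?thesis .
qed

section \<open>The Durfee square decomposition\<close>

text \<open>A partition of $n$ is encoded by the side $d$ of its Durfee square, the conjugate $A$ of the partition to the right of the
square, and the partition $B$ below the square. Because the part to the right is conjugated, $A$ and $B$ obey the same
constraint and their sizes enter the rank symmetrically.\<close>

definition durfee_triples :: "nat \<Rightarrow> (nat \<times> nat multiset \<times> nat multiset) set" where
  "durfee_triples n = {(d, A, B). set_mset A \<subseteq> {1..d} \<and> set_mset B \<subseteq> {1..d} \<and>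
     d\<^sup>2 + sum_mset A + sum_mset B = n}"

text \<open>The rows of the square are $d$ parts. The rows of the conjugate of $A$ extend the first of them; the remaining ones stay equal
to $d$.\<close>

definition glue :: "nat \<times> nat multiset \<times> nat multiset \<Rightarrow> nat multiset" where
  "glue = (\<lambda>(d, A, B). image_mset ((+) d) (conjugate A) + replicate_mset (d - largest A) d + B)"

text \<open>The Durfee side is the largest $d$ for which at least $d$ parts are at least $d$. Parts equal to $d$ can belong to the square or
to the piece below it, so the copies that complete the square are taken away from the small parts.\<close>

definition unglue :: "nat multiset \<Rightarrow> nat \<times> nat multiset \<times> nat multiset" where
  "unglue p = (let d = (GREATEST d. d \<le> parts_ge p d) in
     (d, conjugate (image_mset (\<lambda>x. x - d) {#x \<in># p. d < x#}),
      {#x \<in># p. x \<le> d#} - replicate_mset (d - size {#x \<in># p. d < x#}) d))"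

lemma sum_mset_shift: "sum_mset (image_mset ((+) d) M) = d * size M + sum_mset (M :: nat multiset)"
  by (induction M) auto

text \<open>The number of parts that are at least $d$ decreases in $d$, so the two inequalities locate the largest $d$ uniquely.\<close>

lemma durfee_size_eq:
  assumes "d \<le> parts_ge p d" "parts_ge p (Suc d) \<le> d"
  shows "(GREATEST d. d \<le> parts_ge p d) = d"
proof (rule Greatest_equality)
  fix e assume e: "e \<le> parts_ge p e"
  show "e \<le> d"
  proof (rule ccontr)
    assume "\<not> e \<le> d"
    then have "parts_ge p e \<le> parts_ge p (Suc d)" by (intro parts_ge_antimono) auto
    with e assms \<open>\<not> e \<le> d\<close> show False by simp
  qed
qed (use assms in auto)

lemma durfee_size_props:
  fixes p defines "d \<equiv> (GREATEST d. d \<le> parts_ge p d)"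
  shows "d \<le> parts_ge p d" "parts_ge p (Suc d) \<le> d"
proof -
  have bound: "\<And>e. e \<le> parts_ge p e \<Longrightarrow> e \<le> size p"
    using parts_ge_le_size order_trans by blast
  show 1: "d \<le> parts_ge p d"
    unfolding d_def by (rule GreatestI_nat[of "\<lambda>d. d \<le> parts_ge p d" 0 "size p"]) (use bound in auto)
  have "\<not> Suc d \<le> parts_ge p (Suc d)"
    using Greatest_le_nat[of "\<lambda>d. d \<le> parts_ge p d" "Suc d" "size p"] bound unfolding d_def by auto
  then show "parts_ge p (Suc d) \<le> d" by simp
qed

text \<open>The parts of the glued partition that exceed $d$ are exactly the shifted rows of the conjugate of $A$, and there are at most $d$
of them; this identifies $d$ as the Durfee side and lets all three components be read off again. The largest part is $d + |A|$ and
the number of parts is $d + |B|$, so the contributions of the square to the rank cancel.\<close>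

lemma glue_facts:
  assumes "t \<in> durfee_triples n"
  shows "glue t \<in> partitions_of n" "unglue (glue t) = t"
    "partition_rank (glue t) = int (size (fst (snd t))) - int (size (snd (snd t)))"
proof -
  obtain d A B where t: "t = (d, A, B)" by (cases t)
  have A: "set_mset A \<subseteq> {1..d}" and B: "set_mset B \<subseteq> {1..d}"
    and n: "d\<^sup>2 + sum_mset A + sum_mset B = n"
    using assms by (auto simp: durfee_triples_def t)
  have A0: "0 \<notin># A" and B0: "0 \<notin># B" using A B by auto
  have lA: "largest A \<le> d" using A by (auto simp: largest_le_iff)
  define p where "p = glue t"
  have p: "p = image_mset ((+) d) (conjugate A) + replicate_mset (d - largest A) d + B"
    by (simp add: p_def glue_def t)
  have "0 \<notin># p"
    using B0 lA by (auto simp: p image_iff) 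
  have sp: "size p = d + size B" and sC: "size (conjugate A) = largest A"
    using lA largest_conjugate[OF A0] by (auto simp: p)
  have "sum_mset p = d * largest A + sum_mset A + (d - largest A) * d + sum_mset B"
    by (simp add: p sum_mset_shift)
  also have "d * largest A + sum_mset A + (d - largest A) * d + sum_mset B = n"
    using lA n by (simp add: power2_eq_square algebra_simps diff_mult_distrib2)
  finally show "glue t \<in> partitions_of n"
    using \<open>0 \<notin># p\<close> by (simp add: partitions_of_def p_def)
  have Bd: "\<And>x. x \<in># B \<Longrightarrow> x \<le> d" using B by auto
  have Cpos: "\<And>x. x \<in># conjugate A \<Longrightarrow> 0 < x" using zero_notin_conjugate[of A] by (metis gr0I)
  have filC: "filter_mset (\<lambda>x. d < x) (image_mset ((+) d) (conjugate A)) = image_mset ((+) d) (conjugate A)"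
    "filter_mset (\<lambda>x. x \<le> d) (image_mset ((+) d) (conjugate A)) = {#}"
    using Cpos by (force simp: filter_mset_eq_conv)+
  have filB: "filter_mset (\<lambda>x. d < x) B = {#}" "filter_mset (\<lambda>x. x \<le> d) B = B"
    using Bd by (force simp: filter_mset_eq_conv)+
  have gt: "filter_mset (\<lambda>x. d < x) p = image_mset ((+) d) (conjugate A)"
    and le: "filter_mset (\<lambda>x. x \<le> d) p = replicate_mset (d - largest A) d + B"
    unfolding p filter_union_mset filC filB by (auto simp: filter_mset_eq_conv)
  have 1: "parts_ge p (Suc d) = largest A"
    using gt by (simp add: parts_ge_def Suc_le_eq)
  have 2: "d \<le> parts_ge p d"
  proof -
    have "d - largest A \<le> count p d"
      unfolding count_le_replicate_mset_subset_eq p by simp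
    then show ?thesis using lA parts_ge_diff[of p d] 1 by linarith
  qed
  have d: "(GREATEST d. d \<le> parts_ge p d) = d"
    by (rule durfee_size_eq) (use 1 2 lA in auto)
  have "image_mset (\<lambda>x. x - d) (filter_mset (\<lambda>x. d < x) p) = conjugate A"
    unfolding gt by (simp add: multiset.map_comp comp_def)
  moreover have "size (filter_mset (\<lambda>x. d < x) p) = largest A" by (simp add: gt)
  ultimately have "unglue p = t"
    unfolding unglue_def Let_def d le t by (simp add: conjugate_conjugate A0)
  then show "unglue (glue t) = t" by (simp add: p_def)
  show "partition_rank (glue t) = int (size (fst (snd t))) - int (size (snd (snd t)))"
  proof (cases "d = 0")
    case True
    then have "A = {#}" "B = {#}" using A B by auto
    then have "p = {#}" using True by (simp add: p conjugate_def largest_def)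
    with \<open>A = {#}\<close> \<open>B = {#}\<close> show ?thesis
      unfolding p_def[symmetric] by (simp add: t partition_rank_def)
  next
    case False
    then have "p \<noteq> {#}" using sp by auto
    have "Max (set_mset p) = d + size A"
    proof (rule Max_eqI)
      fix y assume "y \<in> set_mset p"
      then consider x where "x \<in># conjugate A" "y = d + x" | "y = d" | "y \<in># B"
        by (auto simp: p split: if_splits)
      then show "y \<le> d + size A"
        using le_largest[of _ "conjugate A"] largest_conjugate[OF A0] Bd by cases fastforce+
    next
      show "d + size A \<in> set_mset p"
      proof (cases "A = {#}")
        case True
        then show ?thesis using False by (simp add: p largest_def conjugate_def)
      next
        case False
        have "size A = largest (conjugate A)" using largest_conjugate[OF A0] by simp
        also have "\<dots> \<in> insert 0 (set_mset (conjugate A))" unfolding largest_def by (rule Max_in) auto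
        finally have "size A \<in># conjugate A" using False by auto
        then show ?thesis by (simp add: p)
      qed
    qed simp
    then show ?thesis
      using \<open>p \<noteq> {#}\<close> unfolding p_def[symmetric] by (simp add: partition_rank_def t sp)
  qed
qed

lemma unglue_facts:
  assumes "p \<in> partitions_of n"
  shows "unglue p \<in> durfee_triples n" "glue (unglue p) = p"
proof -
  have p0: "0 \<notin># p" and sp: "sum_mset p = n" using assms by (auto simp: partitions_of_def)
  define d where "d = (GREATEST d. d \<le> parts_ge p d)"
  note d = durfee_size_props[of p, folded d_def]
  define C where "C = image_mset (\<lambda>x. x - d) {#x \<in># p. d < x#}"
  define B where "B = {#x \<in># p. x \<le> d#} - replicate_mset (d - size {#x \<in># p. d < x#}) d"
  have u: "unglue p = (d, conjugate C, B)"
    by (simp add: unglue_def Let_def d_def[symmetric] C_def B_def)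
  have C0: "0 \<notin># C" by (auto simp: C_def)
  have sC: "size C = parts_ge p (Suc d)" by (simp add: C_def parts_ge_def Suc_le_eq)
  have CC: "image_mset ((+) d) C = {#x \<in># p. d < x#}"
  proof -
    have "image_mset ((+) d) C = image_mset (\<lambda>x. x) {#x \<in># p. d < x#}"
      unfolding C_def multiset.map_comp by (rule image_mset_cong) auto
    then show ?thesis by simp
  qed
  have size_C: "size {#x \<in># p. d < x#} = size C" by (simp add: C_def)
  have rep: "replicate_mset (d - size {#x \<in># p. d < x#}) d \<subseteq># {#x \<in># p. x \<le> d#}"
    using d sC parts_ge_diff[of p d] by (auto simp: C_def count_le_replicate_mset_subset_eq[symmetric])
  have glue: "glue (unglue p) = p"
  proof -
    have "glue (unglue p) = {#x \<in># p. d < x#} + (replicate_mset (d - size {#x \<in># p. d < x#}) d + B)"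
      unfolding u glue_def using largest_conjugate[OF C0]
      by (simp add: conjugate_conjugate[OF C0] CC size_C)
    also have "replicate_mset (d - size {#x \<in># p. d < x#}) d + B = {#x \<in># p. x \<le> d#}"
      unfolding B_def using rep by (metis subset_mset.add_diff_inverse)
    also have "{#x \<in># p. x \<le> d#} = {#x \<in># p. \<not> d < x#}" by (simp add: not_less)
    also have "{#x \<in># p. d < x#} + \<dots> = p" by (simp add: multiset_partition[symmetric])
    finally show ?thesis .
  qed
  show "glue (unglue p) = p" by (fact glue)
  have sub: "set_mset (conjugate C) \<subseteq> {1..d}"
  proof
    fix x assume x: "x \<in># conjugate C"
    have "x \<le> d" using le_largest[OF x] largest_conjugate[OF C0] sC d by simp
    moreover have "x \<noteq> 0" using x zero_notin_conjugate[of C] by metis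
    ultimately show "x \<in> {1..d}" by simp
  qed
  have B: "set_mset B \<subseteq> {1..d}"
    using p0 by (auto simp: B_def Suc_le_eq intro!: gr0I dest!: in_diffD)
  have "(d, conjugate C, B) \<in> durfee_triples (d\<^sup>2 + sum_mset (conjugate C) + sum_mset B)"
    using sub B by (simp add: durfee_triples_def)
  moreover from glue_facts(1)[OF this] have "d\<^sup>2 + sum_mset (conjugate C) + sum_mset B = n"
    using glue sp by (simp add: u partitions_of_def)
  ultimately show "unglue p \<in> durfee_triples n" by (simp add: u)
qed

lemma bij_glue: "bij_betw glue (durfee_triples n) (partitions_of n)"
  by (rule bij_betw_byWitness[where f' = unglue]) (use glue_facts unglue_facts in auto)

section \<open>The second rank moment as a weighted partition count\<close>

definition num_partitions :: "nat \<Rightarrow> nat" where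
  "num_partitions n = card (partitions_of n)"

lemma finite_durfee_triples [simp]: "finite (durfee_triples n)"
  using bij_betw_finite[OF bij_glue] finite_partitions_of by blast

lemma card_durfee_triples: "card (durfee_triples n) = num_partitions n"
  using bij_betw_same_card[OF bij_glue] by (simp add: num_partitions_def)

lemma sum_rank_eq:
  "(\<Sum>p\<in>partitions_of n. f (partition_rank p)) =
     (\<Sum>(d, A, B)\<in>durfee_triples n. f (int (size A) - int (size B)))"
proof -
  have "(\<Sum>p\<in>partitions_of n. f (partition_rank p)) =
      (\<Sum>t\<in>durfee_triples n. f (partition_rank (glue t)))"
    by (rule sum.reindex_bij_betw[OF bij_glue, symmetric])
  also have "\<dots> = (\<Sum>(d, A, B)\<in>durfee_triples n. f (int (size A) - int (size B)))"
    by (rule sum.cong) (auto simp: glue_facts(3))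
  finally show ?thesis .
qed

text \<open>The number of triples that contain a prescribed collection of parts. By the next lemma it depends on the multiset of the
prescribed parts only, and not on how they are divided between the two components: this is the source of the cancellation in the
second moment.\<close>

definition extend_count :: "nat multiset \<Rightarrow> nat \<Rightarrow> nat" where
  "extend_count C n = card {(d, A, B). set_mset (A + B + C) \<subseteq> {1..d} \<and>
     d\<^sup>2 + sum_mset (A + B + C) = n}"

text \<open>Removing the prescribed parts is a bijection, and the constraint that they be at most $d$ is the same for both components.\<close>

lemma card_containing:
  "card {(d, A, B) \<in> durfee_triples n. A0 \<subseteq># A \<and> B0 \<subseteq># B} = extend_count (A0 + B0) n"
proof -
  let ?X = "{(d, A, B). set_mset (A + B + (A0 + B0)) \<subseteq> {1..d} \<and> d\<^sup>2 + sum_mset (A + B + (A0 + B0)) = n}"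
  let ?Y = "{(d, A, B) \<in> durfee_triples n. A0 \<subseteq># A \<and> B0 \<subseteq># B}"
  have "?Y \<subseteq> (\<lambda>(d, A, B). (d, A + A0, B + B0)) ` ?X"
  proof
    fix t assume "t \<in> ?Y"
    then obtain d A B where t: "t = (d, A + A0, B + B0)" "(d, A + A0, B + B0) \<in> durfee_triples n"
    proof -
      from \<open>t \<in> ?Y\<close> obtain d A B where "t = (d, A, B)" "t \<in> durfee_triples n" "A0 \<subseteq># A" "B0 \<subseteq># B"
        by blast
      then show ?thesis using that[of d "A - A0" "B - B0"] by simp
    qed
    from t(2) have "(d, A, B) \<in> ?X" by (simp add: durfee_triples_def)
    then show "t \<in> (\<lambda>(d, A, B). (d, A + A0, B + B0)) ` ?X"
      unfolding t(1) by (rule rev_image_eqI) simp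
  qed
  moreover have "(\<lambda>(d, A, B). (d, A + A0, B + B0)) ` ?X \<subseteq> ?Y"
    by (clarsimp simp: durfee_triples_def)
  moreover have "inj_on (\<lambda>(d, A, B). (d, A + A0, B + B0)) ?X"
    by (auto simp: inj_on_def)
  ultimately have "bij_betw (\<lambda>(d, A, B). (d, A + A0, B + B0)) ?X ?Y"
    by (simp add: bij_betw_def subset_antisym)
  from bij_betw_same_card[OF this] show ?thesis by (simp add: extend_count_def)
qed

lemma extend_count_replicate:
  assumes "i \<ge> 1" "k \<ge> 1"
  shows "extend_count (replicate_mset k i) n =
    (if i * k \<le> n then card {t \<in> durfee_triples (n - i * k). i \<le> fst t} else 0)"
proof (cases "i * k \<le> n")
  case True
  then have "{(d, A, B). set_mset (A + B + replicate_mset k i) \<subseteq> {1..d} \<and>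
     d\<^sup>2 + sum_mset (A + B + replicate_mset k i) = n} = {t \<in> durfee_triples (n - i * k). i \<le> fst t}"
    using assms by (auto simp: durfee_triples_def algebra_simps)
  then show ?thesis using True by (simp add: extend_count_def)
next
  case False
  then have "{(d, A, B). set_mset (A + B + replicate_mset k i) \<subseteq> {1..d} \<and>
     d\<^sup>2 + sum_mset (A + B + replicate_mset k i) = n} = {}"
    using assms by (auto simp: algebra_simps)
  then show ?thesis using False by (simp only: extend_count_def if_False card.empty)
qed

lemma extend_count_eq_0:
  assumes "i \<ge> 1" "k > n"
  shows "extend_count (replicate_mset k i) n = 0"
proof -
  have "1 * k \<le> i * k" using assms by (intro mult_right_mono) auto
  then have "\<not> i * k \<le> n" using assms by linarith
  then show ?thesis using extend_count_replicate[of i k n] assms by simp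
qed

lemma elem_le_sum_mset: "x \<in># p \<Longrightarrow> x \<le> sum_mset p" for p :: "nat multiset"
  by (induction p) auto

text \<open>Writing a multiplicity as the number of thresholds $k$ below it turns sums of products of sizes into numbers of triples that
contain prescribed parts. The common range $1..n$ makes the index set independent of the triple.\<close>

lemma size_eq_sum_thresholds:
  assumes "0 \<notin># A" "sum_mset A \<le> n"
  shows "int (size A) = (\<Sum>(i, k)\<in>{1..n}\<times>{1..n}. of_bool (k \<le> count A i))"
proof -
  have sz: "size A \<le> n" using size_le_sum_mset[OF assms(1)] assms(2) by simp
  have sub: "set_mset A \<subseteq> {1..n}"
  proof
    fix x assume x: "x \<in># A"
    then have "x \<le> sum_mset A" by (rule elem_le_sum_mset)
    then show "x \<in> {1..n}" using assms x by (cases x) auto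
  qed
  have cnt: "(\<Sum>k=1..n. of_bool (k \<le> count A i)) = int (count A i)" for i
  proof -
    have "count A i \<le> n" using sz count_le_size[of A i] by simp
    then have "{1..n} \<inter> {k. k \<le> count A i} = {1..count A i}" by auto
    then show ?thesis by (simp add: of_bool_def sum.If_cases)
  qed
  have "size A = (\<Sum>i\<in>set_mset A. count A i)" by (simp add: size_multiset_overloaded_eq)
  also have "\<dots> = (\<Sum>i=1..n. count A i)"
    by (rule sum.mono_neutral_left) (use sub in \<open>auto simp: count_eq_zero_iff\<close>)
  finally show ?thesis by (simp only: sum.cartesian_product[symmetric] cnt of_nat_sum)
qed

text \<open>The thresholds $k$ and $l$ for the same part size require $\max(k,l)$ copies if they are imposed on one component, and $k$ plus
$l$ copies if they are imposed on both. For fixed $k$ the terms with $l > k$ of the first kind match all terms of the second kind.\<close>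

lemma sum_thresholds_max_add:
  fixes g :: "nat \<Rightarrow> int"
  assumes "\<And>k. k > n \<Longrightarrow> g k = 0" "k \<in> {1..n}"
  shows "(\<Sum>l=1..n. g (max k l) - g (k + l)) = int k * g k"
proof -
  have "(\<Sum>l=1..n. g (max k l)) = (\<Sum>l\<in>{1..k} \<union> {k<..n}. g (max k l))"
    using assms(2) by (intro sum.cong) auto
  also have "\<dots> = (\<Sum>l=1..k. g (max k l)) + (\<Sum>l\<in>{k<..n}. g (max k l))"
    by (rule sum.union_disjoint) auto
  also have "(\<Sum>l=1..k. g (max k l)) = (\<Sum>l=1..k. g k)" by (rule sum.cong) auto
  also have "(\<Sum>l\<in>{k<..n}. g (max k l)) = (\<Sum>l\<in>{k<..n}. g l)" by (rule sum.cong) auto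
  also have "\<dots> = (\<Sum>l\<in>{k<..k+n}. g l)"
    by (rule sum.mono_neutral_left) (use assms in auto)
  also have "\<dots> = (\<Sum>l=1..n. g (k + l))"
    by (rule sum.reindex_bij_witness[of _ "\<lambda>l. k + l" "\<lambda>l. l - k"]) auto
  finally show ?thesis by (simp add: sum_subtractf)
qed

lemma sum_triple_thresholds:
  fixes A0 B0 :: "'a \<Rightarrow> 'a \<Rightarrow> nat multiset"
  shows "(\<Sum>(d, A, B)\<in>durfee_triples n. \<Sum>x\<in>S. \<Sum>y\<in>S. of_bool (A0 x y \<subseteq># A \<and> B0 x y \<subseteq># B)) =
    (\<Sum>x\<in>S. \<Sum>y\<in>S. int (extend_count (A0 x y + B0 x y) n))"
proof -
  have "(\<Sum>(d, A, B)\<in>durfee_triples n. \<Sum>x\<in>S. \<Sum>y\<in>S. of_bool (A0 x y \<subseteq># A \<and> B0 x y \<subseteq># B)) =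
    (\<Sum>x\<in>S. \<Sum>t\<in>durfee_triples n. \<Sum>y\<in>S. (case t of (d, A, B) \<Rightarrow> of_bool (A0 x y \<subseteq># A \<and> B0 x y \<subseteq># B)))"
    by (subst sum.swap) (auto intro!: sum.cong)
  also have "\<dots> = (\<Sum>x\<in>S. \<Sum>y\<in>S. \<Sum>t\<in>durfee_triples n. (case t of (d, A, B) \<Rightarrow> of_bool (A0 x y \<subseteq># A \<and> B0 x y \<subseteq># B)))"
    by (intro sum.cong refl sum.swap)
  also have "\<dots> = (\<Sum>x\<in>S. \<Sum>y\<in>S. int (extend_count (A0 x y + B0 x y) n))"
  proof (intro sum.cong refl)
    fix x y
    have "(\<Sum>t\<in>durfee_triples n. (case t of (d, A, B) \<Rightarrow> of_bool (A0 x y \<subseteq># A \<and> B0 x y \<subseteq># B))) =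
        (\<Sum>t\<in>durfee_triples n. of_bool (case t of (d, A, B) \<Rightarrow> (A0 x y \<subseteq># A \<and> B0 x y \<subseteq># B)) :: int)"
      by (intro sum.cong) auto
    also have "\<dots> = int (card {(d, A, B) \<in> durfee_triples n. A0 x y \<subseteq># A \<and> B0 x y \<subseteq># B})"
      by (simp add: Int_def, intro arg_cong[of _ _ card], auto)
    finally show "(\<Sum>t\<in>durfee_triples n. (case t of (d, A, B) \<Rightarrow> of_bool (A0 x y \<subseteq># A \<and> B0 x y \<subseteq># B))) =
       int (extend_count (A0 x y + B0 x y) n)"
      by (simp add: card_containing)
  qed
  finally show ?thesis .
qed

lemma replicate_two_subset_iff:
  "i \<noteq> j \<Longrightarrow> replicate_mset k i + replicate_mset l j \<subseteq># A \<longleftrightarrow> k \<le> count A i \<and> l \<le> count A j"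
  "replicate_mset (max k l) i \<subseteq># A \<longleftrightarrow> k \<le> count A i \<and> l \<le> count A i"
  unfolding subseteq_mset_def by (auto split: if_splits)

lemma replicate_mset_add: "replicate_mset (m + n) x = replicate_mset m x + replicate_mset n x"
  by (rule multiset_eqI) simp

text \<open>Expand both products by thresholds $(i,k)$ and $(j,l)$. For $i \neq j$ the two products require the same multiset of parts and
cancel; for $i = j$ the preceding computation leaves $k$ times the number of triples with $k$ prescribed copies of $i$.\<close>

lemma sum_size_products:
  "(\<Sum>(d, A, B)\<in>durfee_triples n. int (size A) * int (size A) - int (size A) * int (size B)) =
    (\<Sum>i=1..n. \<Sum>k=1..n. int k * int (extend_count (replicate_mset k i) n))"
proof -
  let ?S = "{1..n} \<times> {1..n}"
  define r where "r = (\<lambda>(i::nat, k::nat). replicate_mset k i)"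
  define r2 where "r2 = (\<lambda>x y. if fst x = fst y then replicate_mset (max (snd x) (snd y)) (fst x) else r x + r y)"
  have props: "0 \<notin># A" "0 \<notin># B" "sum_mset A \<le> n" "sum_mset B \<le> n"
    if "(d, A, B) \<in> durfee_triples n" for d A B
    using that by (auto simp: durfee_triples_def)
  have r: "k \<le> count A i \<longleftrightarrow> r (i, k) \<subseteq># A" for k i A
    by (simp add: r_def count_le_replicate_mset_subset_eq)
  have r2: "r x \<subseteq># A \<and> r y \<subseteq># A \<longleftrightarrow> r2 x y \<subseteq># A" for x y A
    by (cases x; cases y) (auto simp: r_def r2_def replicate_two_subset_iff count_le_replicate_mset_subset_eq[symmetric])
  have AA: "(\<Sum>(d, A, B)\<in>durfee_triples n. int (size A) * int (size A)) =
     (\<Sum>(d, A, B)\<in>durfee_triples n. \<Sum>x\<in>?S. \<Sum>y\<in>?S. of_bool (r2 x y \<subseteq># A \<and> {#} \<subseteq># B))"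
  proof (rule sum.cong[OF refl], clarify, goal_cases)
    case (1 d A B)
    have "int (size A) = (\<Sum>x\<in>?S. of_bool (r x \<subseteq># A))"
      unfolding size_eq_sum_thresholds[OF props(1,3)[OF 1]] by (rule sum.cong) (auto simp: r)
    then show ?case by (simp add: sum_product of_bool_conj[symmetric] r2 del: sum_of_bool_eq)
  qed
  have AB: "(\<Sum>(d, A, B)\<in>durfee_triples n. int (size A) * int (size B)) =
     (\<Sum>(d, A, B)\<in>durfee_triples n. \<Sum>x\<in>?S. \<Sum>y\<in>?S. of_bool (r x \<subseteq># A \<and> r y \<subseteq># B))"
  proof (rule sum.cong[OF refl], clarify, goal_cases)
    case (1 d A B)
    have "int (size A) = (\<Sum>x\<in>?S. of_bool (r x \<subseteq># A))"
      unfolding size_eq_sum_thresholds[OF props(1,3)[OF 1]] by (rule sum.cong) (auto simp: r)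
    moreover have "int (size B) = (\<Sum>x\<in>?S. of_bool (r x \<subseteq># B))"
      unfolding size_eq_sum_thresholds[OF props(2,4)[OF 1]] by (rule sum.cong) (auto simp: r)
    ultimately show ?case by (simp add: sum_product of_bool_conj[symmetric] del: sum_of_bool_eq)
  qed
  define e where "e C = int (extend_count C n)" for C
  have "(\<Sum>(d, A, B)\<in>durfee_triples n. int (size A) * int (size A) - int (size A) * int (size B)) =
     (\<Sum>x\<in>?S. \<Sum>y\<in>?S. e (r2 x y) - e (r x + r y))"
    using AA[unfolded sum_triple_thresholds] AB[unfolded sum_triple_thresholds]
    by (simp add: sum_subtractf case_prod_beta e_def)
  also have "\<dots> = (\<Sum>i=1..n. \<Sum>k=1..n. \<Sum>j=1..n. \<Sum>l=1..n. e (r2 (i, k) (j, l)) - e (r (i, k) + r (j, l)))"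
    by (simp only: sum.cartesian_product')
  also have "\<dots> = (\<Sum>i=1..n. \<Sum>k=1..n. int k * e (replicate_mset k i))"
  proof (intro sum.cong refl)
    fix i k assume ik: "i \<in> {1..n}" "k \<in> {1..n}"
    have "(\<Sum>j=1..n. \<Sum>l=1..n. e (r2 (i, k) (j, l)) - e (r (i, k) + r (j, l))) =
      (\<Sum>j=1..n. if j = i then \<Sum>l=1..n. e (replicate_mset (max k l) i) - e (replicate_mset (k + l) i) else 0)"
      by (intro sum.cong refl) (auto simp: r2_def r_def replicate_mset_add add.commute)
    also have "\<dots> = (\<Sum>l=1..n. e (replicate_mset (max k l) i) - e (replicate_mset (k + l) i))"
      using ik by simp
    also have "\<dots> = int k * e (replicate_mset k i)"
      using ik by (intro sum_thresholds_max_add) (auto simp: e_def extend_count_eq_0)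
    finally show "(\<Sum>j=1..n. \<Sum>l=1..n. e (r2 (i, k) (j, l)) - e (r (i, k) + r (j, l))) = \<dots>" .
  qed
  finally show ?thesis by (simp add: e_def)
qed

lemma sum_thresholds_truncate:
  fixes i n :: nat
  assumes "i \<ge> 1"
  shows "(\<Sum>k=1..n. if i * k \<le> n then f k else 0) = (\<Sum>k=1..n div i. f k :: 'a :: comm_monoid_add)"
proof -
  have "(\<Sum>k=1..n. if i * k \<le> n then f k else 0) = (\<Sum>k\<in>{1..n} \<inter> {k. i * k \<le> n}. f k)"
    by (simp add: sum.If_cases)
  also have "{1..n} \<inter> {k. i * k \<le> n} = {1..n div i}"
  proof -
    have "i * k \<le> n \<longleftrightarrow> k \<le> n div i" for k
      using assms by (simp add: less_eq_div_iff_mult_less_eq mult.commute)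
    moreover have "n div i \<le> n" by simp
    ultimately show ?thesis using order_trans by fastforce
  qed
  finally show ?thesis .
qed

lemma swap_triple_sum:
  "(\<Sum>(d, A, B)\<in>durfee_triples n. f A B) = (\<Sum>(d, A, B)\<in>durfee_triples n. f B A)"
  by (rule sum.reindex_bij_witness[of _ "\<lambda>(d, A, B). (d, B, A)" "\<lambda>(d, A, B). (d, B, A)"])
     (auto simp: durfee_triples_def)

text \<open>Grouping the partitions by their rank removes the counting function.\<close>

lemma eta2_eq_sum_rank:
  "eta2 n = (\<Sum>p\<in>partitions_of n. partition_rank p * (partition_rank p - 1) div 2)"
proof -
  let ?f = "\<lambda>m::int. m * (m - 1) div 2"
  let ?R = "partition_rank ` partitions_of n"
  have sub: "{m. ?f m * int (rank_count m n) \<noteq> 0} \<subseteq> ?R"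
    by (auto simp: rank_count_def card_eq_0_iff)
  have "eta2 n = (\<Sum>m\<in>?R. ?f m * int (rank_count m n))"
    unfolding eta2_def by (rule Sum_any.expand_superset[OF _ sub]) (simp add: finite_partitions_of)
  also have "\<dots> = (\<Sum>m\<in>?R. \<Sum>p\<in>{p \<in> partitions_of n. partition_rank p = m}. ?f (partition_rank p))"
    by (intro sum.cong) (auto simp: rank_count_def mult.commute)
  also have "\<dots> = (\<Sum>p\<in>partitions_of n. ?f (partition_rank p))"
    by (rule sum.group) (auto simp: finite_partitions_of)
  finally show ?thesis .
qed

text \<open>In terms of triples, $2 \eta_2(n)$ is the sum of $(|A|-|B|)^2 - (|A|-|B|)$. The linear part vanishes by the symmetry between $A$
and $B$, and the quadratic part is twice the sum evaluated above. A triple with $k$ prescribed copies of $i$ is a triple for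
$n - ik$ whose side is at least $i$.\<close>

theorem eta2_eq_durfee_sum:
  "eta2 n = (\<Sum>i=1..n. \<Sum>k=1..n div i. int k * int (card {t \<in> durfee_triples (n - i * k). i \<le> fst t}))"
proof -
  let ?T = "durfee_triples n"
  have dbl: "2 * (m * (m - 1) div 2) = m * (m - 1)" for m :: int
    by (rule dvd_mult_div_cancel) auto
  have "2 * eta2 n = (\<Sum>p\<in>partitions_of n. partition_rank p * (partition_rank p - 1))"
    unfolding eta2_eq_sum_rank sum_distrib_left dbl ..
  also have "\<dots> = (\<Sum>(d, A, B)\<in>?T. (int (size A) - int (size B)) * (int (size A) - int (size B) - 1))"
    by (rule sum_rank_eq)
  also have "\<dots> = (\<Sum>(d, A, B)\<in>?T. int (size A) * int (size A) - int (size A) * int (size B)) +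
     (\<Sum>(d, A, B)\<in>?T. int (size B) * int (size B) - int (size B) * int (size A)) +
     ((\<Sum>(d, A, B)\<in>?T. int (size B)) - (\<Sum>(d, A, B)\<in>?T. int (size A)))"
    by (simp add: sum.distrib[symmetric] sum_subtractf[symmetric] case_prod_beta algebra_simps)
  also have "(\<Sum>(d, A, B)\<in>?T. int (size B) * int (size B) - int (size B) * int (size A)) =
      (\<Sum>(d, A, B)\<in>?T. int (size A) * int (size A) - int (size A) * int (size B))"
    by (rule swap_triple_sum)
  also have "(\<Sum>(d, A, B)\<in>?T. int (size B)) = (\<Sum>(d, A, B)\<in>?T. int (size A))"
    by (rule swap_triple_sum)
  finally have "eta2 n = (\<Sum>(d, A, B)\<in>?T. int (size A) * int (size A) - int (size A) * int (size B))"
    by simp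
  also have "\<dots> = (\<Sum>i=1..n. \<Sum>k=1..n. if i * k \<le> n then
      int k * int (card {t \<in> durfee_triples (n - i * k). i \<le> fst t}) else 0)"
    unfolding sum_size_products by (intro sum.cong refl) (auto simp: extend_count_replicate)
  also have "\<dots> = (\<Sum>i=1..n. \<Sum>k=1..n div i. int k * int (card {t \<in> durfee_triples (n - i * k). i \<le> fst t}))"
    by (intro sum.cong refl sum_thresholds_truncate) auto
  finally show ?thesis .
qed

section \<open>The total size of all partitions as a weighted partition count\<close>

lemma card_partitions_containing:
  assumes "i \<ge> 1"
  shows "card {p \<in> partitions_of n. k \<le> count p i} = (if i * k \<le> n then num_partitions (n - i * k) else 0)"
proof (cases "i * k \<le> n")
  case True
  have "bij_betw (\<lambda>p. p + replicate_mset k i) (partitions_of (n - i * k)) {p \<in> partitions_of n. k \<le> count p i}"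
    by (rule bij_betw_byWitness[where f' = "\<lambda>p. p - replicate_mset k i"])
       (use assms True in \<open>auto split: if_splits simp: partitions_of_def mult.commute count_le_replicate_mset_subset_eq
          sum_mset.distrib mset_subset_eq_exists_conv\<close>)
  from bij_betw_same_card[OF this] show ?thesis using True by (simp add: num_partitions_def)
next
  case False
  have "i * k \<le> n" if p: "p \<in> partitions_of n" and c: "k \<le> count p i" for p
  proof -
    obtain q where "p = replicate_mset k i + q"
      using c by (auto simp: count_le_replicate_mset_subset_eq mset_subset_eq_exists_conv)
    then show ?thesis using p by (auto simp: partitions_of_def mult.commute)
  qed
  then have "{p \<in> partitions_of n. k \<le> count p i} = {}" using False by blast
  then show ?thesis using False by (simp only: if_False card.empty)
qed

lemma sum_mset_eq_sum_count:
  "set_mset p \<subseteq> S \<Longrightarrow> finite S \<Longrightarrow> sum_mset p = (\<Sum>i\<in>S. i * count p i)" for p :: "nat multiset"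
proof (induction p)
  case (add x p)
  have "(\<Sum>i\<in>S. i * count (add_mset x p) i) = (\<Sum>i\<in>S. i * count p i + (if i = x then x else 0))"
    by (intro sum.cong) auto
  then show ?case using add by (simp add: sum.distrib)
qed simp

text \<open>Both sides sum all parts of all partitions of $n$: on the right a part size $i$ is counted once for every $k$ such that it occurs
at least $k$ times.\<close>

theorem n_num_partitions:
  "n * num_partitions n = (\<Sum>i=1..n. \<Sum>k=1..n div i. i * num_partitions (n - i * k))"
proof -
  have "n = (\<Sum>i=1..n. \<Sum>k=1..n. i * of_bool (k \<le> count p i))" if p: "p \<in> partitions_of n" for p
  proof -
    have p: "0 \<notin># p" "sum_mset p = n" using p by (auto simp: partitions_of_def)
    have sz: "size p \<le> n" using size_le_sum_mset[OF p(1)] p(2) by simp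
    have sub: "set_mset p \<subseteq> {1..n}"
    proof
      fix x assume x: "x \<in># p"
      then have "x \<le> sum_mset p" by (rule elem_le_sum_mset)
      then show "x \<in> {1..n}" using p x by (cases x) auto
    qed
    have cnt: "(\<Sum>k=1..n. of_bool (k \<le> count p i)) = count p i" for i
    proof -
      have "count p i \<le> n" using sz count_le_size[of p i] by simp
      then have "{1..n} \<inter> {k. k \<le> count p i} = {1..count p i}" by auto
      then show ?thesis by (simp add: of_bool_def sum.If_cases)
    qed
    have "sum_mset p = (\<Sum>i=1..n. i * count p i)"
      using sub by (rule sum_mset_eq_sum_count) simp
    then show ?thesis using p by (simp only: sum_distrib_left[symmetric] cnt)
  qed
  then have "n * num_partitions n = (\<Sum>p\<in>partitions_of n. \<Sum>i=1..n. \<Sum>k=1..n. i * of_bool (k \<le> count p i))"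
    by (simp add: num_partitions_def mult.commute)
  also have "\<dots> = (\<Sum>i=1..n. \<Sum>p\<in>partitions_of n. \<Sum>k=1..n. i * of_bool (k \<le> count p i))"
    by (rule sum.swap)
  also have "\<dots> = (\<Sum>i=1..n. \<Sum>k=1..n. \<Sum>p\<in>partitions_of n. i * of_bool (k \<le> count p i))"
    by (intro sum.cong refl sum.swap)
  also have "\<dots> = (\<Sum>i=1..n. \<Sum>k=1..n. i * card {p \<in> partitions_of n. k \<le> count p i})"
    by (intro sum.cong refl)
       (simp add: sum_distrib_left[symmetric] of_bool_def sum.If_cases finite_partitions_of Int_def)
  also have "\<dots> = (\<Sum>i=1..n. \<Sum>k=1..n. if i * k \<le> n then i * num_partitions (n - i * k) else 0)"
    by (intro sum.cong refl) (auto simp: card_partitions_containing)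
  also have "\<dots> = (\<Sum>i=1..n. \<Sum>k=1..n div i. i * num_partitions (n - i * k))"
    by (intro sum.cong refl sum_thresholds_truncate) auto
  finally show ?thesis .
qed

lemma swap_divisor_sum:
  fixes n :: nat
  shows "(\<Sum>i=1..n. \<Sum>k=1..n div i. f i k) = (\<Sum>i=1..n. \<Sum>k=1..n div i. f k i :: 'a :: comm_monoid_add)"
proof -
  have "(\<Sum>i=1..n. \<Sum>k=1..n div i. f i k) = (\<Sum>i=1..n. \<Sum>k=1..n. if i * k \<le> n then f i k else 0)"
    by (intro sum.cong refl sum_thresholds_truncate[symmetric]) auto
  also have "\<dots> = (\<Sum>k=1..n. \<Sum>i=1..n. if i * k \<le> n then f i k else 0)" by (rule sum.swap)
  also have "\<dots> = (\<Sum>k=1..n. \<Sum>i=1..n. if k * i \<le> n then f i k else 0)" by (simp add: mult.commute)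
  also have "\<dots> = (\<Sum>k=1..n. \<Sum>i=1..n div k. f i k)"
    by (intro sum.cong refl sum_thresholds_truncate) auto
  finally show ?thesis .
qed

definition divisor_sum :: "nat \<Rightarrow> nat" where
  "divisor_sum m = (\<Sum>d | d dvd m. d)"

text \<open>Collecting the pairs $(i,k)$ with the same product $m = ik$ produces the sum of the divisors $i$ of $m$.\<close>

theorem num_partitions_recurrence:
  "n * num_partitions n = (\<Sum>m=1..n. divisor_sum m * num_partitions (n - m))"
proof -
  have "n * num_partitions n = (\<Sum>i=1..n. \<Sum>k=1..n. if i * k \<le> n then i * num_partitions (n - i * k) else 0)"
    unfolding n_num_partitions by (intro sum.cong refl sum_thresholds_truncate[symmetric]) auto
  also have "\<dots> = (\<Sum>(i, k)\<in>({1..n}\<times>{1..n}) \<inter> {(i, k). i * k \<le> n}. i * num_partitions (n - i * k))"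
    unfolding sum.cartesian_product by (simp add: sum.If_cases case_prod_beta Int_def)
  also have "\<dots> = (\<Sum>(m, d)\<in>Sigma {1..n} (\<lambda>m. {d. d dvd m}). d * num_partitions (n - m))"
  proof (rule sum.reindex_bij_witness[of _ "\<lambda>(m, d). (d, m div d)" "\<lambda>(i, k). (i * k, i)"])
    fix y assume "y \<in> Sigma {1..n} (\<lambda>m. {d. d dvd m})"
    then obtain d e where y: "y = (d * e, d)" "d * e \<in> {1..n}" by (auto elim!: dvdE)
    then have pos: "d > 0" "e > 0" by (auto intro: gr0I)
    then have "d \<le> d * e" "e \<le> d * e" by simp_all
    moreover have "d * e \<le> n" using y(2) by simp
    ultimately have "d \<le> n" "e \<le> n" by linarith+
    with y pos show "(case case y of (m, d) \<Rightarrow> (d, m div d) of (i, k) \<Rightarrow> (i * k, i)) = y"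
      and "(case y of (m, d) \<Rightarrow> (d, m div d)) \<in> ({1..n}\<times>{1..n}) \<inter> {(i, k). i * k \<le> n}"
      by auto
  qed auto
  also have "\<dots> = (\<Sum>m=1..n. divisor_sum m * num_partitions (n - m))"
    by (subst sum.Sigma[symmetric]) (auto simp: divisor_sum_def sum_distrib_right)
  finally show ?thesis .
qed

section \<open>Comparison of the second rank moment with the total size\<close>

lemma num_partitions_0 [simp]: "num_partitions 0 = 1"
proof -
  have "p = {#}" if "0 \<notin># p" "sum_mset p = 0" for p :: "nat multiset"
    using size_le_sum_mset[OF that(1)] that(2) by simp
  then have "partitions_of 0 = {{#}}"
    by (auto simp: partitions_of_def)
  then show ?thesis by (simp add: num_partitions_def)
qed

lemma num_partitions_Suc_mono: "num_partitions n \<le> num_partitions (Suc n)"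
  unfolding num_partitions_def
  by (rule card_inj_on_le[where f = "add_mset 1"])
     (auto simp: inj_on_def partitions_of_def finite_partitions_of[unfolded partitions_of_def])

lemma num_partitions_mono: "m \<le> n \<Longrightarrow> num_partitions m \<le> num_partitions n"
  by (rule lift_Suc_mono_le[of num_partitions]) (rule num_partitions_Suc_mono)

lemma num_partitions_pos: "num_partitions n > 0"
  using num_partitions_mono[of 0 n] by simp

text \<open>The pairs $(i,k)$ enter symmetrically, so the weight may be put on the multiplicity, as in the formula for $\eta_2$.\<close>

lemma n_num_partitions':
  "n * num_partitions n = (\<Sum>i=1..n. \<Sum>k=1..n div i. k * num_partitions (n - i * k))"
  unfolding n_num_partitions
  by (subst swap_divisor_sum) (simp add: mult.commute)

text \<open>These are the terms with $i = 1$ of the preceding sum.\<close>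

lemma sum_weighted_num_partitions_le:
  "(\<Sum>k<n. real (Suc k) * real (num_partitions (n - Suc k))) \<le> real n * real (num_partitions n)"
proof (cases "n = 0")
  case False
  have "(\<Sum>k<n. Suc k * num_partitions (n - Suc k)) = (\<Sum>k=1..n div 1. k * num_partitions (n - 1 * k))"
    by (simp add: sum.atLeast1_atMost_eq)
  also have "\<dots> \<le> (\<Sum>i=1..n. \<Sum>k=1..n div i. k * num_partitions (n - i * k))"
    by (rule member_le_sum) (use False in auto)
  also have "\<dots> = n * num_partitions n" by (rule n_num_partitions'[symmetric])
  finally have "real (\<Sum>k<n. Suc k * num_partitions (n - Suc k)) \<le> real (n * num_partitions n)"
    by (rule of_nat_mono)
  then show ?thesis by (simp only: of_nat_sum of_nat_mult)
qed simp

text \<open>Up to $k = \sqrt n$ every term is at most $p(n)$; beyond it, the factor $k / \sqrt n \geq 1$ can be inserted and the weighted sum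
applies. The point is that the bound is smaller than $n\,p(n)$ by a power of $n$, which absorbs a harmonic sum later on.\<close>

lemma sum_num_partitions_le:
  "(\<Sum>k<n. real (num_partitions (n - Suc k))) \<le> 2 * sqrt (real n) * real (num_partitions n)"
proof (cases "n = 0")
  case False
  define s where "s = sqrt (real n)"
  have s: "s > 0" "s * s = real n" using False by (auto simp: s_def)
  have "(\<Sum>k<n. real (num_partitions (n - Suc k))) \<le>
     (\<Sum>k<n. (if real (Suc k) \<le> s then real (num_partitions n) else 0) +
        real (Suc k) * real (num_partitions (n - Suc k)) / s)"
  proof (rule sum_mono)
    fix k
    have "real (num_partitions (n - Suc k)) \<le> real (num_partitions n)"
      by (simp add: num_partitions_mono)
    moreover have "real (num_partitions (n - Suc k)) \<le> real (Suc k) * real (num_partitions (n - Suc k)) / s"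
      if "\<not> real (Suc k) \<le> s"
    proof -
      have "s * real (num_partitions (n - Suc k)) \<le> real (Suc k) * real (num_partitions (n - Suc k))"
        using that by (intro mult_right_mono) auto
      then show ?thesis using s by (simp add: pos_le_divide_eq mult.commute)
    qed
    ultimately show "real (num_partitions (n - Suc k)) \<le> (if real (Suc k) \<le> s then real (num_partitions n) else 0) +
        real (Suc k) * real (num_partitions (n - Suc k)) / s"
      using s by (auto intro: add_increasing2)
  qed
  also have "\<dots> = real (card ({..<n} \<inter> {k. real (Suc k) \<le> s})) * real (num_partitions n) +
      (\<Sum>k<n. real (Suc k) * real (num_partitions (n - Suc k))) / s"
    by (simp add: sum.distrib sum.If_cases sum_divide_distrib)
  also have "\<dots> \<le> s * real (num_partitions n) + real n * real (num_partitions n) / s"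
  proof (intro add_mono mult_right_mono divide_right_mono sum_weighted_num_partitions_le)
    have "{..<n} \<inter> {k. real (Suc k) \<le> s} \<subseteq> {..<nat \<lfloor>s\<rfloor>}"
      by (auto simp: Suc_le_eq[symmetric] le_nat_floor)
    from card_mono[OF _ this] have "real (card ({..<n} \<inter> {k. real (Suc k) \<le> s})) \<le> real (nat \<lfloor>s\<rfloor>)"
      by simp
    also have "\<dots> \<le> s" using s by (simp add: of_nat_floor)
    finally show "real (card ({..<n} \<inter> {k. real (Suc k) \<le> s})) \<le> s" .
  qed (use s in auto)
  also have "\<dots> = 2 * s * real (num_partitions n)"
    using s by (simp add: field_simps s(2)[symmetric])
  finally show ?thesis by (simp add: s_def)
qed simp

text \<open>By monotonicity $p(n - ik)$ is at most the average of $p(n - m)$ over the $i$ values $m \leq ik$ that follow $i(k-1)$, and there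
$k \leq m/i + 1$. Averaging costs a factor $1/i$ and the weight another one, so the main term has the factor $1/i^2$, which is
summable over $i$.\<close>

lemma sum_progression_le:
  assumes "i \<ge> 1"
  shows "(\<Sum>k=1..n div i. real k * real (num_partitions (n - i * k))) \<le>
     real n * real (num_partitions n) / (real i)\<^sup>2 + 2 * sqrt (real n) * real (num_partitions n) / real i"
proof -
  let ?p = "\<lambda>m. real (num_partitions m)"
  let ?F = "\<lambda>m. (real (Suc m) / real i + 1) * ?p (n - Suc m)"
  have step: "real i * (real (Suc k) * ?p (n - i * Suc k)) \<le> (\<Sum>m\<in>{k*i..<k*i+i}. ?F m)" for k
  proof -
    have "(\<Sum>m\<in>{k*i..<k*i+i}. real (Suc k) * ?p (n - i * Suc k)) \<le> (\<Sum>m\<in>{k*i..<k*i+i}. ?F m)"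
    proof (intro sum_mono mult_mono)
      fix m assume m: "m \<in> {k*i..<k*i+i}"
      then have "real (k * i) \<le> real (Suc m)" by (intro of_nat_mono) auto
      then show "real (Suc k) \<le> real (Suc m) / real i + 1" using assms by (simp add: field_simps)
      show "?p (n - i * Suc k) \<le> ?p (n - Suc m)"
        using m by (intro of_nat_mono num_partitions_mono diff_le_mono2) (auto simp: algebra_simps)
    qed auto
    then show ?thesis by simp
  qed
  have "real i * (\<Sum>k=1..n div i. real k * ?p (n - i * k)) =
      (\<Sum>k<n div i. real i * (real (Suc k) * ?p (n - i * Suc k)))"
    by (simp add: sum.atLeast1_atMost_eq sum_distrib_left)
  also have "\<dots> \<le> (\<Sum>k<n div i. \<Sum>m\<in>{k*i..<k*i+i}. ?F m)" by (rule sum_mono) (rule step)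
  also have "\<dots> = (\<Sum>m<n div i * i. ?F m)" by (rule sum.nat_group)
  also have "\<dots> \<le> (\<Sum>m<n. ?F m)"
    by (rule sum_mono2) (auto intro: less_le_trans)
  also have "\<dots> = (\<Sum>m<n. real (Suc m) * ?p (n - Suc m)) / real i + (\<Sum>m<n. ?p (n - Suc m))"
    by (simp add: sum.distrib sum_divide_distrib algebra_simps add_divide_distrib)
  also have "\<dots> \<le> real n * ?p n / real i + 2 * sqrt (real n) * ?p n"
    by (intro add_mono divide_right_mono sum_weighted_num_partitions_le sum_num_partitions_le) auto
  finally show ?thesis using assms by (simp add: field_simps power2_eq_square)
qed

text \<open>A triple of side less than $J$ is determined by its side and by the multiplicities of the parts $1..J$ in both components, each of
which is at most $m$.\<close>

lemma card_small_durfee_le: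
  "card {t \<in> durfee_triples m. fst t < J} \<le> J * (m + 1) ^ (2 * J)"
proof -
  let ?P = "PiE {1..J} (\<lambda>_. {..m})"
  let ?f = "\<lambda>(d :: nat, A :: nat multiset, B :: nat multiset). (d, restrict (count A) {1..J}, restrict (count B) {1..J})"
  have cnt: "count A i \<le> m \<and> count B i \<le> m" if "(d, A, B) \<in> durfee_triples m" for d A B i
  proof -
    have "0 \<notin># A" "0 \<notin># B" "sum_mset A \<le> m" "sum_mset B \<le> m" using that by (auto simp: durfee_triples_def)
    then show ?thesis using size_le_sum_mset[of A] size_le_sum_mset[of B] count_le_size[of A i] count_le_size[of B i]
      by linarith
  qed
  have "inj_on ?f {t \<in> durfee_triples m. fst t < J}"
  proof (rule inj_onI)
    fix s t
    assume s: "s \<in> {t \<in> durfee_triples m. fst t < J}" and t: "t \<in> {t \<in> durfee_triples m. fst t < J}"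
      and eq: "?f s = ?f t"
    obtain d A B where sd: "s = (d, A, B)" by (cases s)
    obtain A' B' where td: "t = (d, A', B')" using eq by (cases t) (simp add: sd)
    have "C = C'" if "set_mset C \<subseteq> {1..d}" "set_mset C' \<subseteq> {1..d}"
      "restrict (count C) {1..J} = restrict (count C') {1..J}" for C C'
    proof (rule multiset_eqI)
      fix x show "count C x = count C' x"
      proof (cases "x \<in> {1..J}")
        case True
        have "restrict (count C) {1..J} x = restrict (count C') {1..J} x" by (simp only: that(3))
        with True show ?thesis by simp
      next
        case False
        then have "x \<notin># C" "x \<notin># C'" using that(1,2) s by (auto simp: sd)
        then show ?thesis by (simp add: not_in_iff)
      qed
    qed
    then show "s = t" using s t eq by (simp add: sd td durfee_triples_def)
  qed
  moreover have "?f ` {t \<in> durfee_triples m. fst t < J} \<subseteq> {..<J} \<times> ?P \<times> ?P"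
    using cnt by auto
  moreover have "finite ({..<J} \<times> ?P \<times> ?P)" by (auto intro!: finite_PiE)
  ultimately have "card {t \<in> durfee_triples m. fst t < J} \<le> card ({..<J} \<times> ?P \<times> ?P)"
    by (rule card_inj_on_le)
  also have "\<dots> = J * (m + 1) ^ (2 * J)"
    by (simp add: card_cartesian_product card_PiE power_add[symmetric] mult_2)
  finally show ?thesis .
qed

text \<open>Classify the partitions of $n - ik$ by their Durfee side. The difference is the number usually called $\mathrm{spt}(n)$.\<close>

lemma n_num_partitions_minus_eta2:
  "int (n * num_partitions n) - eta2 n =
     int (\<Sum>i=1..n. \<Sum>k=1..n div i. k * card {t \<in> durfee_triples (n - i * k). fst t < i})"
proof -
  have split: "num_partitions m = card {t \<in> durfee_triples m. i \<le> fst t} + card {t \<in> durfee_triples m. fst t < i}" for m i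
  proof -
    have "card ({t \<in> durfee_triples m. i \<le> fst t} \<union> {t \<in> durfee_triples m. fst t < i}) =
        card {t \<in> durfee_triples m. i \<le> fst t} + card {t \<in> durfee_triples m. fst t < i}"
      by (rule card_Un_disjoint) auto
    moreover have "{t \<in> durfee_triples m. i \<le> fst t} \<union> {t \<in> durfee_triples m. fst t < i} = durfee_triples m"
      by auto
    ultimately show ?thesis by (simp add: card_durfee_triples)
  qed
  have "n * num_partitions n = (\<Sum>i=1..n. \<Sum>k=1..n div i.
      k * (card {t \<in> durfee_triples (n - i * k). i \<le> fst t} + card {t \<in> durfee_triples (n - i * k). fst t < i}))"
    unfolding n_num_partitions' by (intro sum.cong refl arg_cong2[of _ _ _ _ "(*)"] split)
  then show ?thesis
    unfolding eta2_eq_durfee_sum by (simp add: distrib_left sum.distrib)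
qed

lemma sum_inverse_squares_tail: "J \<ge> 1 \<Longrightarrow> (\<Sum>i=Suc J..n. 1 / (real i)\<^sup>2) \<le> 1 / real J"
proof (cases "J \<le> n")
  case True
  assume J: "J \<ge> 1"
  have "(\<Sum>i=Suc J..n. 1 / (real i)\<^sup>2) \<le> 1 / real J - 1 / real n"
    using True
  proof (induction n rule: dec_induct)
    case (step n)
    have "1 / (real (Suc n))\<^sup>2 \<le> 1 / real n - 1 / real (Suc n)"
    proof -
      have "1 / (real (Suc n))\<^sup>2 \<le> 1 / (real n * real (Suc n))"
        using J step unfolding power2_eq_square by (intro divide_left_mono mult_right_mono) auto
      also have "\<dots> = 1 / real n - 1 / real (Suc n)" using J step by (simp add: field_simps)
      finally show ?thesis .
    qed
    then show ?case using step by simp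
  qed simp
  then show ?thesis by (smt (verit) of_nat_0_le_iff zero_le_divide_1_iff)
qed auto

lemma sum_inverse_le: "n \<ge> 1 \<Longrightarrow> (\<Sum>i=1..n. 1 / real i) \<le> 1 + ln (real n)"
proof (induction n rule: dec_induct)
  case (step n)
  have "1 / real (Suc n) \<le> ln (real (Suc n)) - ln (real n)"
    using ln_le_minus_one[of "real n / real (Suc n)"] step
    by (simp add: ln_div field_simps)
  then show ?case using step by simp
qed simp

text \<open>The terms with $i \leq J$ are bounded by the number of partitions with small Durfee side, those with $i > J$ by the estimate for
progressions; the three summands on the right are the polynomial part and the tails of $\sum 1/i^2$ and of $\sum 1/i$.\<close>

lemma eta2_deficiency_le:
  assumes "J \<ge> 1" "n \<ge> J"
  shows "real n * real (num_partitions n) - real_of_int (eta2 n) \<le>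
    real (J * n\<^sup>2 * (J * (n + 1) ^ (2 * J))) + (1 / real J) * (real n * real (num_partitions n)) +
    (1 + ln (real n)) * (2 * sqrt (real n) * real (num_partitions n))"
proof -
  let ?p = "\<lambda>m. real (num_partitions m)"
  let ?c = "\<lambda>i k. card {t \<in> durfee_triples (n - i * k). fst t < i}"
  let ?G = "\<lambda>i. \<Sum>k=1..n div i. real k * real (?c i k)"
  have "real n * ?p n - real_of_int (eta2 n) = real_of_int (int (n * num_partitions n) - eta2 n)"
    by simp
  also have "\<dots> = (\<Sum>i=1..n. ?G i)"
    unfolding n_num_partitions_minus_eta2 by simp
  also have "{1..n} = {1..J} \<union> {Suc J..n}" using assms by auto
  also have "(\<Sum>i\<in>{1..J} \<union> {Suc J..n}. ?G i) = (\<Sum>i=1..J. ?G i) + (\<Sum>i=Suc J..n. ?G i)"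
    by (rule sum.union_disjoint) auto
  also have "(\<Sum>i=1..J. ?G i) \<le> (\<Sum>i=1..J. real (n\<^sup>2 * (J * (n + 1) ^ (2 * J))))"
  proof (rule sum_mono)
    fix i assume i: "i \<in> {1..J}"
    have "?c i k \<le> J * (n + 1) ^ (2 * J)" for k
    proof -
      have "?c i k \<le> card {t \<in> durfee_triples (n - i * k). fst t < J}"
        by (rule card_mono) (use i in auto)
      also have "\<dots> \<le> J * (n - i * k + 1) ^ (2 * J)" by (rule card_small_durfee_le)
      also have "\<dots> \<le> J * (n + 1) ^ (2 * J)" by (intro mult_left_mono power_mono) auto
      finally show ?thesis .
    qed
    then have "(\<Sum>k=1..n div i. k * ?c i k) \<le> (\<Sum>k=1..n div i. n * (J * (n + 1) ^ (2 * J)))"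
      using div_le_dividend[of n i] by (intro sum_mono mult_mono) (auto intro: order_trans)
    also have "\<dots> \<le> n * (n * (J * (n + 1) ^ (2 * J)))"
      using div_le_dividend[of n i] by (simp add: mult_right_mono)
    finally have "real (\<Sum>k=1..n div i. k * ?c i k) \<le> real (n * (n * (J * (n + 1) ^ (2 * J))))"
      by (rule of_nat_mono)
    then show "?G i \<le> real (n\<^sup>2 * (J * (n + 1) ^ (2 * J)))"
      by (simp only: of_nat_sum of_nat_mult power2_eq_square mult.assoc)
  qed
  also have "(\<Sum>i=Suc J..n. ?G i) \<le> (\<Sum>i=Suc J..n. 1 / (real i)\<^sup>2 * (real n * ?p n) + 1 / real i * (2 * sqrt (real n) * ?p n))"
  proof (rule sum_mono)
    fix i assume i: "i \<in> {Suc J..n}"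
    have "?c i k \<le> num_partitions (n - i * k)" for k
      unfolding card_durfee_triples[symmetric] by (rule card_mono) auto
    then have "?G i \<le> (\<Sum>k=1..n div i. real k * ?p (n - i * k))"
      by (intro sum_mono mult_left_mono of_nat_mono) auto
    also have "\<dots> \<le> real n * ?p n / (real i)\<^sup>2 + 2 * sqrt (real n) * ?p n / real i"
      using i by (intro sum_progression_le) auto
    finally show "?G i \<le> 1 / (real i)\<^sup>2 * (real n * ?p n) + 1 / real i * (2 * sqrt (real n) * ?p n)"
      by simp
  qed
  also have "\<dots> = (\<Sum>i=Suc J..n. 1 / (real i)\<^sup>2) * (real n * ?p n) + (\<Sum>i=Suc J..n. 1 / real i) * (2 * sqrt (real n) * ?p n)"
    unfolding sum.distrib sum_distrib_right ..
  also have "\<dots> \<le> (1 / real J) * (real n * ?p n) + (1 + ln (real n)) * (2 * sqrt (real n) * ?p n)"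
  proof (intro add_mono mult_right_mono sum_inverse_squares_tail)
    have "(\<Sum>i=Suc J..n. 1 / real i) \<le> (\<Sum>i=1..n. 1 / real i)" by (rule sum_mono2) auto
    also have "\<dots> \<le> 1 + ln (real n)" using assms by (intro sum_inverse_le) auto
    finally show "(\<Sum>i=Suc J..n. 1 / real i) \<le> 1 + ln (real n)" .
  qed (use assms in auto)
  finally show ?thesis by (simp add: mult.assoc)
qed

text \<open>For fixed $J$ the bound of the preceding lemma, divided by $n\,p(n)$, has limit $1/J$, and $J$ is arbitrary.\<close>

theorem eta2_asymp_n_num_partitions:
  assumes superpoly: "\<And>m. (\<lambda>n. real n ^ m / real (num_partitions n)) \<longlonglongrightarrow> 0"
  shows "(\<lambda>n. real_of_int (eta2 n) / (real n * real (num_partitions n))) \<longlonglongrightarrow> 1"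
proof (rule LIMSEQ_I)
  fix e :: real assume e: "e > 0"
  \<comment> \<open>Then $1/J \<le> e/2$, and the other half of $e$ is left for the terms of smaller order.\<close>
  define J where "J = nat \<lceil>2 / e\<rceil> + 1"
  have "2 / e \<le> real J" unfolding J_def by linarith
  moreover have "J \<ge> 1" by (simp add: J_def)
  ultimately have J: "J \<ge> 1" "1 / real J \<le> e / 2"
    using e by (auto simp: field_simps)
  define R where "R n = real (J * n\<^sup>2 * (J * (n + 1) ^ (2 * J))) / (real n * real (num_partitions n)) +
     (1 + ln (real n)) * (2 * sqrt (real n)) / real n" for n
  have "R \<longlonglongrightarrow> 0"
  proof -
    have "(\<lambda>n. (real (J * n\<^sup>2 * (J * (n + 1) ^ (2 * J))) / real n ^ (2 * J + 3)) * (real n ^ (2 * J + 2) / real (num_partitions n))) \<longlonglongrightarrow> 0 * 0"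
    proof (intro tendsto_mult superpoly)
      have "(\<lambda>n. real J * real J * (1 / real n) * (1 + 1 / real n) ^ (2 * J)) \<longlonglongrightarrow> real J * real J * 0 * (1 + 0) ^ (2 * J)"
        by (intro tendsto_intros lim_1_over_n)
      moreover have "eventually (\<lambda>n. real J * real J * (1 / real n) * (1 + 1 / real n) ^ (2 * J) =
         real (J * n\<^sup>2 * (J * (n + 1) ^ (2 * J))) / real n ^ (2 * J + 3)) sequentially"
        using eventually_gt_at_top[of 0]
      proof eventually_elim
        case (elim n)
        have "(1 + 1 / real n) ^ (2 * J) = (real n + 1) ^ (2 * J) / real n ^ (2 * J)"
        proof -
          have "1 + 1 / real n = (real n + 1) / real n" using elim by (simp add: field_simps)
          then show ?thesis by (simp only: power_divide)
        qed
        then show ?case using elim by (simp add: power_add field_simps power2_eq_square power3_eq_cube)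
      qed
      ultimately show "(\<lambda>n. real (J * n\<^sup>2 * (J * (n + 1) ^ (2 * J))) / real n ^ (2 * J + 3)) \<longlonglongrightarrow> 0"
        by (simp add: filterlim_cong)
    qed
    moreover have "eventually (\<lambda>n. (real (J * n\<^sup>2 * (J * (n + 1) ^ (2 * J))) / real n ^ (2 * J + 3)) * (real n ^ (2 * J + 2) / real (num_partitions n)) =
        real (J * n\<^sup>2 * (J * (n + 1) ^ (2 * J))) / (real n * real (num_partitions n))) sequentially"
      using eventually_gt_at_top[of 0]
      by eventually_elim (simp add: power_add power2_eq_square power3_eq_cube)
    ultimately have 1: "(\<lambda>n. real (J * n\<^sup>2 * (J * (n + 1) ^ (2 * J))) / (real n * real (num_partitions n))) \<longlonglongrightarrow> 0"
      by (simp add: filterlim_cong)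
    have 2: "(\<lambda>n. (1 + ln (real n)) * (2 * sqrt (real n)) / real n) \<longlonglongrightarrow> 0"
      by real_asymp
    show ?thesis unfolding R_def using tendsto_add[OF 1 2] by simp
  qed
  then have "eventually (\<lambda>n. R n < e / 2) sequentially"
    using e by (intro order_tendstoD) auto
  then have "eventually (\<lambda>n. norm (real_of_int (eta2 n) / (real n * real (num_partitions n)) - 1) < e) sequentially"
    using eventually_ge_at_top[of J]
  proof eventually_elim
    case (elim n)
    define q where "q = real n * real (num_partitions n)"
    have q: "q > 0" using elim J num_partitions_pos[of n] by (auto simp: q_def)
    have n0: "real n > 0" "real (num_partitions n) > 0" using elim J num_partitions_pos[of n] by auto
    have "q - real_of_int (eta2 n) \<le> (R n + 1 / real J) * q"
    proof -
      have "R n * q = real (J * n\<^sup>2 * (J * (n + 1) ^ (2 * J))) +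
          (1 + ln (real n)) * (2 * sqrt (real n) * real (num_partitions n))"
      proof -
        have "y * s / real n * (real n * p) = y * (s * p)" for y s p using n0 by simp
        moreover have "P / q * q = P" for P using q by simp
        ultimately show ?thesis
          unfolding R_def distrib_right[of "_ / _"] q_def by (simp only:)
      qed
      then show ?thesis
        using eta2_deficiency_le[OF J(1) elim(2)] by (simp only: q_def[symmetric] distrib_right)
    qed
    also have "\<dots> < e * q" using elim J q by (intro mult_strict_right_mono) auto
    finally have "q - real_of_int (eta2 n) < e * q" .
    moreover have "0 \<le> q - real_of_int (eta2 n)"
    proof -
      have "0 \<le> real_of_int (int (n * num_partitions n) - eta2 n)"
        unfolding n_num_partitions_minus_eta2 by (simp add: sum_nonneg)
      then show ?thesis by (simp add: q_def)
    qed
    ultimately show ?case using q e unfolding q_def[symmetric] by (simp add: field_simps abs_if)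
  qed
  then show "\<exists>no. \<forall>n\<ge>no. norm (real_of_int (eta2 n) / (real n * real (num_partitions n)) - 1) < e"
    by (simp add: eventually_sequentially)
qed

section \<open>The generating function of the partition numbers\<close>

lemma divisor_sum_le: "m > 0 \<Longrightarrow> divisor_sum m \<le> m\<^sup>2"
proof -
  assume m: "m > 0"
  have "divisor_sum m \<le> (\<Sum>d\<in>{1..m}. m)"
    unfolding divisor_sum_def by (rule order_trans[OF sum_mono sum_mono2[of "{1..m}"]])
      (use m in \<open>auto dest: dvd_imp_le intro: Suc_leI dvd_pos_nat\<close>)
  then show ?thesis by (simp add: power2_eq_square)
qed

lemma divisor_sum_ge: "m > 0 \<Longrightarrow> m \<le> divisor_sum m"
  unfolding divisor_sum_def by (rule member_le_sum) auto

lemma summable_power_mult: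
  fixes y :: real assumes "0 \<le> y" "y < 1"
  shows "summable (\<lambda>k. real k ^ i * y ^ k)"
  using assms
proof (induction i arbitrary: y)
  case 0
  then show ?case by (simp add: summable_geometric)
next
  case (Suc i)
  define z where "z = (y + 1) / 2"
  have z: "0 < z" "z < 1" "y < z" using Suc.prems by (auto simp: z_def)
  have "(\<lambda>k. of_nat k * (y / z) ^ k) \<longlonglongrightarrow> 0"
    by (rule powser_times_n_limit_0) (use z Suc.prems in auto)
  then have "Bseq (\<lambda>k. real k * (y / z) ^ k)" by (rule convergent_imp_Bseq[OF convergentI])
  then obtain K where K: "\<And>k. norm (real k * (y / z) ^ k) \<le> K" by (auto simp: Bseq_def)
  show ?case
  proof (rule summable_comparison_test')
    show "summable (\<lambda>k. K * (real k ^ i * z ^ k))"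
      using Suc.IH[of z] z by (intro summable_mult) auto
    fix k
    have "real k ^ Suc i * y ^ k = (real k * (y / z) ^ k) * (real k ^ i * z ^ k)"
      using z by (simp add: power_divide)
    also have "norm \<dots> \<le> K * (real k ^ i * z ^ k)"
      unfolding norm_mult[of "real k * _"] using K[of k] z by (simp add: mult_right_mono abs_mult)
    finally show "norm (real k ^ Suc i * y ^ k) \<le> K * (real k ^ i * z ^ k)" .
  qed
qed

lemma summable_divisor_sum_pow:
  fixes y :: real assumes "0 \<le> y" "y < 1"
  shows "summable (\<lambda>m. real m ^ i * real (divisor_sum m) * y ^ m)"
proof (rule summable_comparison_test_ev[OF _ summable_power_mult[OF assms, of "i + 2"]])
  show "\<forall>\<^sub>F m in sequentially. norm (real m ^ i * real (divisor_sum m) * y ^ m) \<le> real m ^ (i + 2) * y ^ m"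
    using eventually_gt_at_top[of 0]
  proof eventually_elim
    case (elim m)
    have "real (divisor_sum m) \<le> real m ^ 2"
      using divisor_sum_le[OF elim] by (metis of_nat_le_iff of_nat_power)
    then have "real m ^ i * real (divisor_sum m) * y ^ m \<le> real m ^ i * real m ^ 2 * y ^ m"
      using assms by (intro mult_right_mono mult_left_mono) auto
    then show ?case using assms by (simp add: abs_mult power_add power2_eq_square mult_ac)
  qed
qed

lemma summable_divisor_sum:
  fixes y :: real assumes "0 \<le> y" "y < 1"
  shows "summable (\<lambda>m. real (divisor_sum m) * y ^ m)"
  using summable_divisor_sum_pow[OF assms, of 0] by simp

text \<open>Let $S = \sum_m \sigma(m) y^m$. If all earlier values of $p(n) y^n$ are at most $B$, the recurrence bounds $n\,p(n) y^n$ by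
$S B$, which is at most $n B$ once $n \geq S$.\<close>

lemma num_partitions_pow_bounded:
  fixes y :: real assumes y: "0 < y" "y < 1"
  obtains B where "\<And>n. real (num_partitions n) * y ^ n \<le> B"
proof -
  define S where "S = (suminf (\<lambda>m. real (divisor_sum m) * y ^ m))"
  define N where "N = nat \<lceil>S\<rceil> + 1"
  \<comment> \<open>The sum bounds every initial value, which starts the induction.\<close>
  define B where "B = (\<Sum>n\<le>N. real (num_partitions n) * y ^ n)"
  have "real (num_partitions n) * y ^ n \<le> B" for n
  proof (induction n rule: less_induct)
    case (less n)
    show ?case
    proof (cases "n \<le> N")
      case True
      then show ?thesis unfolding B_def using y by (intro member_le_sum) auto
    next
      case False
      have n0: "n > 0" "S \<le> real n" using False by (auto simp: N_def) linarith
      have B0: "B \<ge> 0" unfolding B_def using y by (intro sum_nonneg) auto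
      have "real n * (real (num_partitions n) * y ^ n) = real (n * num_partitions n) * y ^ n" by simp
      also have "\<dots> = (\<Sum>m=1..n. real (divisor_sum m) * y ^ m * (real (num_partitions (n - m)) * y ^ (n - m)))"
        unfolding num_partitions_recurrence of_nat_sum sum_distrib_right
        by (intro sum.cong refl) (simp add: power_add[symmetric])
      also have "\<dots> \<le> (\<Sum>m=1..n. real (divisor_sum m) * y ^ m * B)"
        by (intro sum_mono mult_left_mono less) (use y in auto)
      also have "\<dots> = (\<Sum>m=1..n. real (divisor_sum m) * y ^ m) * B" by (rule sum_distrib_right[symmetric])
      also have "\<dots> \<le> S * B"
        unfolding S_def using y B0 by (intro mult_right_mono sum_le_suminf summable_divisor_sum) auto
      also have "\<dots> \<le> real n * B" using n0 B0 by (intro mult_right_mono) auto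
      finally show ?thesis using n0 by simp
    qed
  qed
  then show ?thesis by (rule that)
qed

lemma summable_num_partitions:
  fixes q :: complex assumes "norm q < 1"
  shows "summable (\<lambda>n. norm (of_nat (num_partitions n) * q ^ n))"
proof -
  define y where "y = (norm q + 1) / 2"
  have y: "0 < y" "y < 1" "norm q < y" using assms norm_ge_zero[of q] unfolding y_def by (simp_all add: add_nonneg_pos)
  obtain B where B: "\<And>n. real (num_partitions n) * y ^ n \<le> B"
    using num_partitions_pow_bounded y by blast
  show ?thesis
  proof (rule summable_comparison_test')
    show "summable (\<lambda>n. B * (norm q / y) ^ n)"
      using y by (intro summable_mult summable_geometric) auto
    fix n
    have "real (num_partitions n) * norm q ^ n = (real (num_partitions n) * y ^ n) * (norm q / y) ^ n"
      using y by (simp add: power_divide)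
    also have "\<dots> \<le> B * (norm q / y) ^ n" using y by (intro mult_right_mono B) auto
    finally show "norm (norm (of_nat (num_partitions n) * q ^ n)) \<le> B * (norm q / y) ^ n"
      by (simp add: norm_mult norm_power)
  qed
qed

lemma summable_divisor_sum_log:
  fixes q :: complex assumes "norm q < 1"
  shows "summable (\<lambda>m. norm (of_nat (divisor_sum m) / of_nat m * q ^ m))"
proof (rule summable_comparison_test')
  show "summable (\<lambda>m. real (divisor_sum m) * norm q ^ m)"
    using assms by (intro summable_divisor_sum) auto
  fix m
  have "real (divisor_sum m) / real m \<le> real (divisor_sum m)"
    by (cases m) (auto simp: field_simps)
  then have "real (divisor_sum m) / real m * norm q ^ m \<le> real (divisor_sum m) * norm q ^ m"
    by (rule mult_right_mono) simp
  then show "norm (norm (of_nat (divisor_sum m) / of_nat m * q ^ m)) \<le> real (divisor_sum m) * norm q ^ m"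
    by (simp add: norm_mult norm_power norm_divide)
qed

text \<open>The recurrence says that $P' = A' P$, where $P$ is the generating function and $A$ is the series in the exponent. Hence
$P e^{-A}$ is constant on the unit disc, and its value at the origin is $1$.\<close>

theorem num_partitions_gf:
  fixes q :: complex assumes q: "norm q < 1"
  shows "(\<lambda>n. of_nat (num_partitions n) * q ^ n) sums exp (suminf (\<lambda>m. of_nat (divisor_sum m) / of_nat m * q ^ m))"
proof -
  define p where "p n = (of_nat (num_partitions n) :: complex)" for n
  define a where "a m = (of_nat (divisor_sum m) / of_nat m :: complex)" for m
  define f where "f z = (suminf (\<lambda>n. p n * z ^ n))" for z
  define A where "A z = (suminf (\<lambda>n. a n * z ^ n))" for z
  have sp: "summable (\<lambda>n. norm (p n * z ^ n))" if "norm z < 1" for z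
    using summable_num_partitions[OF that] by (simp add: p_def)
  have sa: "summable (\<lambda>n. norm (a n * z ^ n))" if "norm z < 1" for z
    using summable_divisor_sum_log[OF that] by (simp add: a_def)
  have df: "(f has_field_derivative (suminf (\<lambda>n. diffs p n * z ^ n))) (at z)" if "norm z < 1" for z
    unfolding f_def by (rule termdiffs_strong'[of 1]) (use that sp[THEN summable_norm_cancel] in auto)
  have dA: "(A has_field_derivative (suminf (\<lambda>n. diffs a n * z ^ n))) (at z)" if "norm z < 1" for z
    unfolding A_def by (rule termdiffs_strong'[of 1]) (use that sa[THEN summable_norm_cancel] in auto)
  have diffs_a: "diffs a n = of_nat (divisor_sum (Suc n))" for n
    by (simp add: diffs_def a_def del: of_nat_Suc)
  have sda: "summable (\<lambda>n. norm (diffs a n * z ^ n))" if z: "norm z < 1" for z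
  proof (cases "z = 0")
    case True
    then show ?thesis by (intro summable_finite[of "{0}"]) auto
  next
    case False
    have "summable (\<lambda>m. real (divisor_sum (Suc m)) * norm z ^ Suc m)"
      using z by (subst summable_Suc_iff) (intro summable_divisor_sum, auto)
    then have "summable (\<lambda>m. (real (divisor_sum (Suc m)) * norm z ^ Suc m) * (1 / norm z))"
      by (rule summable_mult2)
    then show ?thesis using False by (simp add: diffs_a norm_mult norm_power)
  qed
  have ode: "(suminf (\<lambda>n. diffs p n * z ^ n)) = (suminf (\<lambda>n. diffs a n * z ^ n)) * f z" if z: "norm z < 1" for z
  proof -
    have "(\<lambda>k. \<Sum>i\<le>k. (diffs a i * z ^ i) * (p (k - i) * z ^ (k - i))) sums
        ((suminf (\<lambda>n. diffs a n * z ^ n)) * (suminf (\<lambda>n. p n * z ^ n)))"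
      using sda[OF z] sp[OF z] by (rule Cauchy_product_sums)
    moreover have "(\<Sum>i\<le>k. (diffs a i * z ^ i) * (p (k - i) * z ^ (k - i))) = diffs p k * z ^ k" for k
    proof -
      have rec: "Suc k * num_partitions (Suc k) = (\<Sum>i\<le>k. divisor_sum (Suc i) * num_partitions (k - i))"
        using num_partitions_recurrence[of "Suc k"]
        by (simp only: One_nat_def sum.atLeast1_atMost_eq lessThan_Suc_atMost diff_Suc_Suc)
      have "diffs p k = of_nat (Suc k * num_partitions (Suc k))"
        by (simp add: diffs_def p_def algebra_simps)
      also have "\<dots> = (\<Sum>i\<le>k. diffs a i * p (k - i))"
        unfolding rec
        by (simp add: diffs_a p_def del: of_nat_Suc)
      finally show ?thesis
        by (simp add: sum_distrib_right power_add[symmetric] mult.assoc mult.left_commute)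
    qed
    ultimately show ?thesis by (simp add: f_def sums_iff)
  qed
  have "\<exists>c. \<forall>z\<in>ball 0 1. f z * exp (- A z) = c"
  proof (rule has_field_derivative_zero_constant)
    fix z :: complex assume "z \<in> ball 0 1"
    then have z: "norm z < 1" by simp
    have "((\<lambda>z. f z * exp (- A z)) has_field_derivative
        (suminf (\<lambda>n. diffs a n * z ^ n)) * f z * exp (- A z) +
          exp (- A z) * - (suminf (\<lambda>n. diffs a n * z ^ n)) * f z) (at z)"
      using df[OF z, unfolded ode[OF z]]
      by (rule DERIV_mult) (rule DERIV_fun_exp[OF DERIV_minus[OF dA[OF z]]])
    then have "((\<lambda>z. f z * exp (- A z)) has_field_derivative 0) (at z)"
      by (simp add: algebra_simps)
    then show "((\<lambda>z. f z * exp (- A z)) has_field_derivative 0) (at z within ball 0 1)"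
      by (rule has_field_derivative_at_within)
  qed simp
  then obtain c where c: "\<And>z. norm z < 1 \<Longrightarrow> f z * exp (- A z) = c" by auto
  have p0: "num_partitions 0 = 1" by (rule num_partitions_0)
  have "f 0 = 1" "A 0 = 0"
    unfolding f_def A_def powser_zero by (simp_all add: p_def a_def p0)
  with c[of 0] c[OF q] have "f q * exp (- A q) = 1" by simp
  then have "f q = exp (A q)" by (simp add: exp_minus field_simps)
  moreover have "(\<lambda>n. p n * q ^ n) sums f q"
    unfolding f_def by (rule summable_sums[OF summable_norm_cancel[OF sp[OF q]]])
  ultimately show ?thesis by (simp add: p_def A_def a_def)
qed

section \<open>Fourier inversion on a circle\<close>

lemma integral_exp_int_circle:
  "has_bochner_integral lborel (\<lambda>t. indicator {-pi..pi} t *\<^sub>R exp (\<i> * of_int m * of_real t))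
     (if m = 0 then 2 * of_real pi else 0 :: complex)"
proof (cases "m = 0")
  case True
  have "has_bochner_integral lborel (\<lambda>t. indicator {-pi..pi} t *\<^sub>R (1::complex)) (measure lborel {-pi..pi} *\<^sub>R 1)"
    by (rule has_bochner_integral_indicator) auto
  then show ?thesis using True by (simp add: scaleR_conv_of_real)
next
  case False
  define F where "F t = exp (\<i> * of_int m * of_real t) / (\<i> * of_int m)" for t :: real
  have "has_bochner_integral lborel (\<lambda>t. indicator {-pi..pi} t *\<^sub>R exp (\<i> * of_int m * of_real t)) (F pi - F (-pi))"
  proof (rule has_bochner_integral_FTC_Icc)
    fix t assume "- pi \<le> t" "t \<le> pi"
    have "((\<lambda>z. exp (\<i> * of_int m * z) / (\<i> * of_int m)) has_field_derivative exp (\<i> * of_int m * of_real t)) (at (of_real t))"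
      using False by (auto intro!: derivative_eq_intros)
    then show "(F has_vector_derivative exp (\<i> * of_int m * of_real t)) (at t within {-pi..pi})"
      unfolding F_def by (rule has_vector_derivative_real_field)
  qed (auto intro!: continuous_intros)
  moreover have "F pi = F (-pi)"
  proof -
    have "exp (\<i> * of_int m * of_real pi) = exp (\<i> * of_int m * of_real (-pi) + 2 * of_int m * of_real pi * \<i>)"
      by (simp add: algebra_simps)
    also have "\<dots> = exp (\<i> * of_int m * of_real (-pi))"
      using exp_plus_2pin[of "\<i> * of_int m * of_real (-pi)" m] by (simp add: mult_ac)
    finally show ?thesis by (simp add: F_def)
  qed
  ultimately show ?thesis using False by simp
qed

text \<open>The logarithm of $P(e^{-x+it}) / P(e^{-x})$, as a series that fixes the branch.\<close>

definition log_ratio :: "real \<Rightarrow> real \<Rightarrow> complex" where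
  "log_ratio x t = (suminf (\<lambda>m. of_real (real (divisor_sum m) / real m * exp (- (real m * x))) * (exp (\<i> * of_real (real m * t)) - 1)))"

text \<open>The logarithm of the generating function at $e^{-x}$.\<close>

definition log_gf :: "real \<Rightarrow> real" where
  "log_gf x = (suminf (\<lambda>m. real (divisor_sum m) / real m * exp (- (real m * x))))"

lemma summable_log_gf: "x > 0 \<Longrightarrow> summable (\<lambda>m. real (divisor_sum m) / real m * exp (- (real m * x)))"
  using summable_divisor_sum_log[of "of_real (exp (- x))"]
  by (simp add: norm_mult norm_power norm_divide exp_of_nat_mult[symmetric])

lemma gf_on_circle:
  assumes "x > 0"
  shows "(\<lambda>k. of_nat (num_partitions k) * exp (- of_nat k * (of_real x - \<i> * of_real t))) sums
     (of_real (exp (log_gf x)) * exp (log_ratio x t))"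
proof -
  define q where "q = exp (- (of_real x - \<i> * of_real t))"
  have nq: "norm q = exp (- x)" by (simp add: q_def)
  then have q: "norm q < 1" using assms by simp
  have qk: "q ^ k = exp (- of_nat k * (of_real x - \<i> * of_real t))" for k
    unfolding q_def exp_of_nat_mult[symmetric] by (simp add: algebra_simps)
  have qk': "q ^ k = of_real (exp (- (real k * x))) * exp (\<i> * of_real (real k * t))" for k
    unfolding qk exp_of_real[symmetric] exp_add[symmetric] by (simp add: algebra_simps)
  let ?a = "\<lambda>m. real (divisor_sum m) / real m * exp (- (real m * x))"
  have s1: "(\<lambda>m. of_nat (divisor_sum m) / of_nat m * q ^ m) sums (suminf (\<lambda>m. of_nat (divisor_sum m) / of_nat m * q ^ m))"
    by (rule summable_sums[OF summable_norm_cancel[OF summable_divisor_sum_log[OF q]]])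
  have s2: "(\<lambda>m. of_real (?a m) :: complex) sums of_real (log_gf x)"
    unfolding log_gf_def by (intro sums_of_real summable_sums summable_log_gf assms)
  have "(\<lambda>m. of_nat (divisor_sum m) / of_nat m * q ^ m - of_real (?a m)) sums
      ((suminf (\<lambda>m. of_nat (divisor_sum m) / of_nat m * q ^ m)) - of_real (log_gf x))"
    by (rule sums_diff[OF s1 s2])
  moreover have "of_nat (divisor_sum m) / of_nat m * q ^ m - of_real (?a m) =
      of_real (?a m) * (exp (\<i> * of_real (real m * t)) - 1)" for m
    unfolding qk' by (simp add: right_diff_distrib mult.assoc)
  ultimately have "log_ratio x t = (suminf (\<lambda>m. of_nat (divisor_sum m) / of_nat m * q ^ m)) - of_real (log_gf x)"
    unfolding log_ratio_def by (simp add: sums_iff)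
  then have "suminf (\<lambda>m. of_nat (divisor_sum m) / of_nat m * q ^ m) = of_real (log_gf x) + log_ratio x t"
    by simp
  then have "exp (suminf (\<lambda>m. of_nat (divisor_sum m) / of_nat m * q ^ m)) = of_real (exp (log_gf x)) * exp (log_ratio x t)"
    by (simp only: exp_add exp_of_real)
  with num_partitions_gf[OF q] show ?thesis by (simp add: qk)
qed

text \<open>The power series converges absolutely on the circle of radius $e^{-x}$, so it may be integrated term by term against
$e^{-int}$; only the $n$-th term survives. Both sides are divided by the value of $P$ at $e^{-x}$.\<close>

theorem num_partitions_fourier:
  assumes x: "x > 0"
  shows "has_bochner_integral lborel
    (\<lambda>t. indicator {-pi..pi} t *\<^sub>R (exp (log_ratio x t) * exp (- (\<i> * of_nat n * of_real t))))
    (of_real (2 * pi * real (num_partitions n) * exp (- (real n * x)) / exp (log_gf x)))"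
proof -
  let ?c = "\<lambda>k. of_real (real (num_partitions k) * exp (- (real k * x))) :: complex"
  define f where "f k t = ?c k * (indicator {-pi..pi} t *\<^sub>R exp (\<i> * of_int (int k - int n) * of_real t))" for k t
  have hb: "has_bochner_integral lborel (f k) (?c k * (if int k - int n = 0 then 2 * of_real pi else 0))" for k
    unfolding f_def by (intro has_bochner_integral_mult_right integral_exp_int_circle) 
  have int: "integrable lborel (f k)" for k using hb by (auto simp: has_bochner_integral_iff)
  have nf: "norm (f k t) = real (num_partitions k) * exp (- (real k * x)) * indicator {-pi..pi} t" for k t
    by (simp add: f_def norm_mult norm_exp_eq_Re indicator_def)
  have sm: "summable (\<lambda>k. real (num_partitions k) * exp (- (real k * x)))"
    using summable_num_partitions[of "of_real (exp (- x))"] x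
    by (simp add: norm_mult norm_power exp_of_nat_mult[symmetric])
  have sums: "(\<lambda>k. f k t) sums (of_real (exp (log_gf x)) *
      (indicator {-pi..pi} t *\<^sub>R (exp (log_ratio x t) * exp (- (\<i> * of_nat n * of_real t)))))" for t
  proof -
    have "(\<lambda>k. of_nat (num_partitions k) * exp (- of_nat k * (of_real x - \<i> * of_real t)) * (indicator {-pi..pi} t *\<^sub>R exp (- (\<i> * of_nat n * of_real t)))) sums
       (of_real (exp (log_gf x)) * exp (log_ratio x t) * (indicator {-pi..pi} t *\<^sub>R exp (- (\<i> * of_nat n * of_real t))))"
      by (intro sums_mult2 gf_on_circle x)
    moreover have "of_nat (num_partitions k) * exp (- of_nat k * (of_real x - \<i> * of_real t)) * (indicator {-pi..pi} t *\<^sub>R exp (- (\<i> * of_nat n * of_real t))) = f k t" for k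
    proof -
      have "exp (- of_nat k * (of_real x - \<i> * of_real t)) * exp (- (\<i> * of_nat n * of_real t)) =
          of_real (exp (- (real k * x))) * exp (\<i> * of_int (int k - int n) * of_real t)"
        unfolding exp_of_real[symmetric] exp_add[symmetric] by (simp add: algebra_simps)
      then show ?thesis by (simp add: f_def mult.assoc scaleR_conv_of_real mult.left_commute)
    qed
    ultimately show ?thesis by (simp add: mult.assoc scaleR_conv_of_real mult.left_commute)
  qed
  have ae: "AE t in lborel. summable (\<lambda>k. norm (f k t))"
    unfolding nf by (intro AE_I2 summable_mult2 sm)
  have sn: "summable (\<lambda>k. LINT t|lborel. norm (f k t))"
    unfolding nf by (simp add: summable_mult2 sm)
  have I: "integrable lborel (\<lambda>t. (suminf (\<lambda>k. f k t)))" by (rule integrable_suminf[OF int ae sn])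
  have "(LINT t|lborel. (suminf (\<lambda>k. f k t))) = (suminf (\<lambda>k. LINT t|lborel. f k t))"
    by (rule integral_suminf[OF int ae sn])
  also have "\<dots> = (suminf (\<lambda>k. if k = n then ?c k * (2 * of_real pi) else 0))"
    using hb by (intro suminf_cong) (auto simp: has_bochner_integral_iff)
  also have "\<dots> = ?c n * (2 * of_real pi)"
    using sums_unique[OF sums_single[of n "\<lambda>k. ?c k * (2 * of_real pi)"]] by simp
  finally have "has_bochner_integral lborel (\<lambda>t. (suminf (\<lambda>k. f k t))) (?c n * (2 * of_real pi))"
    using I by (simp add: has_bochner_integral_iff)
  moreover have "(\<lambda>t. (suminf (\<lambda>k. f k t))) = (\<lambda>t. of_real (exp (log_gf x)) *
      (indicator {-pi..pi} t *\<^sub>R (exp (log_ratio x t) * exp (- (\<i> * of_nat n * of_real t)))))"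
    using sums by (auto simp: sums_iff)
  ultimately have "has_bochner_integral lborel (\<lambda>t. (1 / of_real (exp (log_gf x))) * (of_real (exp (log_gf x)) *
      (indicator {-pi..pi} t *\<^sub>R (exp (log_ratio x t) * exp (- (\<i> * of_nat n * of_real t))))))
      ((1 / of_real (exp (log_gf x))) * (?c n * (2 * of_real pi)))"
    by (intro has_bochner_integral_mult_right) simp
  then show ?thesis by (simp add: field_simps)
qed

section \<open>Weighted divisor sums near the singularity\<close>

lemma has_sum_from_1_imp_sums:
  fixes f :: "nat \<Rightarrow> real"
  assumes "(f has_sum S) {1..}"
  shows "(\<lambda>n. f (Suc n)) sums S"
proof (rule has_sum_imp_sums)
  have "bij_betw Suc UNIV {1..}"
    by (rule bij_betw_byWitness[where f' = "\<lambda>n. n - 1"]) auto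
  from has_sum_reindex_bij_betw[OF this, of f S] assms
  show "((\<lambda>n. f (Suc n)) has_sum S) UNIV" by simp
qed

text \<open>A sum over all pairs $(j,k)$ of positive integers can be arranged by $k$ or by the product $m = jk$. With non-negative terms,
summability of one arrangement implies that of the other.\<close>

lemma lambert_rearrange:
  fixes h :: "nat \<Rightarrow> nat \<Rightarrow> real"
  assumes nonneg: "\<And>j k. h j k \<ge> 0"
  assumes inner: "\<And>k. k \<ge> 1 \<Longrightarrow> (\<lambda>j. h (Suc j) k) sums H k"
  assumes outer: "(\<lambda>m. \<Sum>d | d dvd Suc m. h d (Suc m div d)) sums S"
  shows "(\<lambda>k. H (Suc k)) sums S"
proof -
  have bij: "bij_betw Suc UNIV {1..}"
    by (rule bij_betw_byWitness[where f' = "\<lambda>n. n - 1"]) auto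
  have o: "((\<lambda>m. \<Sum>d | d dvd m. h d (m div d)) has_sum S) {1..}"
    using has_sum_reindex_bij_betw[OF bij, of "\<lambda>m. \<Sum>d | d dvd m. h d (m div d)" S]
      sums_nonneg_imp_has_sum[OF outer] nonneg by (simp add: sum_nonneg)
  have i: "((\<lambda>j. h j k) has_sum H k) {1..}" if "k \<ge> 1" for k
    using has_sum_reindex_bij_betw[OF bij, of "\<lambda>j. h j k" "H k"]
      sums_nonneg_imp_has_sum[OF inner[OF that]] nonneg by simp
  have fin: "((\<lambda>d. h d (m div d)) has_sum (\<Sum>d | d dvd m. h d (m div d))) {d. d dvd m}" if "m \<in> {1..}" for m
    by (rule has_sum_finite) (use that in auto)
  have "((\<lambda>(m, d). h d (m div d)) has_sum S) (Sigma {1..} (\<lambda>m. {d. d dvd m}))"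
  proof (rule has_sum_SigmaI)
    show "(\<lambda>(m, d). h d (m div d)) summable_on Sigma {1..} (\<lambda>m. {d. d dvd m})"
      by (rule summable_on_SigmaI[where g = "\<lambda>m. \<Sum>d | d dvd m. h d (m div d)"])
         (use fin o nonneg in \<open>auto simp: summable_on_def\<close>)
  qed (use fin o in auto)
  also have "?this \<longleftrightarrow> ((\<lambda>(k, j). h j k) has_sum S) ({1..} \<times> {1..})"
    by (rule has_sum_reindex_bij_witness[of _ "\<lambda>(k, j). (j * k, j)" "\<lambda>(m, d). (m div d, d)"])
       (auto simp: Suc_le_eq div_greater_zero_iff dvd_imp_le dvd_pos_nat elim!: dvdE)
  finally have "((\<lambda>(k, j). h j k) has_sum S) (Sigma {1..} (\<lambda>_. {1..}))" .
  then have "(H has_sum S) {1..}"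
    by (rule has_sum_SigmaD) (use i in auto)
  then show ?thesis by (rule has_sum_from_1_imp_sums)
qed

text \<open>Up to sign, the derivative of order $i + 1$ of log_gf at $x$.\<close>

definition divisor_moment :: "nat \<Rightarrow> real \<Rightarrow> real" where
  "divisor_moment i x = suminf (\<lambda>m. real m ^ i * real (divisor_sum m) * exp (- (real m * x)))"

lemma summable_divisor_moment:
  "x > 0 \<Longrightarrow> summable (\<lambda>m. real m ^ i * real (divisor_sum m) * exp (- (real m * x)))"
  using summable_divisor_sum_pow[of "exp (- x)" i] by (simp add: exp_of_nat_mult[symmetric])

lemma divisor_sum_0 [simp]: "divisor_sum 0 = 0"
  by (simp add: divisor_sum_def)

lemma sums_divisor_moment:
  assumes "x > 0"
  shows "(\<lambda>m. real (Suc m) ^ i * real (divisor_sum (Suc m)) * exp (- (real (Suc m) * x))) sums divisor_moment i x"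
  unfolding divisor_moment_def
  by (subst sums_Suc_iff) (use summable_sums[OF summable_divisor_moment[OF assms]] in simp)

lemma sums_index_geometric:
  fixes r :: real assumes "norm r < 1"
  shows "(\<lambda>j. real (Suc j) * r ^ Suc j) sums (r / (1 - r)\<^sup>2)"
  using sums_mult[OF geometric_deriv_sums[OF assms], of r] by (simp add: mult_ac)

text \<open>The sum telescopes: the terms are the differences of a quadratic polynomial in $j$ times $r^j$.\<close>

lemma sums_square_geometric:
  fixes r :: real assumes r: "0 \<le> r" "r < 1"
  shows "(\<lambda>j. real (Suc j) ^ 2 * r ^ Suc j) sums (r * (1 + r) / (1 - r) ^ 3)"
proof -
  \<comment> \<open>The coefficients solve $a_j - a_{j+1} = j^2 r^j$ successively, from the leading one downwards.\<close>
  define a where "a j = (1 / (1 - r)) * (real j ^ 2 * r ^ j) + (2 * r / (1 - r)\<^sup>2) * (real j ^ 1 * r ^ j) +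
      (r * (1 + r) / (1 - r) ^ 3) * (real j ^ 0 * r ^ j)" for j
  have "a \<longlonglongrightarrow> (1 / (1 - r)) * 0 + (2 * r / (1 - r)\<^sup>2) * 0 + (r * (1 + r) / (1 - r) ^ 3) * 0"
    unfolding a_def by (intro tendsto_intros summable_LIMSEQ_zero[OF summable_power_mult[OF r]])
  then have "(\<lambda>j. a j - a (Suc j)) sums (a 0 - 0)" by (intro telescope_sums') simp
  moreover have "a j - a (Suc j) = real j ^ 2 * r ^ j" for j
  proof -
    have "1 - r \<noteq> 0" using r by simp
    define s where "s = 1 - r"
    have rs: "r = 1 - s" and s: "s \<noteq> 0" using r by (auto simp: s_def)
    show ?thesis unfolding a_def s_def[symmetric] using s
      by (simp add: field_simps power2_eq_square power3_eq_cube rs)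
  qed
  ultimately have "(\<lambda>j. real j ^ 2 * r ^ j) sums (r * (1 + r) / (1 - r) ^ 3)" by (simp add: a_def)
  then show ?thesis by (subst sums_Suc_iff) simp
qed

lemma divisor_moment_0_sums:
  assumes x: "x > 0"
  shows "(\<lambda>k. exp (- (real (Suc k) * x)) / (1 - exp (- (real (Suc k) * x)))\<^sup>2) sums divisor_moment 0 x"
proof (rule lambert_rearrange[where h = "\<lambda>j k. real j * exp (- (real k * x)) ^ j" and H = "\<lambda>k. exp (- (real k * x)) / (1 - exp (- (real k * x)))\<^sup>2"])
  fix k :: nat assume "k \<ge> 1"
  then show "(\<lambda>j. real (Suc j) * exp (- (real k * x)) ^ Suc j) sums (exp (- (real k * x)) / (1 - exp (- (real k * x)))\<^sup>2)"
    using x by (intro sums_index_geometric) simp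
next
  have "(\<Sum>d | d dvd m. real d * exp (- (real (m div d) * x)) ^ d) = real (divisor_sum m) * exp (- (real m * x))" for m
    unfolding divisor_sum_def of_nat_sum sum_distrib_right
    by (intro sum.cong refl) (auto simp: exp_of_nat_mult[symmetric] mult_ac elim!: dvdE)
  then show "(\<lambda>m. \<Sum>d | d dvd Suc m. real d * exp (- (real (Suc m div d) * x)) ^ d) sums divisor_moment 0 x"
    using sums_divisor_moment[OF x, of 0] by simp
qed simp

lemma divisor_moment_1_sums:
  assumes x: "x > 0"
  shows "(\<lambda>k. real (Suc k) * (exp (- (real (Suc k) * x)) * (1 + exp (- (real (Suc k) * x))) / (1 - exp (- (real (Suc k) * x))) ^ 3))
    sums divisor_moment 1 x"
proof (rule lambert_rearrange[where h = "\<lambda>j k. real k * (real j ^ 2 * exp (- (real k * x)) ^ j)" and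
    H = "\<lambda>k. real k * (exp (- (real k * x)) * (1 + exp (- (real k * x))) / (1 - exp (- (real k * x))) ^ 3)"])
  fix k :: nat assume "k \<ge> 1"
  then show "(\<lambda>j. real k * (real (Suc j) ^ 2 * exp (- (real k * x)) ^ Suc j)) sums
     (real k * (exp (- (real k * x)) * (1 + exp (- (real k * x))) / (1 - exp (- (real k * x))) ^ 3))"
    using x by (intro sums_mult sums_square_geometric) auto
next
  have "(\<Sum>d | d dvd m. real (m div d) * (real d ^ 2 * exp (- (real (m div d) * x)) ^ d)) =
      real m ^ 1 * real (divisor_sum m) * exp (- (real m * x))" for m
    unfolding divisor_sum_def of_nat_sum sum_distrib_right sum_distrib_left
    by (intro sum.cong refl) (auto simp: exp_of_nat_mult[symmetric] power2_eq_square mult_ac elim!: dvdE)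
  then show "(\<lambda>m. \<Sum>d | d dvd Suc m. real (Suc m div d) * (real d ^ 2 * exp (- (real (Suc m div d) * x)) ^ d)) sums divisor_moment 1 x"
    using sums_divisor_moment[OF x, of 1] by simp
qed simp

text \<open>This is the inequality $y/2 \leq \sinh(y/2)$ multiplied by $2 e^{-y/2}$.\<close>

lemma mult_exp_half_le: "y \<ge> 0 \<Longrightarrow> y * exp (- (y / 2)) \<le> 1 - exp (- y)" for y :: real
proof -
  assume y: "y \<ge> 0"
  define F where "F t = 1 - exp (- t) - t * exp (- (t / 2))" for t :: real
  have "F 0 \<le> F y"
  proof (rule DERIV_nonneg_imp_nondecreasing[OF y])
    fix t :: real assume "0 \<le> t" "t \<le> y"
    have "(F has_real_derivative exp (- t) - (exp (- (t / 2)) - t * exp (- (t / 2)) / 2)) (at t)"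
      unfolding F_def by (auto intro!: derivative_eq_intros simp: field_simps)
    moreover have "exp (- t) - (exp (- (t / 2)) - t * exp (- (t / 2)) / 2) = exp (- (t / 2)) * (exp (- (t / 2)) - (1 + - (t / 2)))"
      by (simp add: algebra_simps exp_add[symmetric])
    moreover have "exp (- (t / 2)) - (1 + - (t / 2)) \<ge> 0" using exp_ge_add_one_self[of "- (t / 2)"] by linarith
    ultimately show "\<exists>d. (F has_real_derivative d) (at t) \<and> 0 \<le> d" by fastforce
  qed
  then show ?thesis by (simp add: F_def)
qed

lemma exp_over_square_le:
  assumes y: "y > (0::real)"
  shows "exp (- y) / (1 - exp (- y))\<^sup>2 \<le> 1 / y\<^sup>2"
proof -
  have "(y * exp (- (y / 2)))\<^sup>2 \<le> (1 - exp (- y))\<^sup>2"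
    by (rule power_mono[OF mult_exp_half_le]) (use y in auto)
  moreover have "(y * exp (- (y / 2)))\<^sup>2 = y\<^sup>2 * exp (- y)"
    by (simp add: power_mult_distrib power2_eq_square exp_add[symmetric])
  moreover have "1 - exp (- y) > 0" using y by simp
  ultimately show ?thesis using y by (simp add: field_simps)
qed

text \<open>The true difference of $1/y^2$ and the quotient is bounded near $0$, but the power $-5/4$ is enough: it is summable over the
multiples of $x$, and it makes the total error $O(x^{-5/4})$, which is $o(x^{-3/2})$. It dominates the two easy bounds, $1/y$ for
$y \leq 1$ and $1/y^2$ for $y \geq 1$.\<close>

lemma exp_over_square_ge:
  assumes y: "y > (0::real)"
  shows "1 / y\<^sup>2 - y powr (-5/4) \<le> exp (- y) / (1 - exp (- y))\<^sup>2"
proof (cases "y \<le> 1")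
  case True
  have p: "0 < 1 - exp (- y)" "1 - exp (- y) \<le> y" using y exp_ge_add_one_self[of "- y"] by auto
  have "y powr (-1) \<le> y powr (-5/4)" using y True by (intro powr_mono') auto
  moreover have "y powr (-1) = 1 / y" using y by (simp add: powr_minus_divide)
  ultimately have "1 / y\<^sup>2 - y powr (-5/4) \<le> 1 / y\<^sup>2 - 1 / y" by linarith
  also have "\<dots> = (1 - y) / y\<^sup>2" using y by (simp add: field_simps power2_eq_square)
  also have "\<dots> \<le> exp (- y) / (1 - exp (- y))\<^sup>2"
    using p y True exp_ge_add_one_self[of "- y"] by (intro frac_le power_mono) auto
  finally show ?thesis .
next
  case False
  have "y powr (-2) \<le> y powr (-5/4)" using False by (intro powr_mono) auto
  moreover have "y powr (-2) = 1 / y\<^sup>2" using y by (simp add: powr_minus_divide)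
  ultimately have "1 / y\<^sup>2 - y powr (-5/4) \<le> 0" by linarith
  also have "0 \<le> exp (- y) / (1 - exp (- y))\<^sup>2" by simp
  finally show ?thesis .
qed

lemma inverse_squares_sums': "(\<lambda>n. 1 / (real n + 1)\<^sup>2) sums (pi\<^sup>2 / 6)"
  using inverse_squares_sums by (simp add: add.commute)

lemma inverse_squares_progression_sums:
  assumes "x > 0"
  shows "(\<lambda>k. 1 / (real (Suc k) * x)\<^sup>2) sums (pi\<^sup>2 / (6 * x\<^sup>2))"
proof -
  have "(\<lambda>k. 1 / x\<^sup>2 * (1 / (real k + 1)\<^sup>2)) sums (1 / x\<^sup>2 * (pi\<^sup>2 / 6))"
    by (intro sums_mult inverse_squares_sums')
  then show ?thesis by (simp add: power_mult_distrib mult_ac add_ac)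
qed

lemma divisor_moment_0_le: "x > 0 \<Longrightarrow> divisor_moment 0 x \<le> pi\<^sup>2 / (6 * x\<^sup>2)"
  by (rule sums_le[OF _ divisor_moment_0_sums inverse_squares_progression_sums]) (auto intro: exp_over_square_le)

text \<open>In the Lambert arrangement the terms are $e^{-kx}/(1-e^{-kx})^2 \approx 1/(kx)^2$. The first moment is the mean in a
local limit theorem at the scale $x^{-3/2}$, so an error of smaller order than this is required.\<close>

lemma divisor_moment_0_estimate:
  obtains C where "\<And>x. x > 0 \<Longrightarrow> \<bar>divisor_moment 0 x - pi\<^sup>2 / (6 * x\<^sup>2)\<bar> \<le> C * x powr (-5/4)"
proof -
  define C where "C = suminf (\<lambda>k. real (Suc k) powr (-5/4))"
  have sC: "(\<lambda>k. real (Suc k) powr (-5/4)) sums C"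
    unfolding C_def by (intro summable_sums) (subst summable_Suc_iff, simp add: summable_real_powr_iff)
  have "\<bar>divisor_moment 0 x - pi\<^sup>2 / (6 * x\<^sup>2)\<bar> \<le> C * x powr (-5/4)" if x: "x > 0" for x
  proof -
    let ?g = "\<lambda>k. exp (- (real (Suc k) * x)) / (1 - exp (- (real (Suc k) * x)))\<^sup>2"
    have s1: "(\<lambda>k. 1 / (real (Suc k) * x)\<^sup>2) sums (pi\<^sup>2 / (6 * x\<^sup>2))"
      by (rule inverse_squares_progression_sums[OF x])
    have s2: "?g sums divisor_moment 0 x" by (rule divisor_moment_0_sums[OF x])
    have s3: "(\<lambda>k. (real (Suc k) * x) powr (-5/4)) sums (C * x powr (-5/4))"
      using sums_mult2[OF sC] x by (simp add: powr_mult)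
    have s4: "(\<lambda>k. 1 / (real (Suc k) * x)\<^sup>2 - ?g k) sums (pi\<^sup>2 / (6 * x\<^sup>2) - divisor_moment 0 x)"
      by (rule sums_diff[OF s1 s2])
    have "1 / (real (Suc k) * x)\<^sup>2 - ?g k \<le> (real (Suc k) * x) powr (-5/4)" for k
      using exp_over_square_ge[of "real (Suc k) * x"] x by simp
    from sums_le[OF this s4 s3]
    have "pi\<^sup>2 / (6 * x\<^sup>2) - divisor_moment 0 x \<le> C * x powr (-5/4)" .
    moreover have "divisor_moment 0 x \<le> pi\<^sup>2 / (6 * x\<^sup>2)" by (rule divisor_moment_0_le[OF x])
    ultimately show ?thesis by simp
  qed
  then show ?thesis by (rule that)
qed

text \<open>One half of the exponential absorbs $m^2$, since $t^2/2 \leq e^t$ for $t = mx/2$; the other half leaves the first moment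
at $x/2$.\<close>

lemma divisor_moment_2_le:
  assumes x: "x > 0"
  shows "divisor_moment 2 x \<le> 16 * pi\<^sup>2 / (3 * x ^ 4)"
proof -
  have "divisor_moment 2 x \<le> 8 / x\<^sup>2 * divisor_moment 0 (x / 2)"
  proof -
    have "real m ^ 2 * real (divisor_sum m) * exp (- (real m * x)) \<le>
        8 / x\<^sup>2 * (real m ^ 0 * real (divisor_sum m) * exp (- (real m * (x / 2))))" for m
    proof -
      define t where "t = real m * x / 2"
      have t: "t \<ge> 0" using x by (simp add: t_def)
      have "t\<^sup>2 / 2 \<le> exp t" using exp_lower_Taylor_quadratic[OF t] t by simp
      then have "t\<^sup>2 / 2 * exp (- 2 * t) \<le> exp t * exp (- 2 * t)" by (intro mult_right_mono) auto
      also have "\<dots> = exp (- t)" by (simp add: exp_add[symmetric])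
      finally have "8 / x\<^sup>2 * real (divisor_sum m) * (t\<^sup>2 / 2 * exp (- 2 * t)) \<le> 8 / x\<^sup>2 * real (divisor_sum m) * exp (- t)"
        by (intro mult_left_mono) auto
      then show ?thesis using x by (simp add: t_def power_mult_distrib power_divide mult_ac)
    qed
    then show ?thesis
      unfolding divisor_moment_def using x
      by (subst suminf_mult[symmetric]) (intro suminf_le summable_mult summable_divisor_moment; simp)+
  qed
  also have "\<dots> \<le> 8 / x\<^sup>2 * (pi\<^sup>2 / (6 * (x / 2)\<^sup>2))"
    by (intro mult_left_mono divisor_moment_0_le) (use x in auto)
  also have "\<dots> = 16 * pi\<^sup>2 / (3 * x ^ 4)"
    using x by (simp add: field_simps power2_eq_square power4_eq_xxxx)
  finally show ?thesis .
qed

text \<open>Since $e^{-y} \leq 1/(1+y)$, the quotient $y/(1-e^{-y})$ is at most $1 + y$. A third of the exponential pays for this factor, and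
this is done three times.\<close>

lemma divisor_moment_1_kernel_le:
  assumes y: "y > (0::real)"
  shows "y ^ 3 * (exp (- y) * (1 + exp (- y)) / (1 - exp (- y)) ^ 3) \<le> 54"
proof -
  have pos: "1 - exp (- y) > 0" using y by simp
  have "y * exp (- (y / 3)) \<le> 3 * (1 - exp (- y))"
  proof -
    have "exp (- y) * (1 + y) \<le> exp (- y) * exp y" by (intro mult_left_mono) auto
    then have 1: "y \<le> (1 + y) * (1 - exp (- y))" by (simp add: algebra_simps exp_add[symmetric])
    have "1 + y \<le> 3 * exp (y / 3)" using exp_ge_add_one_self[of "y / 3"] by linarith
    then have "(1 + y) * (1 - exp (- y)) \<le> 3 * exp (y / 3) * (1 - exp (- y))"
      using pos by (intro mult_right_mono) auto
    with 1 have "y \<le> 3 * exp (y / 3) * (1 - exp (- y))" by linarith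
    then have "y * exp (- (y / 3)) \<le> 3 * exp (y / 3) * (1 - exp (- y)) * exp (- (y / 3))"
      by (intro mult_right_mono) auto
    also have "\<dots> = 3 * (1 - exp (- y)) * exp (y / 3 + - (y / 3))" unfolding exp_add by (simp add: mult_ac)
    finally show ?thesis by simp
  qed
  then have "(y * exp (- (y / 3))) ^ 3 \<le> (3 * (1 - exp (- y))) ^ 3"
    using y by (intro power_mono) auto
  moreover have "(y * exp (- (y / 3))) ^ 3 = y ^ 3 * exp (- y)"
    by (simp add: power_mult_distrib exp_of_nat_mult[symmetric])
  moreover have "(3 * (1 - exp (- y))) ^ 3 = 27 * (1 - exp (- y)) ^ 3"
    by (simp only: power_mult_distrib) simp
  ultimately have "y ^ 3 * exp (- y) \<le> 27 * (1 - exp (- y)) ^ 3" by simp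
  then have 1: "y ^ 3 * exp (- y) / (1 - exp (- y)) ^ 3 \<le> 27" using pos by (simp add: field_simps)
  have "y ^ 3 * exp (- y) / (1 - exp (- y)) ^ 3 * (1 + exp (- y)) \<le> 27 * 2"
    using y pos by (intro mult_mono 1) auto
  then show ?thesis by (simp add: mult_ac)
qed

text \<open>Multiplied by $x^3$, the term for $k$ in the Lambert arrangement is $1/k^2$ times a bounded function of $kx$ whose limit at $0$ is
$2$. Dominated convergence for series gives the limit $2\,\zeta(2)$.\<close>

lemma divisor_moment_1_limit: "((\<lambda>x. x ^ 3 * divisor_moment 1 x) \<longlongrightarrow> pi\<^sup>2 / 3) (at_right 0)"
proof -
  define g where "g y = y ^ 3 * (exp (- y) * (1 + exp (- y)) / (1 - exp (- y)) ^ 3)" for y :: real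
  define a where "a k x = 1 / (real k + 1)\<^sup>2 * g ((real k + 1) * x)" for k x
  have "(\<lambda>k. 54 * (1 / (real k + 1)\<^sup>2)) sums (54 * (pi\<^sup>2 / 6))"
    by (intro sums_mult inverse_squares_sums')
  then have sM: "summable (\<lambda>k. 54 * (1 / (real k + 1)\<^sup>2))" by (rule sums_summable)
  have lim: "((\<lambda>x. a k x) \<longlongrightarrow> 1 / (real k + 1)\<^sup>2 * 2) (at_right 0)" for k
  proof -
    have c: "real k + 1 > 0" by simp
    have "(g \<longlongrightarrow> 2) (at_right 0)" unfolding g_def by real_asymp
    moreover have "filterlim (\<lambda>x. (real k + 1) * x) (at_right 0) (at_right 0)"
      using c by real_asymp
    ultimately have "((\<lambda>x. g ((real k + 1) * x)) \<longlongrightarrow> 2) (at_right 0)" by (rule filterlim_compose)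
    then show ?thesis unfolding a_def by (intro tendsto_intros)
  qed
  have bound: "norm (a k x) \<le> 54 * (1 / (real k + 1)\<^sup>2)" if "x > 0" for k x
  proof -
    have y: "(real k + 1) * x > 0" using that by simp
    then have "g ((real k + 1) * x) \<le> 54" unfolding g_def by (rule divisor_moment_1_kernel_le)
    moreover have "g ((real k + 1) * x) \<ge> 0" using y unfolding g_def by (intro mult_nonneg_nonneg divide_nonneg_nonneg) auto
    ultimately have "\<bar>g ((real k + 1) * x)\<bar> / (real k + 1)\<^sup>2 \<le> 54 / (real k + 1)\<^sup>2"
      by (intro divide_right_mono) auto
    then show ?thesis by (simp add: a_def abs_mult)
  qed
  have "((\<lambda>x. suminf (\<lambda>k. a k x)) \<longlongrightarrow> suminf (\<lambda>k. 1 / (real k + 1)\<^sup>2 * 2)) (at_right 0)"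
  proof (rule tannerys_theorem[THEN conjunct2, THEN conjunct2, OF lim _ sM])
    have "eventually (\<lambda>x::real. x > 0) (at_right 0)" by (rule eventually_at_right_less)
    then show "\<forall>\<^sub>F (k, x) in sequentially \<times>\<^sub>F at_right 0. norm (a k x) \<le> 54 * (1 / (real k + 1)\<^sup>2)"
      unfolding eventually_prod_filter
      by (intro exI[of _ "\<lambda>_. True"] exI[of _ "\<lambda>x. x > 0"] conjI allI impI)
         (auto simp only: prod.case intro: bound eventually_True)
  qed simp
  also have "suminf (\<lambda>k. 1 / (real k + 1)\<^sup>2 * 2) = pi\<^sup>2 / 3"
    using sums_mult2[OF inverse_squares_sums', of 2] by (simp add: sums_iff)
  finally show ?thesis
  proof (rule Lim_transform_eventually)
    show "\<forall>\<^sub>F x in at_right 0. suminf (\<lambda>k. a k x) = x ^ 3 * divisor_moment 1 x"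
      using eventually_at_right_less[of "0::real"]
    proof eventually_elim
      case (elim x)
      from sums_mult[OF divisor_moment_1_sums[OF elim], of "x ^ 3"]
      have "(\<lambda>k. a k x) sums (x ^ 3 * divisor_moment 1 x)"
      proof (rule sums_cong[THEN iffD1, rotated])
        fix k
        have "(real k + 1) ^ 3 / (real k + 1)\<^sup>2 = real k + 1" by (simp add: power3_eq_cube power2_eq_square)
        moreover have "a k x = (real k + 1) ^ 3 / (real k + 1)\<^sup>2 * (x ^ 3 * (exp (- ((real k + 1) * x)) * (1 + exp (- ((real k + 1) * x))) / (1 - exp (- ((real k + 1) * x))) ^ 3))"
          by (simp add: a_def g_def power_mult_distrib)
        ultimately show "x ^ 3 * (real (Suc k) * (exp (- (real (Suc k) * x)) * (1 + exp (- (real (Suc k) * x))) / (1 - exp (- (real (Suc k) * x))) ^ 3)) = a k x"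
          by (simp add: add.commute[of 1] mult_ac)
      qed
      then show ?case by (simp add: sums_iff)
    qed
  qed
qed

section \<open>Stirling's constant\<close>

definition stirling_seq :: "nat \<Rightarrow> real" where
  "stirling_seq n = ln (fact n) - (real n + 1 / 2) * ln (real n) + real n"

lemma ln_fact_Suc: "ln (fact (Suc n) :: real) = ln (real (Suc n)) + ln (fact n)"
  unfolding fact_Suc by (subst ln_mult) auto

lemma sum_ln_eq_ln_fact: "(\<Sum>n=1..M. ln (real n)) = ln (fact M)"
  by (induction M) (simp_all add: ln_fact_Suc del: fact_Suc)

text \<open>The increments are $O(1/n^2)$, so the sequence converges. Wallis' product is a combination of its terms with indices $n$ and $2n$,
which determines the limit.\<close>

lemma stirling_limit: "stirling_seq \<longlonglongrightarrow> ln (2 * pi) / 2"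
proof -
  have "convergent (\<lambda>n. stirling_seq (Suc n))"
  proof -
    have "summable (\<lambda>n. stirling_seq (Suc (Suc n)) - stirling_seq (Suc n))"
    proof (rule summable_comparison_test_bigo)
      show "summable (\<lambda>n. norm (1 / (real n + 1)\<^sup>2))"
        using inverse_squares_sums' by (simp add: sums_iff)
      have "stirling_seq (Suc (Suc n)) - stirling_seq (Suc n) =
         1 - (real n + 3 / 2) * (ln (real n + 2) - ln (real n + 1))" for n
        unfolding stirling_seq_def ln_fact_Suc by (simp add: algebra_simps)
      moreover have "(\<lambda>n. 1 - (real n + 3 / 2) * (ln (real n + 2) - ln (real n + 1))) \<in> O(\<lambda>n. 1 / (real n + 1)\<^sup>2)"
        by real_asymp
      ultimately show "(\<lambda>n. stirling_seq (Suc (Suc n)) - stirling_seq (Suc n)) \<in> O(\<lambda>n. 1 / (real n + 1)\<^sup>2)" by simp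
    qed
    then have "convergent (\<lambda>n. \<Sum>k<n. stirling_seq (Suc (Suc k)) - stirling_seq (Suc k))"
      by (simp only: summable_iff_convergent)
    then show ?thesis
      by (simp only: sum_lessThan_telescope[of "\<lambda>n. stirling_seq (Suc n)"] convergent_diff_const_right_iff)
  qed
  then have "convergent stirling_seq" by (simp only: convergent_Suc_iff)
  then obtain c where c: "stirling_seq \<longlonglongrightarrow> c" by (auto simp: convergent_def)
  \<comment> \<open>Wallis' product equals $(2^n n!)^4 / ((2n)!^2 (2n+1))$.\<close>
  have W: "ln (\<Prod>k=1..n. (4*real k^2) / (4*real k^2 - 1)) =
      4 * stirling_seq n - 2 * stirling_seq (2 * n) + (2 * ln (real n) - ln (2 * real n) - ln (2 * real n + 1))"
    if "n \<ge> 1" for n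
  proof -
    have "(\<Prod>k=1..n. (4*real k^2) / (4*real k^2 - 1)) = (2 ^ n * fact n) ^ 4 / ((fact (2 * n)) ^ 2 * (2 * real n + 1))" for n
    proof (induction n)
      case (Suc n)
      have nz: "4 * (real (Suc n))\<^sup>2 - 1 = (2 * real n + 1) * (2 * real n + 3)"
        by (simp add: power2_eq_square algebra_simps)
      have f: "fact (2 * Suc n) = (2 * real n + 2) * (2 * real n + 1) * fact (2 * n)"
        by (simp add: algebra_simps)
      have "(\<Prod>k=1..Suc n. (4*real k^2) / (4*real k^2 - 1)) =
         (2 ^ n * fact n) ^ 4 / ((fact (2 * n)) ^ 2 * (2 * real n + 1)) * ((4 * (real (Suc n))\<^sup>2) / ((2 * real n + 1) * (2 * real n + 3)))"
        by (simp only: prod.nat_ivl_Suc' Suc nz) (simp add: mult_ac)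
      also have "\<dots> = (2 ^ Suc n * fact (Suc n)) ^ 4 / ((fact (2 * Suc n)) ^ 2 * (2 * real (Suc n) + 1))"
      proof -
        define a where "a = real n"
        have a: "a \<ge> 0" by (simp add: a_def)
        define F where "F = (fact n :: real)" define H where "H = (fact (2 * n) :: real)" define T where "T = (2 :: real) ^ n"
        have pos: "F > 0" "H > 0" "T > 0" by (auto simp: F_def H_def T_def)
        have "2 ^ Suc n = 2 * T" "fact (Suc n) = (a + 1) * F" "real (Suc n) = a + 1"
          by (auto simp: T_def F_def a_def)
        then show ?thesis
          unfolding f a_def[symmetric] F_def[symmetric] H_def[symmetric] T_def[symmetric]
          using pos a by (simp add: divide_simps) (simp add: algebra_simps power2_eq_square power4_eq_xxxx add_nonneg_eq_0_iff)
      qed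
      finally show ?case .
    qed simp
    then have "ln (\<Prod>k=1..n. (4*real k^2) / (4*real k^2 - 1)) =
        4 * (real n * ln 2 + ln (fact n)) - (2 * ln (fact (2 * n)) + ln (2 * real n + 1))"
      using that by (simp add: ln_div ln_mult ln_realpow add_pos_pos)
    also have "\<dots> = 4 * stirling_seq n - 2 * stirling_seq (2 * n) + (2 * ln (real n) - ln (2 * real n) - ln (2 * real n + 1))"
      using that by (simp add: stirling_seq_def ln_mult algebra_simps)
    finally show ?thesis .
  qed
  have "(\<lambda>n. 4 * stirling_seq n - 2 * stirling_seq (2 * n) + (2 * ln (real n) - ln (2 * real n) - ln (2 * real n + 1)))
      \<longlonglongrightarrow> 4 * c - 2 * c + (- 2 * ln 2)"
  proof (intro tendsto_intros c)
    show "(\<lambda>n. stirling_seq (2 * n)) \<longlonglongrightarrow> c"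
      by (rule filterlim_compose[OF c]) real_asymp
    show "(\<lambda>n. 2 * ln (real n) - ln (2 * real n) - ln (2 * real n + 1)) \<longlonglongrightarrow> - 2 * ln 2"
      by real_asymp
  qed
  moreover have "(\<lambda>n. ln (\<Prod>k=1..n. (4*real k^2) / (4*real k^2 - 1))) \<longlonglongrightarrow> ln (pi / 2)"
    by (intro tendsto_ln wallis) simp
  moreover have "eventually (\<lambda>n. ln (\<Prod>k=1..n. (4*real k^2) / (4*real k^2 - 1)) =
     4 * stirling_seq n - 2 * stirling_seq (2 * n) + (2 * ln (real n) - ln (2 * real n) - ln (2 * real n + 1))) sequentially"
    using eventually_ge_at_top[of 1] by eventually_elim (rule W)
  ultimately have "(\<lambda>n. ln (\<Prod>k=1..n. (4*real k^2) / (4*real k^2 - 1))) \<longlonglongrightarrow> 4 * c - 2 * c + (- 2 * ln 2)"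
    by (simp add: filterlim_cong)
  from LIMSEQ_unique[OF this \<open>(\<lambda>n. ln (\<Prod>k=1..n. (4*real k^2) / (4*real k^2 - 1))) \<longlonglongrightarrow> ln (pi / 2)\<close>]
  have "2 * c = ln (2 * pi)" by (simp add: ln_div ln_mult)
  then have "c = ln (2 * pi) / 2" by simp
  with c show ?thesis by (simp only:)
qed

section \<open>The logarithm of the generating function near the singularity\<close>

lemma sums_power_over_index:
  fixes r :: real assumes "0 \<le> r" "r < 1"
  shows "(\<lambda>j. r ^ Suc j / real (Suc j)) sums (- ln (1 - r))"
proof -
  have "(\<lambda>n. - ((- (- r)) ^ n) / of_nat n) sums ln (1 + - r)"
    by (rule ln_series') (use assms in auto)
  then have "(\<lambda>n. r ^ n / real n) sums (- ln (1 - r))" using sums_minus by fastforce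
  then show ?thesis by (subst sums_Suc_iff) simp
qed

text \<open>The Lambert arrangement corresponds to the Euler product $P(q) = \prod_k 1/(1 - q^k)$.\<close>

lemma log_gf_sums:
  assumes x: "x > 0"
  shows "(\<lambda>k. - ln (1 - exp (- (real (Suc k) * x)))) sums log_gf x"
proof (rule lambert_rearrange[where h = "\<lambda>j k. exp (- (real k * x)) ^ j / real j" and H = "\<lambda>k. - ln (1 - exp (- (real k * x)))"])
  fix k :: nat assume "k \<ge> 1"
  then show "(\<lambda>j. exp (- (real k * x)) ^ Suc j / real (Suc j)) sums (- ln (1 - exp (- (real k * x))))"
    using x by (intro sums_power_over_index) auto
next
  have "(\<Sum>d | d dvd m. exp (- (real (m div d) * x)) ^ d / real d) = real (divisor_sum m) / real m * exp (- (real m * x))"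
    if m: "m > 0" for m
  proof -
    have "(\<Sum>d | d dvd m. exp (- (real (m div d) * x)) ^ d / real d) = (\<Sum>d | d dvd m. exp (- (real m * x)) / real d)"
      by (intro sum.cong refl) (auto simp: exp_of_nat_mult[symmetric] mult_ac elim!: dvdE)
    also have "\<dots> = (\<Sum>d | d dvd m. exp (- (real m * x)) * real d / real m)"
    proof (rule sum.reindex_bij_witness[of _ "\<lambda>d. m div d" "\<lambda>d. m div d"])
      fix d assume "d \<in> {d. d dvd m}"
      then obtain e where e: "m = d * e" by (auto elim: dvdE)
      then have "d > 0" "e > 0" using m by auto
      then show "exp (- (real m * x)) * real (m div d) / real m = exp (- (real m * x)) / real d"
        by (simp add: e)
    qed (use m in \<open>auto simp: div_div_eq_right\<close>)
    finally show ?thesis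
      by (simp add: divisor_sum_def sum_distrib_left sum_divide_distrib sum_distrib_right mult_ac)
  qed
  moreover have "(\<lambda>m. real (divisor_sum (Suc m)) / real (Suc m) * exp (- (real (Suc m) * x))) sums log_gf x"
    unfolding log_gf_def
    by (subst sums_Suc_iff) (use summable_sums[OF summable_log_gf[OF x]] in simp)
  ultimately show "(\<lambda>m. \<Sum>d | d dvd Suc m. exp (- (real (Suc m div d) * x)) ^ d / real d) sums log_gf x"
    by simp
qed simp

text \<open>The error of the trapezoidal rule on $[a,t]$ has a derivative in $t$ that compares $f(t) - f(a)$ with $(t-a) f'(t)$, and the mean
value theorem bounds it by the increase of $f'$. A bound by this increase, rather than by the second derivative, telescopes over
consecutive intervals.\<close>

lemma trapezoid_error:
  fixes F f g :: "real \<Rightarrow> real"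
  assumes ab: "a \<le> b"
    and F: "\<And>t. a \<le> t \<Longrightarrow> t \<le> b \<Longrightarrow> (F has_real_derivative f t) (at t)"
    and f: "\<And>t. a \<le> t \<Longrightarrow> t \<le> b \<Longrightarrow> (f has_real_derivative g t) (at t)"
    and mono: "\<And>s t. a \<le> s \<Longrightarrow> s \<le> t \<Longrightarrow> t \<le> b \<Longrightarrow> g s \<le> g t"
  shows "\<bar>(b - a) * (f a + f b) / 2 - (F b - F a)\<bar> \<le> (b - a)\<^sup>2 / 2 * (g b - g a)"
proof (cases "a = b")
  case False
  \<comment> \<open>Up to a constant, the error on the interval from $a$ to $t$.\<close>
  define D where "D t = (t - a) * (f a + f t) / 2 - F t" for t
  have D: "(D has_real_derivative (f a - f t) / 2 + (t - a) * g t / 2) (at t)" if "a \<le> t" "t \<le> b" for t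
    unfolding D_def using that by (auto intro!: derivative_eq_intros F f simp: field_simps)
  have bound: "\<bar>(f a - f t) / 2 + (t - a) * g t / 2\<bar> \<le> (b - a) / 2 * (g b - g a)" if t: "a \<le> t" "t \<le> b" for t
  proof (cases "a = t")
    case True
    then show ?thesis using mono[of a b] ab by simp
  next
    case False
    then have "\<exists>z. a < z \<and> z < t \<and> f t - f a = (t - a) * g z"
      using t by (intro MVT2 f) auto
    then obtain z where z: "a < z" "z < t" "f t - f a = (t - a) * g z" by auto
    have eq: "(f a - f t) / 2 + (t - a) * g t / 2 = (t - a) / 2 * (g t - g z)" using z by (simp add: field_simps)
    have g: "0 \<le> g t - g z" "g t - g z \<le> g b - g a"
      using mono[of z t] mono[of a z] mono[of t b] z t by auto
    have "0 \<le> (t - a) / 2 * (g t - g z)" using g t by simp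
    moreover have "(t - a) / 2 * (g t - g z) \<le> (b - a) / 2 * (g b - g a)"
      using g t by (intro mult_mono) auto
    ultimately show ?thesis unfolding eq by (simp only: abs_of_nonneg)
  qed
  have "\<exists>z. a < z \<and> z < b \<and> D b - D a = (b - a) * ((f a - f z) / 2 + (z - a) * g z / 2)"
    using ab False by (intro MVT2 D) auto
  then obtain z where z: "a < z" "z < b" "D b - D a = (b - a) * ((f a - f z) / 2 + (z - a) * g z / 2)" by auto
  then have "\<bar>D b - D a\<bar> \<le> (b - a) * ((b - a) / 2 * (g b - g a))"
    using bound[of z] ab by (simp add: abs_mult mult_left_mono)
  then show ?thesis by (simp add: D_def power2_eq_square algebra_simps)
qed simp

text \<open>The function $\log((1-e^{-t})/t)$, in which the logarithmic singularity at $0$ of the terms of log_gf has been removed.\<close>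

definition log_quot :: "real \<Rightarrow> real" where "log_quot t = ln (1 - exp (- t)) - ln t"

definition log_quot_deriv :: "real \<Rightarrow> real" where "log_quot_deriv t = exp (- t) / (1 - exp (- t)) - 1 / t"

definition dilog :: "real \<Rightarrow> real" where "dilog q = suminf (\<lambda>n. 1 / (real n)\<^sup>2 * q ^ n)"

text \<open>The primitive of log_quot with limit $0$ at the origin: the dilogarithm of $e^{-t}$ is a primitive of $\log(1-e^{-t})$ with limit
$\pi^2/6$ there.\<close>

definition log_quot_primitive :: "real \<Rightarrow> real" where
  "log_quot_primitive t = dilog (exp (- t)) - pi\<^sup>2 / 6 - t * ln t + t"

lemma log_quot_has_derivative: "t > 0 \<Longrightarrow> (log_quot has_real_derivative log_quot_deriv t) (at t)"
  unfolding log_quot_def log_quot_deriv_def by (auto intro!: derivative_eq_intros simp: field_simps)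

text \<open>The function log_quot is convex: its second derivative is $1/t^2 - e^{-t}/(1-e^{-t})^2$.\<close>

lemma log_quot_deriv_mono:
  assumes "0 < s" "s \<le> t"
  shows "log_quot_deriv s \<le> log_quot_deriv t"
proof (rule DERIV_nonneg_imp_nondecreasing[OF assms(2)])
  fix u assume "s \<le> u" "u \<le> t"
  then have u: "u > 0" using assms by simp
  have nz: "1 - exp (- u) \<noteq> 0" using u by simp
  have "(log_quot_deriv has_real_derivative ((- exp (- u)) * (1 - exp (- u)) - exp (- u) * exp (- u)) / (1 - exp (- u))\<^sup>2 + 1 / u\<^sup>2) (at u)"
    unfolding log_quot_deriv_def using u nz
    by (auto intro!: derivative_eq_intros simp: power2_eq_square)
  moreover have "((- exp (- u)) * (1 - exp (- u)) - exp (- u) * exp (- u)) = - exp (- u)" by (simp add: algebra_simps)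
  ultimately have "(log_quot_deriv has_real_derivative 1 / u\<^sup>2 - exp (- u) / (1 - exp (- u))\<^sup>2) (at u)" by simp
  with exp_over_square_le[OF u] show "\<exists>y. (log_quot_deriv has_real_derivative y) (at u) \<and> 0 \<le> y"
    by (intro exI conjI) auto
qed

lemma log_quot_deriv_bounds:
  assumes "t > 0"
  shows "log_quot_deriv t \<le> 0" "- 1 \<le> log_quot_deriv t"
proof -
  have p: "0 < 1 - exp (- t)" "1 - exp (- t) \<le> t" using assms exp_ge_add_one_self[of "- t"] by auto
  have "exp (- t) * (1 + t) \<le> exp (- t) * exp t" by (intro mult_left_mono) auto
  then have "t * exp (- t) \<le> 1 - exp (- t)" by (simp add: algebra_simps exp_add[symmetric])
  then show "log_quot_deriv t \<le> 0" using p assms by (simp add: log_quot_deriv_def field_simps)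
  have "1 / t \<le> 1 / (1 - exp (- t))" using p assms by (intro divide_left_mono) auto
  also have "1 / (1 - exp (- t)) = exp (- t) / (1 - exp (- t)) + 1" using p by (simp add: field_simps)
  finally show "- 1 \<le> log_quot_deriv t" by (simp add: log_quot_deriv_def)
qed

lemma log_quot_bounds:
  assumes "t > 0"
  shows "log_quot t \<le> 0" "- t \<le> log_quot t"
proof -
  have p: "0 < 1 - exp (- t)" "1 - exp (- t) \<le> t" using assms exp_ge_add_one_self[of "- t"] by auto
  show "log_quot t \<le> 0" using p by (simp add: log_quot_def)
  have "exp (- t) * (1 + t) \<le> exp (- t) * exp t" by (intro mult_left_mono) auto
  then have "t * exp (- t) \<le> 1 - exp (- t)" by (simp add: algebra_simps exp_add[symmetric])
  then have "ln (t * exp (- t)) \<le> ln (1 - exp (- t))" using p assms by (subst ln_le_cancel_iff) auto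
  then show "- t \<le> log_quot t" using assms by (simp add: log_quot_def ln_mult)
qed

lemma summable_dilog:
  assumes "norm q < 1" shows "summable (\<lambda>n. 1 / (real n)\<^sup>2 * q ^ n)"
proof (rule summable_comparison_test')
  show "summable (\<lambda>n. norm q ^ n)" using assms by (intro summable_geometric) auto
  fix n
  have "1 / (real n)\<^sup>2 \<le> 1" by (cases n) (auto simp: field_simps)
  then have "1 / (real n)\<^sup>2 * norm q ^ n \<le> 1 * norm q ^ n" by (intro mult_right_mono) auto
  then show "norm (1 / (real n)\<^sup>2 * q ^ n) \<le> norm q ^ n" by (simp add: norm_mult norm_power power_abs)
qed

lemma dilog_deriv:
  assumes "0 < q" "q < 1" shows "(dilog has_real_derivative - ln (1 - q) / q) (at q)"
proof -
  have "(dilog has_real_derivative suminf (\<lambda>n. diffs (\<lambda>n. 1 / (real n)\<^sup>2) n * q ^ n)) (at q)"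
    unfolding dilog_def by (rule termdiffs_strong'[of 1]) (use assms summable_dilog in auto)
  moreover have "(\<lambda>n. (q ^ Suc n / real (Suc n)) * (1 / q)) sums (- ln (1 - q) * (1 / q))"
    by (rule sums_mult2[OF sums_power_over_index]) (use assms in auto)
  then have "(\<lambda>n. diffs (\<lambda>n. 1 / (real n)\<^sup>2) n * q ^ n) sums (- ln (1 - q) / q)"
    using assms by (simp add: diffs_def power2_eq_square del: of_nat_Suc)
  ultimately show ?thesis by (simp add: sums_iff)
qed

lemma log_quot_primitive_has_derivative:
  assumes "t > 0" shows "(log_quot_primitive has_real_derivative log_quot t) (at t)"
proof -
  have "((\<lambda>t. dilog (exp (- t))) has_real_derivative (- ln (1 - exp (- t)) / exp (- t)) * (- exp (- t))) (at t)"
    by (rule DERIV_chain2[OF dilog_deriv]) (use assms in \<open>auto intro!: derivative_eq_intros\<close>)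
  then have "((\<lambda>t. dilog (exp (- t))) has_real_derivative ln (1 - exp (- t))) (at t)" by simp
  then show ?thesis unfolding log_quot_primitive_def log_quot_def using assms
    by (auto intro!: derivative_eq_intros)
qed

text \<open>This is Abel's theorem for $\sum 1/n^2$, by dominated convergence.\<close>

lemma dilog_limit_1: "((\<lambda>t. dilog (exp (- t))) \<longlongrightarrow> pi\<^sup>2 / 6) (at_right 0)"
proof -
  have sM: "(\<lambda>n. 1 / (real n)\<^sup>2) sums (pi\<^sup>2 / 6)"
    using inverse_squares_sums' sums_Suc_iff[of "\<lambda>n. 1 / (real n)\<^sup>2" "pi\<^sup>2 / 6"] by (simp add: add.commute)
  have bound: "norm (1 / (real n)\<^sup>2 * exp (- t) ^ n) \<le> 1 / (real n)\<^sup>2" if "t > 0" for n t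
  proof -
    have "exp (- t) ^ n \<le> 1" using that by (intro power_le_one) auto
    then have "1 / (real n)\<^sup>2 * exp (- t) ^ n \<le> 1 / (real n)\<^sup>2 * 1" by (intro mult_left_mono) auto
    then show ?thesis by simp
  qed
  have "((\<lambda>t. suminf (\<lambda>n. 1 / (real n)\<^sup>2 * exp (- t) ^ n)) \<longlongrightarrow> suminf (\<lambda>n. 1 / (real n)\<^sup>2)) (at_right 0)"
  proof (rule tannerys_theorem[THEN conjunct2, THEN conjunct2, OF _ _ sums_summable[OF sM]])
    fix n
    have "((\<lambda>t. 1 / (real n)\<^sup>2 * exp (- t) ^ n) \<longlongrightarrow> 1 / (real n)\<^sup>2 * exp (- 0) ^ n) (at_right 0)"
      by (intro tendsto_intros)
    then show "((\<lambda>t. 1 / (real n)\<^sup>2 * exp (- t) ^ n) \<longlongrightarrow> 1 / (real n)\<^sup>2) (at_right 0)" by simp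
  next
    have "eventually (\<lambda>x::real. x > 0) (at_right 0)" by (rule eventually_at_right_less)
    then show "\<forall>\<^sub>F (n, t) in sequentially \<times>\<^sub>F at_right 0. norm (1 / (real n)\<^sup>2 * exp (- t) ^ n) \<le> 1 / (real n)\<^sup>2"
      unfolding eventually_prod_filter
      by (intro exI[of _ "\<lambda>_. True"] exI[of _ "\<lambda>x. x > 0"] conjI allI impI)
         (auto simp only: prod.case intro: bound eventually_True)
  qed simp
  also have "suminf (\<lambda>n. 1 / (real n)\<^sup>2) = pi\<^sup>2 / 6" by (rule sums_unique[OF sM, symmetric])
  finally show ?thesis by (simp only: dilog_def)
qed

lemma dilog_limit_0: "x > 0 \<Longrightarrow> (\<lambda>n. dilog (exp (- (real n * x)))) \<longlonglongrightarrow> 0"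
proof -
  assume x: "x > 0"
  have "(dilog has_real_derivative suminf (\<lambda>n. diffs (\<lambda>n. 1 / (real n)\<^sup>2) n * 0 ^ n)) (at 0)"
    unfolding dilog_def by (rule termdiffs_strong'[of 1]) (use summable_dilog in auto)
  then have "isCont dilog 0" by (rule DERIV_isCont)
  moreover have "dilog 0 = 0" by (simp only: dilog_def powser_zero) simp
  ultimately have "(dilog \<longlongrightarrow> 0) (nhds 0)" by (simp add: isCont_def tendsto_nhds_iff)
  moreover have "(\<lambda>n. exp (- (real n * x))) \<longlonglongrightarrow> 0" using x by real_asymp
  ultimately show ?thesis by (rule filterlim_compose)
qed

text \<open>The primitive has limit $0$ at the origin, and its derivative at $t$ is at most $t$ in absolute value.\<close>

lemma log_quot_primitive_bound:
  assumes t: "t > 0"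
  shows "\<bar>log_quot_primitive t\<bar> \<le> t\<^sup>2"
proof -
  have lim: "(log_quot_primitive \<longlongrightarrow> 0) (at_right 0)"
  proof -
    have "((\<lambda>t::real. - t * ln t + t) \<longlongrightarrow> 0) (at_right 0)" by real_asymp
    from tendsto_add[OF tendsto_diff[OF dilog_limit_1 tendsto_const[of "pi\<^sup>2 / 6"]] this]
    have "((\<lambda>t. dilog (exp (- t)) - pi\<^sup>2 / 6 + (- t * ln t + t)) \<longlongrightarrow> 0) (at_right 0)" by simp
    moreover have "log_quot_primitive = (\<lambda>t. dilog (exp (- t)) - pi\<^sup>2 / 6 + (- t * ln t + t))"
      by (rule ext) (simp add: log_quot_primitive_def)
    ultimately show ?thesis by (simp only:)
  qed
  have le: "\<bar>log_quot_primitive t - log_quot_primitive s\<bar> \<le> t\<^sup>2" if s: "0 < s" "s < t" for s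
  proof -
    have "\<exists>z. s < z \<and> z < t \<and> log_quot_primitive t - log_quot_primitive s = (t - s) * log_quot z"
      using s by (intro MVT2 log_quot_primitive_has_derivative) auto
    then obtain z where z: "s < z" "z < t" "log_quot_primitive t - log_quot_primitive s = (t - s) * log_quot z" by auto
    have "\<bar>log_quot z\<bar> \<le> t" using log_quot_bounds[of z] z s by auto
    then have "(t - s) * \<bar>log_quot z\<bar> \<le> t * t" using s by (intro mult_mono) auto
    then show ?thesis using z s by (simp add: abs_mult power2_eq_square)
  qed
  have "((\<lambda>s. \<bar>log_quot_primitive t - log_quot_primitive s\<bar>) \<longlongrightarrow> \<bar>log_quot_primitive t - 0\<bar>) (at_right 0)" by (intro tendsto_intros lim)
  then have "\<bar>log_quot_primitive t - 0\<bar> \<le> t\<^sup>2"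
  proof (rule tendsto_upperbound)
    show "\<forall>\<^sub>F s in at_right 0. \<bar>log_quot_primitive t - log_quot_primitive s\<bar> \<le> t\<^sup>2"
      using eventually_at_right_real[OF t] by eventually_elim (use le in auto)
  qed simp
  then show ?thesis by simp
qed

lemma log_quot_sum_trapezoid:
  assumes x: "x > 0" and M: "M \<ge> 1"
  shows "\<bar>x * ((\<Sum>n=1..M. log_quot (real n * x)) - (log_quot x + log_quot (real M * x)) / 2) - (log_quot_primitive (real M * x) - log_quot_primitive x)\<bar>
     \<le> x\<^sup>2 / 2 * (log_quot_deriv (real M * x) - log_quot_deriv x)"
  using M
proof (induction M rule: dec_induct)
  case base
  then show ?case by simp
next
  case (step M)
  define a where "a = real M * x"
  define b where "b = real (Suc M) * x"
  have ab: "0 < a" "a \<le> b" "b - a = x" using x step by (auto simp: a_def b_def algebra_simps)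
  have "\<bar>(b - a) * (log_quot a + log_quot b) / 2 - (log_quot_primitive b - log_quot_primitive a)\<bar> \<le> (b - a)\<^sup>2 / 2 * (log_quot_deriv b - log_quot_deriv a)"
    using ab by (intro trapezoid_error log_quot_primitive_has_derivative log_quot_has_derivative log_quot_deriv_mono) auto
  moreover define S where "S = (\<Sum>n=1..M. log_quot (real n * x))"
  moreover have "(\<Sum>n=1..Suc M. log_quot (real n * x)) = S + log_quot b" by (simp add: S_def b_def)
  moreover have "x * ((S + log_quot b) - (log_quot x + log_quot b) / 2) - (log_quot_primitive b - log_quot_primitive x) =
     (x * (S - (log_quot x + log_quot a) / 2) - (log_quot_primitive a - log_quot_primitive x)) + (x * (log_quot a + log_quot b) / 2 - (log_quot_primitive b - log_quot_primitive a))"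
    by (simp add: field_simps)
  moreover have "\<bar>x * (S - (log_quot x + log_quot a) / 2) - (log_quot_primitive a - log_quot_primitive x)\<bar> \<le> x\<^sup>2 / 2 * (log_quot_deriv a - log_quot_deriv x)"
    using step.IH by (simp add: S_def a_def)
  moreover have "x\<^sup>2 / 2 * (log_quot_deriv b - log_quot_deriv x) = x\<^sup>2 / 2 * (log_quot_deriv a - log_quot_deriv x) + x\<^sup>2 / 2 * (log_quot_deriv b - log_quot_deriv a)"
    by (simp only: distrib_left[symmetric]) simp
  ultimately show ?case
    unfolding b_def[symmetric] ab(3) by (simp only:)
qed

text \<open>Apply the trapezoidal rule with step $x$ to the sum of $\log((1-e^{-t})/t)$ over the multiples $nx$ with $n \leq M$. The terms
$\log(nx)$ contribute $\log M!$, which is compared with the Stirling sequence, and all quantities that grow with $M$ cancel. Let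
$M \to \infty$; the error of the rule is at most $x/2$, and the boundary terms at $x$ are $O(x)$.\<close>

theorem log_gf_estimate:
  assumes x: "x > 0"
  shows "\<bar>log_gf x - pi\<^sup>2 / (6 * x) - ln x / 2 + ln (2 * pi) / 2\<bar> \<le> 2 * x"
proof -
  \<comment> \<open>The error of the trapezoidal rule divided by $x$, with all terms that grow with $M$ cancelled.\<close>
  define T where "T M = (\<Sum>n=1..M. ln (1 - exp (- (real n * x)))) - stirling_seq M - log_quot x / 2
     - ln (1 - exp (- (real M * x))) / 2 + ln x / 2 - dilog (exp (- (real M * x))) / x + pi\<^sup>2 / (6 * x) + log_quot_primitive x / x" for M
  have T: "\<bar>T M\<bar> \<le> x / 2" if M: "M \<ge> 1" for M
  proof -
    have s: "(\<Sum>n=1..M. log_quot (real n * x)) = (\<Sum>n=1..M. ln (1 - exp (- (real n * x)))) - (ln (fact M) + real M * ln x)"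
    proof -
      have "(\<Sum>n=1..M. ln (real n * x)) = (\<Sum>n=1..M. ln (real n) + ln x)"
        using x by (intro sum.cong) (auto simp: ln_mult)
      also have "\<dots> = ln (fact M) + real M * ln x"
        unfolding sum.distrib sum_ln_eq_ln_fact by simp
      finally show ?thesis by (simp add: log_quot_def sum_subtractf)
    qed
    have M0: "real M > 0" using M by simp
    have lnM: "ln (real M * x) = ln (real M) + ln x" using M0 x by (simp add: ln_mult)
    have "x * T M = x * ((\<Sum>n=1..M. log_quot (real n * x)) - (log_quot x + log_quot (real M * x)) / 2) - (log_quot_primitive (real M * x) - log_quot_primitive x)"
      unfolding T_def s stirling_seq_def log_quot_primitive_def[of "real M * x"] log_quot_def[of "real M * x"] lnM
      using x by (simp add: field_simps)
    then have "\<bar>x * T M\<bar> \<le> x\<^sup>2 / 2 * (log_quot_deriv (real M * x) - log_quot_deriv x)"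
      using log_quot_sum_trapezoid[OF x M] by simp
    also have "\<dots> \<le> x\<^sup>2 / 2 * 1"
      using log_quot_deriv_bounds[of "real M * x"] log_quot_deriv_bounds[OF x] M0 x by (intro mult_left_mono) auto
    finally have "x * \<bar>T M\<bar> \<le> x * (x / 2)" using x by (simp add: abs_mult power2_eq_square)
    then show ?thesis using x by simp
  qed
  have "T \<longlonglongrightarrow> - log_gf x - ln (2 * pi) / 2 - log_quot x / 2 - ln (1 - 0) / 2 + ln x / 2 - 0 / x + pi\<^sup>2 / (6 * x) + log_quot_primitive x / x"
    unfolding T_def
  proof (intro tendsto_intros stirling_limit dilog_limit_0 x)
    have "(\<lambda>k. ln (1 - exp (- (real (Suc k) * x)))) sums - log_gf x"
      using sums_minus[OF log_gf_sums[OF x]] by simp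
    then show "(\<lambda>M. \<Sum>n=1..M. ln (1 - exp (- (real n * x)))) \<longlonglongrightarrow> - log_gf x"
      by (simp only: sums_def One_nat_def sum.atLeast1_atMost_eq)
    show "(\<lambda>M. exp (- (real M * x))) \<longlonglongrightarrow> 0" using x by real_asymp
  qed (use x in auto)
  from tendsto_rabs[OF this]
  have "\<bar>- log_gf x - ln (2 * pi) / 2 - log_quot x / 2 - ln (1 - 0) / 2 + ln x / 2 - 0 / x + pi\<^sup>2 / (6 * x) + log_quot_primitive x / x\<bar> \<le> x / 2"
    by (rule tendsto_upperbound) (rule eventually_mono[OF eventually_ge_at_top[of 1]], rule T, simp_all)
  then have "\<bar>- log_gf x - ln (2 * pi) / 2 - log_quot x / 2 + ln x / 2 + pi\<^sup>2 / (6 * x) + log_quot_primitive x / x\<bar> \<le> x / 2"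
    by simp
  moreover have "\<bar>log_quot_primitive x / x\<bar> \<le> x"
    using log_quot_primitive_bound[OF x] x by (simp add: field_simps power2_eq_square)
  moreover have "\<bar>log_quot x\<bar> \<le> x" using log_quot_bounds[OF x] by auto
  ultimately show ?thesis by linarith
qed

section \<open>The Hardy-Ramanujan formula\<close>

lemma summable_log_ratio:
  assumes x: "x > 0"
  shows "summable (\<lambda>m. of_real (real (divisor_sum m) / real m * exp (- (real m * x))) * (exp (\<i> * of_real (real m * t)) - 1))"
proof (rule summable_norm_cancel, rule summable_comparison_test')
  define a where "a m = real (divisor_sum m) / real m * exp (- (real m * x))" for m
  show "summable (\<lambda>m. a m * 2)" unfolding a_def by (intro summable_mult2 summable_log_gf x)
  fix m
  have "norm (exp (\<i> * of_real (real m * t)) - 1) \<le> norm (exp (\<i> * of_real (real m * t))) + norm (1 :: complex)"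
    by (rule norm_triangle_ineq4)
  then have "norm (exp (\<i> * of_real (real m * t)) - 1) \<le> 2" by (simp only: norm_exp_i_times) simp
  moreover have "a m \<ge> 0" by (simp add: a_def)
  ultimately have "norm (norm (of_real (a m) * (exp (\<i> * of_real (real m * t)) - 1))) \<le> a m * 2"
    unfolding norm_mult by (simp add: mult_left_mono del: of_real_mult)
  then show "norm (norm (of_real (real (divisor_sum m) / real m * exp (- (real m * x))) * (exp (\<i> * of_real (real m * t)) - 1))) \<le> a m * 2"
    by (simp only: a_def)
qed

text \<open>Termwise this is the Taylor estimate $|e^{iy} - 1 - iy + y^2/2| \leq |y|^3/6$ at $y = mt$. As the coefficients of the series are
non-negative, the remainders sum to a moment at the real point $x$.\<close>

lemma log_ratio_approx:
  assumes x: "x > 0"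
  shows "norm (log_ratio x t - (\<i> * of_real (t * divisor_moment 0 x) - of_real (t\<^sup>2 / 2 * divisor_moment 1 x)))
    \<le> \<bar>t\<bar> ^ 3 / 6 * divisor_moment 2 x"
proof -
  define c where "c m = real (divisor_sum m) / real m * exp (- (real m * x))" for m
  have mom: "(\<lambda>m. c m * real m ^ Suc i) sums divisor_moment i x" for i
  proof -
    have eq: "c m * real m ^ Suc i = real m ^ i * real (divisor_sum m) * exp (- (real m * x))" for m
      by (cases "m = 0") (auto simp: c_def)
    show ?thesis unfolding divisor_moment_def eq by (rule summable_sums[OF summable_divisor_moment[OF x]])
  qed
  have c0: "c m \<ge> 0" for m by (simp add: c_def)
  define e where "e m = of_real (c m) * (exp (\<i> * of_real (real m * t)) - 1)" for m
  have "summable e"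
    unfolding e_def c_def by (rule summable_log_ratio[OF x])
  then have "e sums log_ratio x t"
    unfolding log_ratio_def e_def c_def by (rule summable_sums)
  moreover have "(\<lambda>m. \<i> * of_real (t * (c m * real m ^ Suc 0)) - of_real (t\<^sup>2 / 2 * (c m * real m ^ Suc 1)) :: complex)
      sums (\<i> * of_real (t * divisor_moment 0 x) - of_real (t\<^sup>2 / 2 * divisor_moment 1 x))"
    by (intro sums_diff sums_mult sums_of_real mom)
  ultimately have "(\<lambda>m. e m - (\<i> * of_real (t * (c m * real m ^ Suc 0)) - of_real (t\<^sup>2 / 2 * (c m * real m ^ Suc 1))))
      sums (log_ratio x t - (\<i> * of_real (t * divisor_moment 0 x) - of_real (t\<^sup>2 / 2 * divisor_moment 1 x)))" (is "?d sums ?D")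
    by (rule sums_diff)
  then have "suminf ?d = ?D" by (rule sums_unique[symmetric])
  moreover have bound: "norm (?d m) \<le> \<bar>t\<bar> ^ 3 / 6 * (c m * real m ^ Suc 2)" for m
  proof -
    let ?y = "real m * t"
    have "norm (exp (\<i> * of_real ?y) - (\<Sum>k\<le>2. (\<i> * of_real ?y) ^ k / fact k)) \<le> \<bar>?y\<bar> ^ Suc 2 / fact (Suc 2)"
      by (rule iexp_approx1)
    moreover have "(\<Sum>k\<le>2. (\<i> * of_real ?y) ^ k / fact k) = 1 + \<i> * of_real ?y - of_real (?y\<^sup>2 / 2)"
      by (simp add: numeral_2_eq_2 power_mult_distrib)
    moreover have d: "?d m = of_real (c m) * (exp (\<i> * of_real ?y) - (1 + \<i> * of_real ?y - of_real (?y\<^sup>2 / 2)))"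
      by (simp add: e_def algebra_simps power2_eq_square)
    moreover have "\<bar>?y\<bar> ^ Suc 2 / fact (Suc 2) = \<bar>t\<bar> ^ 3 / 6 * real m ^ 3"
      by (simp add: abs_mult power_mult_distrib eval_nat_numeral)
    ultimately have "norm (exp (\<i> * of_real ?y) - (1 + \<i> * of_real ?y - of_real (?y\<^sup>2 / 2))) \<le> \<bar>t\<bar> ^ 3 / 6 * real m ^ 3"
      by (simp only:)
    then have "norm (?d m) \<le> c m * (\<bar>t\<bar> ^ 3 / 6 * real m ^ 3)"
      unfolding d norm_mult norm_of_real abs_of_nonneg[OF c0] by (rule mult_left_mono) (rule c0)
    then show ?thesis by (simp add: mult_ac numeral_3_eq_3 numeral_2_eq_2)
  qed
  moreover have bs: "(\<lambda>m. \<bar>t\<bar> ^ 3 / 6 * (c m * real m ^ Suc 2)) sums (\<bar>t\<bar> ^ 3 / 6 * divisor_moment 2 x)"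
    by (intro sums_mult mom)
  moreover have "norm (suminf ?d) \<le> suminf (\<lambda>m. \<bar>t\<bar> ^ 3 / 6 * (c m * real m ^ Suc 2))"
    by (rule norm_suminf_le[OF bound sums_summable[OF bs]])
  moreover have "suminf (\<lambda>m. \<bar>t\<bar> ^ 3 / 6 * (c m * real m ^ Suc 2)) = \<bar>t\<bar> ^ 3 / 6 * divisor_moment 2 x"
    by (rule sums_unique[OF bs, symmetric])
  ultimately show ?thesis by (simp only:)
qed

lemma one_minus_cos_ge:
  assumes "\<bar>t\<bar> \<le> pi" shows "t\<^sup>2 / 8 \<le> 1 - cos t"
proof -
  have *: "u / 2 \<le> sin u" if u: "0 \<le> u" "u \<le> pi / 2" for u
  proof -
    have "\<bar>sin u - (\<Sum>m<3. sin_coeff m * u ^ m)\<bar> \<le> inverse (fact 3) * \<bar>u\<bar> ^ 3" by (rule Maclaurin_sin_bound)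
    moreover have "(\<Sum>m<3. sin_coeff m * u ^ m) = u" by (simp add: sin_coeff_def eval_nat_numeral)
    moreover have "inverse (fact 3) * \<bar>u\<bar> ^ 3 = u ^ 3 / 6" using u by (simp add: eval_nat_numeral)
    ultimately have "u - u ^ 3 / 6 \<le> sin u" by linarith
    moreover have "u ^ 3 / 6 \<le> u / 2"
    proof -
      have "pi < 3.2" using pi_approx by simp
      then have "u * u \<le> 1.6 * 1.6" using u by (intro mult_mono) auto
      then have "u * u \<le> 3" by simp
      then have "u * (u * u) \<le> u * 3" using u by (intro mult_left_mono) auto
      then show ?thesis by (simp add: power3_eq_cube)
    qed
    ultimately show ?thesis by linarith
  qed
  have "\<bar>t\<bar> / 2 / 2 \<le> sin (\<bar>t\<bar> / 2)" using assms by (intro *) auto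
  then have "(\<bar>t\<bar> / 4)\<^sup>2 \<le> (sin (\<bar>t\<bar> / 2))\<^sup>2" by (intro power_mono) auto
  moreover have "1 - cos \<bar>t\<bar> = 2 * (sin (\<bar>t\<bar> / 2))\<^sup>2" using cos_double_sin[of "\<bar>t\<bar> / 2"] by simp
  ultimately show ?thesis by (simp add: power_divide)
qed

text \<open>The sum is $\mathrm{Re}\,(1/(1-q)) - 1/(1-r)$ with $q = r e^{it}$, and $|1-q|^2 = (1-r)^2 + 2r(1 - \cos t)$.\<close>

lemma Re_geometric_difference:
  fixes r t :: real
  assumes r: "0 < r" "r < 1"
  defines "c \<equiv> 1 - cos t"
  shows "(\<lambda>m. r ^ m * (cos (real m * t) - 1)) sums (- (r * (1 + r) * c / ((1 - r) * ((1 - r)\<^sup>2 + 2 * r * c))))"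
proof -
  define q where "q = complex_of_real r * cis t"
  have nq: "norm q < 1" using r by (simp add: q_def norm_mult)
  have "(\<lambda>m. q ^ m) sums (1 / (1 - q))" using geometric_sums[OF nq] .
  then have "(\<lambda>m. Re (q ^ m)) sums Re (1 / (1 - q))" by (rule sums_Re)
  moreover have "Re (q ^ m) = r ^ m * cos (real m * t)" for m
  proof -
    have "q ^ m = of_real (r ^ m) * cis (real m * t)"
      unfolding q_def power_mult_distrib Complex.DeMoivre by simp
    then show ?thesis by simp
  qed
  moreover have "(\<lambda>m. r ^ m) sums (1 / (1 - r))" using r by (intro geometric_sums) auto
  ultimately have "(\<lambda>m. r ^ m * cos (real m * t) - r ^ m) sums (Re (1 / (1 - q)) - 1 / (1 - r))"
    by (intro sums_diff) auto
  moreover have "Re (1 / (1 - q)) - 1 / (1 - r) = - (r * (1 + r) * c / ((1 - r) * ((1 - r)\<^sup>2 + 2 * r * c)))"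
  proof -
    define D where "D = (1 - r)\<^sup>2 + 2 * r * c"
    have c0: "c \<ge> 0" by (simp add: c_def)
    have D: "D > 0" unfolding D_def using r c0 by (intro add_pos_nonneg) auto
    have "Re (1 / (1 - q)) = (1 - r * cos t) / ((1 - r * cos t)\<^sup>2 + (r * sin t)\<^sup>2)"
      by (simp add: q_def Re_divide power2_eq_square)
    also have "(1 - r * cos t)\<^sup>2 + (r * sin t)\<^sup>2 = 1 - 2 * r * cos t + r\<^sup>2 * ((cos t)\<^sup>2 + (sin t)\<^sup>2)"
      by (simp add: power2_eq_square algebra_simps
          del: sin_cos_squared_add sin_cos_squared_add2 sin_cos_squared_add3)
    also have "\<dots> = D" unfolding sin_cos_squared_add2 by (simp add: D_def c_def power2_eq_square algebra_simps)
    finally have R: "Re (1 / (1 - q)) = (1 - r * cos t) / D" .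
    have "(1 - r * cos t) / D - 1 / (1 - r) = ((1 - r * cos t) * (1 - r) - D) / ((1 - r) * D)"
      using r D by (simp add: field_simps)
    also have "(1 - r * cos t) * (1 - r) - D = - (r * (1 + r) * c)"
      by (simp add: D_def c_def power2_eq_square algebra_simps)
    finally show ?thesis using R by (simp add: D_def)
  qed
  ultimately show ?thesis by (simp add: algebra_simps)
qed

text \<open>All terms $\cos(mt) - 1$ are at most $0$, and $\sigma(m) \geq m$, so the coefficients $\sigma(m)/m$ may be replaced by $1$. The
resulting geometric series is of the right order $t^2/x^3$ for small $t$, and it still gives exponential decay, of exponent
$-c/x$, for $t$ of the order of $x$ or larger. One bound thus serves the whole circle.\<close>

lemma Re_log_ratio_le:
  assumes x: "0 < x" "x \<le> 1 / 2" and t: "\<bar>t\<bar> \<le> pi"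
  shows "Re (log_ratio x t) \<le> - (3 / 32 * t\<^sup>2 / (x * (x\<^sup>2 + t\<^sup>2)))"
proof -
  define r where "r = exp (- x)"
  define a where "a m = real (divisor_sum m) / real m * exp (- (real m * x))" for m
  have r: "0 < r" "r < 1" "1 / 2 \<le> r" "1 - r \<le> x"
    using x exp_ge_add_one_self[of "- x"] by (auto simp: r_def)
  define c where "c = 1 - cos t"
  have c: "t\<^sup>2 / 8 \<le> c" "0 \<le> c" using one_minus_cos_ge[OF t] by (auto simp: c_def)
  have rm: "exp (- (real m * x)) = r ^ m" for m by (simp add: r_def exp_of_nat_mult[symmetric])
  from sums_Re[OF summable_sums[OF summable_log_ratio[OF x(1), of t]]]
  have "(\<lambda>m. Re (of_real (a m) * (exp (\<i> * of_real (real m * t)) - 1))) sums Re (log_ratio x t)"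
    by (simp only: log_ratio_def a_def)
  moreover have "Re (of_real (a m) * (exp (\<i> * of_real (real m * t)) - 1)) = a m * (cos (real m * t) - 1)" for m
    by (simp add: Re_exp)
  ultimately have s1: "(\<lambda>m. a m * (cos (real m * t) - 1)) sums Re (log_ratio x t)" by (simp only:)
  have "Re (log_ratio x t) \<le> - (r * (1 + r) * c / ((1 - r) * ((1 - r)\<^sup>2 + 2 * r * c)))"
  proof (rule sums_le[OF _ s1 Re_geometric_difference[OF r(1,2), of t, folded c_def]])
    fix m
    show "a m * (cos (real m * t) - 1) \<le> r ^ m * (cos (real m * t) - 1)"
    proof (cases "m = 0")
      case False
      have "real m \<le> real (divisor_sum m)" using divisor_sum_ge[of m] False by simp
      then have "1 \<le> real (divisor_sum m) / real m" using False by (simp add: field_simps)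
      then have "1 * r ^ m \<le> a m" unfolding a_def rm using r by (intro mult_right_mono) auto
      then show ?thesis by (intro mult_right_mono_neg) auto
    qed simp
  qed
  moreover have "3 / 32 * t\<^sup>2 / (x * (x\<^sup>2 + t\<^sup>2)) \<le> r * (1 + r) * c / ((1 - r) * ((1 - r)\<^sup>2 + 2 * r * c))"
  proof (cases "t = 0")
    case False
    then have cpos: "c > 0" using c by (smt (verit) zero_less_power2 divide_pos_pos)
    have "3 / 32 * t\<^sup>2 / (x * (x\<^sup>2 + t\<^sup>2)) \<le> 3 / 32 * t\<^sup>2 / (x * (x\<^sup>2 + t\<^sup>2 / 4))"
      using x False by (intro divide_left_mono mult_left_mono mult_pos_pos add_pos_nonneg) auto
    also have "\<dots> \<le> (3 / 4 * c) / (x * (x\<^sup>2 + 2 * c))"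
    proof -
      have "t\<^sup>2 / 8 * (x\<^sup>2 + 2 * c) \<le> c * (x\<^sup>2 + t\<^sup>2 / 4)"
        using mult_right_mono[OF c(1), of "x\<^sup>2"] by (simp add: algebra_simps)
      moreover have "x\<^sup>2 + 2 * c > 0" "x\<^sup>2 + t\<^sup>2 / 4 > 0" using x cpos by (auto intro!: add_pos_nonneg)
      ultimately have "(t\<^sup>2 / 8) / (x\<^sup>2 + t\<^sup>2 / 4) \<le> c / (x\<^sup>2 + 2 * c)" by (simp add: frac_le_eq divide_le_0_iff) (simp add: algebra_simps)
      then have "3 / (4 * x) * ((t\<^sup>2 / 8) / (x\<^sup>2 + t\<^sup>2 / 4)) \<le> 3 / (4 * x) * (c / (x\<^sup>2 + 2 * c))"
        using x by (intro mult_left_mono) auto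
      then show ?thesis using x by (simp add: mult_ac)
    qed
    also have "\<dots> \<le> r * (1 + r) * c / ((1 - r) * ((1 - r)\<^sup>2 + 2 * r * c))"
    proof (intro frac_le mult_right_mono mult_mono add_mono power_mono mult_pos_pos add_pos_nonneg)
      have "1 / 2 * (1 + 1 / 2) \<le> r * (1 + r)" using r by (intro mult_mono) auto
      then show "3 / 4 \<le> r * (1 + r)" by simp
    qed (use r c x in auto)
    finally show ?thesis .
  qed (use r c in auto)
  ultimately show ?thesis by linarith
qed

text \<open>The integrand of the inversion formula at scale $t = x^{3/2} v$. The number $n$ is replaced by $\pi^2/(6x^2)$, with which it agrees
for $x = \pi/\sqrt{6n}$, so that $x$ can be treated as a continuous variable.\<close>

definition kernel :: "real \<Rightarrow> real \<Rightarrow> complex" where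
  "kernel x v = indicator {-pi..pi} (x powr (3/2) * v) *\<^sub>R
     exp (log_ratio x (x powr (3/2) * v) - \<i> * of_real (pi\<^sup>2 / (6 * x\<^sup>2) * (x powr (3/2) * v)))"

lemma kernel_measurable [measurable]: "kernel x \<in> borel_measurable lborel"
proof -
  have "log_ratio x \<in> borel_measurable borel"
    unfolding log_ratio_def[abs_def] by (intro borel_measurable_suminf) measurable
  then show ?thesis unfolding kernel_def[abs_def] by measurable
qed

text \<open>Let $w = v^2/(1 + x v^2)$, so that the kernel is at most $e^{-kw}$ in absolute value. If $x v^2 \leq 1$ then $w \geq v^2/2$. Otherwise
$w \geq 1/(2x)$, and $|t| \leq \pi$ means $v^2 \leq \pi^2/x^3$, which is at most $8 \pi^2 w^3$. In both cases $v^2$ is bounded by a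
polynomial in $w$ and hence by a multiple of $e^{kw}$.\<close>

lemma kernel_bound:
  obtains C where "\<And>x v. 0 < x \<Longrightarrow> x \<le> 1 / 2 \<Longrightarrow> norm (kernel x v) \<le> C * inverse (1 + v\<^sup>2)"
proof -
  define k :: real where "k = 3 / 32"
  define C where "C = 1 + 2 / k + 8 * pi\<^sup>2 * (6 / k ^ 3)"
  have "norm (kernel x v) \<le> C * inverse (1 + v\<^sup>2)" if x: "0 < x" "x \<le> 1 / 2" for x v
  proof (cases "\<bar>x powr (3/2) * v\<bar> \<le> pi")
    case False
    then have "kernel x v = 0" by (auto simp: kernel_def indicator_def)
    moreover have "0 \<le> C" by (auto simp: C_def k_def)
    ultimately show ?thesis by simp
  next
    case True
    define t where "t = x powr (3/2) * v"
    have t: "\<bar>t\<bar> \<le> pi" using True by (simp add: t_def)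
    have "(x powr (3/2))\<^sup>2 = x powr 3" by (simp add: power2_eq_square powr_add[symmetric])
    also have "\<dots> = x ^ 3" using x by simp
    finally have t2: "t\<^sup>2 = x ^ 3 * v\<^sup>2" by (simp add: t_def power_mult_distrib)
    define w where "w = v\<^sup>2 / (1 + x * v\<^sup>2)"
    have den: "1 + x * v\<^sup>2 > 0" using x by (intro add_pos_nonneg) auto
    have w0: "w \<ge> 0" using den by (simp add: w_def)
    have "t\<^sup>2 / (x * (x\<^sup>2 + t\<^sup>2)) = (x ^ 3 * v\<^sup>2) / (x ^ 3 * (1 + x * v\<^sup>2))"
      unfolding t2 by (simp add: power2_eq_square power3_eq_cube algebra_simps)
    also have "\<dots> = w" using x by (simp add: w_def)
    finally have wt: "t\<^sup>2 / (x * (x\<^sup>2 + t\<^sup>2)) = w" .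
    have "norm (kernel x v) \<le> exp (Re (log_ratio x t))"
      by (simp add: kernel_def t_def[symmetric] norm_exp_eq_Re indicator_def)
    also have "\<dots> \<le> exp (- (k * w))"
      using Re_log_ratio_le[OF x t] unfolding k_def wt[symmetric] by simp
    also have "\<dots> \<le> C * inverse (1 + v\<^sup>2)"
    proof -
      have v2: "v\<^sup>2 \<le> 2 * w + 8 * pi\<^sup>2 * w ^ 3"
      proof (cases "x * v\<^sup>2 \<le> 1")
        case True
        then have "v\<^sup>2 * (1 + x * v\<^sup>2) \<le> v\<^sup>2 * 2" by (intro mult_left_mono) auto
        then have "v\<^sup>2 \<le> 2 * w" using den by (simp add: w_def field_simps)
        moreover have "0 \<le> 8 * pi\<^sup>2 * w ^ 3" using w0 by simp
        ultimately show ?thesis by linarith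
      next
        case False
        then have "1 + x * v\<^sup>2 \<le> 2 * (x * v\<^sup>2)" by simp
        then have "1 / (2 * x) \<le> w" using x den by (simp add: w_def field_simps)
        then have "(1 / (2 * x)) ^ 3 \<le> w ^ 3" using x by (intro power_mono) auto
        then have "8 * pi\<^sup>2 * (1 / (2 * x)) ^ 3 \<le> 8 * pi\<^sup>2 * w ^ 3" by (intro mult_left_mono) auto
        moreover have "8 * pi\<^sup>2 * (1 / (2 * x)) ^ 3 = pi\<^sup>2 / x ^ 3" by (simp add: power_divide power_mult_distrib)
        moreover have "\<bar>t\<bar>\<^sup>2 \<le> pi\<^sup>2" using t by (intro power_mono) auto
        then have "v\<^sup>2 \<le> pi\<^sup>2 / x ^ 3" using x by (simp add: t2 field_simps)
        ultimately show ?thesis using w0 by linarith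
      qed
      define E where "E = exp (k * w)"
      have kw: "k * w \<ge> 0" "k > 0" using w0 by (auto simp: k_def)
      have E1: "1 \<le> E" using kw by (simp add: E_def)
      have "k * w \<le> E" unfolding E_def using exp_ge_add_one_self[of "k * w"] by linarith
      then have E2: "2 * w \<le> 2 / k * E" using kw by (simp add: field_simps)
      have "(k * w) ^ 3 / fact 3 \<le> E"
      proof -
        have "(\<Sum>n\<in>{3}. (k * w) ^ n / fact n) \<le> suminf (\<lambda>n. (k * w) ^ n / fact n)"
          by (rule sum_le_suminf) (use kw summable_exp[of "k * w"] in \<open>auto simp: divide_inverse mult.commute\<close>)
        then show ?thesis by (simp add: E_def exp_def divide_inverse mult.commute)
      qed
      then have "w ^ 3 \<le> 6 / k ^ 3 * E" using kw by (simp add: power_mult_distrib field_simps eval_nat_numeral)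
      then have E3: "8 * pi\<^sup>2 * w ^ 3 \<le> 8 * pi\<^sup>2 * (6 / k ^ 3 * E)" by (intro mult_left_mono) auto
      have "1 + v\<^sup>2 \<le> C * E" using E1 E2 E3 v2 by (simp add: C_def distrib_right)
      moreover have "1 + v\<^sup>2 > 0" by (intro add_pos_nonneg) auto
      ultimately show ?thesis by (simp add: E_def exp_minus field_simps)
    qed
    finally show ?thesis .
  qed
  then show ?thesis by (rule that)
qed

text \<open>At $t = x^{3/2} v$ the cubic remainder is $O(x^{9/2} \cdot x^{-4})$, the linear term is $O(x^{3/2} \cdot x^{-5/4})$, and the
quadratic term tends to $(v^2/2) \cdot \pi^2/3$.\<close>

lemma kernel_limit:
  "((\<lambda>x. kernel x v) \<longlongrightarrow> of_real (exp (- (pi\<^sup>2 * v\<^sup>2 / 6)))) (at_right 0)"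
proof -
  obtain C where C: "\<And>x. x > 0 \<Longrightarrow> \<bar>divisor_moment 0 x - pi\<^sup>2 / (6 * x\<^sup>2)\<bar> \<le> C * x powr (-5/4)"
    using divisor_moment_0_estimate by blast
  define s where "s x = x powr (3/2) * v" for x :: real
  define A where "A x = log_ratio x (s x) - (\<i> * of_real (s x * divisor_moment 0 x) - of_real ((s x)\<^sup>2 / 2 * divisor_moment 1 x))" for x
  define B where "B x = s x * (divisor_moment 0 x - pi\<^sup>2 / (6 * x\<^sup>2))" for x
  define D where "D x = (s x)\<^sup>2 / 2 * divisor_moment 1 x" for x
  have pos: "eventually (\<lambda>x::real. x > 0) (at_right 0)" by (rule eventually_at_right_less)
  have A: "(A \<longlongrightarrow> 0) (at_right 0)"
  proof (rule Lim_null_comparison)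
    show "\<forall>\<^sub>F x in at_right 0. norm (A x) \<le> \<bar>v\<bar> ^ 3 * (8 * pi\<^sup>2 / 9) * x powr (1/2)"
      using pos
    proof eventually_elim
      case (elim x)
      have "norm (A x) \<le> \<bar>s x\<bar> ^ 3 / 6 * divisor_moment 2 x"
        unfolding A_def by (rule log_ratio_approx[OF elim])
      also have "\<dots> \<le> \<bar>s x\<bar> ^ 3 / 6 * (16 * pi\<^sup>2 / (3 * x ^ 4))"
        by (intro mult_left_mono divisor_moment_2_le elim) auto
      also have "\<bar>s x\<bar> ^ 3 = x powr (9/2) * \<bar>v\<bar> ^ 3"
      proof -
        have "(x powr (3/2)) ^ 3 = x powr (9/2)" by (simp add: power3_eq_cube powr_add[symmetric])
        then show ?thesis by (simp add: s_def abs_mult power_mult_distrib)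
      qed
      also have "x powr (9/2) * \<bar>v\<bar> ^ 3 / 6 * (16 * pi\<^sup>2 / (3 * x ^ 4)) = \<bar>v\<bar> ^ 3 * (8 * pi\<^sup>2 / 9) * (x powr (9/2) / x powr 4)"
        using elim by (simp add: field_simps)
      also have "x powr (9/2) / x powr 4 = x powr (1/2)"
        by (simp add: powr_diff[symmetric])
      finally show ?case .
    qed
    show "((\<lambda>x. \<bar>v\<bar> ^ 3 * (8 * pi\<^sup>2 / 9) * x powr (1/2)) \<longlongrightarrow> 0) (at_right 0)" by real_asymp
  qed
  have B: "(B \<longlongrightarrow> 0) (at_right 0)"
  proof (rule Lim_null_comparison)
    show "\<forall>\<^sub>F x in at_right 0. norm (B x) \<le> \<bar>v\<bar> * C * x powr (1/4)"
      using pos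
    proof eventually_elim
      case (elim x)
      have "norm (B x) \<le> \<bar>s x\<bar> * (C * x powr (-5/4))"
        unfolding B_def real_norm_def abs_mult[of "s x"] by (intro mult_left_mono C elim) auto
      also have "\<dots> = \<bar>v\<bar> * C * (x powr (3/2) * x powr (-5/4))" by (simp add: s_def abs_mult mult_ac)
      also have "x powr (3/2) * x powr (-5/4) = x powr (1/4)" by (simp add: powr_add[symmetric])
      finally show ?case .
    qed
    have "((\<lambda>x::real. x powr (1/4)) \<longlongrightarrow> 0) (at_right 0)" by real_asymp
    from tendsto_mult[OF tendsto_const[of "\<bar>v\<bar> * C"] this]
    show "((\<lambda>x. \<bar>v\<bar> * C * x powr (1/4)) \<longlongrightarrow> 0) (at_right 0)" by simp
  qed
  have D: "(D \<longlongrightarrow> pi\<^sup>2 * v\<^sup>2 / 6) (at_right 0)"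
  proof -
    have "((\<lambda>x. v\<^sup>2 / 2 * (x ^ 3 * divisor_moment 1 x)) \<longlongrightarrow> v\<^sup>2 / 2 * (pi\<^sup>2 / 3)) (at_right 0)"
      by (intro tendsto_mult tendsto_const divisor_moment_1_limit)
    moreover have "\<forall>\<^sub>F x in at_right 0. v\<^sup>2 / 2 * (x ^ 3 * divisor_moment 1 x) = D x"
      using pos
    proof eventually_elim
      case (elim x)
      have "(x powr (3/2))\<^sup>2 = x powr 3" by (simp add: power2_eq_square powr_add[symmetric])
      also have "\<dots> = x ^ 3" using elim by simp
      finally show ?case by (simp add: D_def s_def power_mult_distrib)
    qed
    ultimately show ?thesis by (rule Lim_transform_eventually[THEN tendsto_eq_rhs]) simp
  qed
  have "((\<lambda>x. exp (A x + \<i> * of_real (B x) - of_real (D x))) \<longlongrightarrow> exp (0 + \<i> * of_real 0 - of_real (pi\<^sup>2 * v\<^sup>2 / 6))) (at_right 0)"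
    by (intro tendsto_intros A B D)
  then have "((\<lambda>x. exp (A x + \<i> * of_real (B x) - of_real (D x))) \<longlongrightarrow> of_real (exp (- (pi\<^sup>2 * v\<^sup>2 / 6)))) (at_right 0)"
    by (simp add: exp_of_real[symmetric])
  moreover have "\<forall>\<^sub>F x in at_right 0. exp (A x + \<i> * of_real (B x) - of_real (D x)) = kernel x v"
  proof -
    have "((\<lambda>x::real. x powr (3/2)) \<longlongrightarrow> 0) (at_right 0)" by real_asymp
    then have "((\<lambda>x. \<bar>x powr (3/2) * v\<bar>) \<longlongrightarrow> 0) (at_right 0)"
      by (intro tendsto_rabs_zero tendsto_mult_left_zero)
    then have "\<forall>\<^sub>F x in at_right 0. \<bar>x powr (3/2) * v\<bar> < pi" by (rule order_tendstoD) simp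
    then show ?thesis
    proof eventually_elim
      case (elim x)
      then have "indicator {-pi..pi} (x powr (3/2) * v) = (1::real)" by (auto simp: indicator_def)
      moreover have "A x + \<i> * of_real (B x) - of_real (D x) = log_ratio x (s x) - \<i> * of_real (pi\<^sup>2 / (6 * x\<^sup>2) * s x)"
        by (simp add: A_def B_def D_def algebra_simps)
      ultimately show ?case by (simp only: kernel_def s_def scaleR_one)
    qed
  qed
  ultimately show ?thesis by (rule Lim_transform_eventually)
qed

text \<open>A normal density of variance $3/\pi^2$, up to its normalization.\<close>

lemma gaussian_integral: "(LINT v|lborel. exp (- (pi\<^sup>2 * v\<^sup>2 / 6))) = sqrt (6 / pi)"
proof -
  define d where "d = sqrt 3 / pi"
  have d: "d > 0" "d\<^sup>2 = 3 / pi\<^sup>2" by (auto simp: d_def power_divide)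
  have "exp (- (pi\<^sup>2 * v\<^sup>2 / 6)) = sqrt (6 / pi) * normal_density 0 d v" for v
  proof -
    have e: "2 * pi * d\<^sup>2 = 6 / pi" unfolding d(2) by (simp add: field_simps power2_eq_square)
    have "- (v - 0)\<^sup>2 / (2 * d\<^sup>2) = - (pi\<^sup>2 * v\<^sup>2 / 6)" unfolding d(2) by simp
    then show ?thesis unfolding normal_density_def e by simp
  qed
  then show ?thesis using integral_normal_density[OF d(1), of 0] by simp
qed

text \<open>The substitution $x = e^{-T}$ keeps $x$ positive for every real $T$ and turns the limit at $0$ into a limit at infinity.\<close>

lemma kernel_integral_limit:
  "((\<lambda>T. LINT v|lborel. kernel (exp (- T)) v) \<longlongrightarrow> of_real (sqrt (6 / pi))) at_top"
proof -
  obtain C where C: "\<And>x v. 0 < x \<Longrightarrow> x \<le> 1 / 2 \<Longrightarrow> norm (kernel x v) \<le> C * inverse (1 + v\<^sup>2)"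
    using kernel_bound by blast
  have ln2: "exp (- T) \<le> 1 / 2" if "T \<ge> ln 2" for T :: real
    using that exp_le_cancel_iff[of "- T" "- ln 2"] by (simp add: exp_minus)
  have "((\<lambda>T. LINT v|lborel. kernel (exp (- T)) v) \<longlongrightarrow> (LINT v|lborel. complex_of_real (exp (- (pi\<^sup>2 * v\<^sup>2 / 6))))) at_top"
  proof (rule integral_dominated_convergence_at_top)
    show "integrable lborel (\<lambda>v::real. C * inverse (1 + v\<^sup>2))"
      using integrable_inverse_1_plus_square by (simp add: set_integrable_def einterval_eq_UNIV)
    have "filterlim (\<lambda>T::real. exp (- T)) (at_right 0) at_top" by real_asymp
    then show "AE v in lborel. ((\<lambda>T. kernel (exp (- T)) v) \<longlongrightarrow> of_real (exp (- (pi\<^sup>2 * v\<^sup>2 / 6)))) at_top"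
      by (intro AE_I2 filterlim_compose[OF kernel_limit])
    show "\<forall>\<^sub>F T in at_top. AE v in lborel. norm (kernel (exp (- T)) v) \<le> C * inverse (1 + v\<^sup>2)"
      using eventually_ge_at_top[of "ln 2 :: real"]
      by eventually_elim (intro AE_I2 C, auto intro: ln2[simplified])
  qed (auto intro: kernel_measurable)
  also have "(LINT v|lborel. complex_of_real (exp (- (pi\<^sup>2 * v\<^sup>2 / 6)))) = of_real (sqrt (6 / pi))"
    unfolding gaussian_integral[symmetric] by (rule integral_complex_of_real)
  finally show ?thesis .
qed

lemma num_partitions_eq_kernel_integral:
  assumes n: "n \<ge> 1"
  defines "x \<equiv> pi / sqrt (6 * real n)"
  shows "of_real (2 * pi * real (num_partitions n) * exp (- (real n * x)) / exp (log_gf x)) =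
    of_real (x powr (3/2)) * (LINT v|lborel. kernel x v)"
proof -
  have x: "x > 0" using n by (simp add: x_def)
  have nx: "pi\<^sup>2 / (6 * x\<^sup>2) = real n" using n by (simp add: x_def power_divide)
  let ?f = "\<lambda>t. indicator {-pi..pi} t *\<^sub>R (exp (log_ratio x t) * exp (- (\<i> * of_nat n * of_real t)))"
  have "of_real (2 * pi * real (num_partitions n) * exp (- (real n * x)) / exp (log_gf x)) = (LINT t|lborel. ?f t)"
    using num_partitions_fourier[OF x, of n] by (simp add: has_bochner_integral_iff)
  also have "\<dots> = \<bar>x powr (3/2)\<bar> *\<^sub>R (LINT v|lborel. ?f (0 + x powr (3/2) * v))"
    by (rule lborel_integral_real_affine) (use x in simp)
  also have "(\<lambda>v. ?f (0 + x powr (3/2) * v)) = kernel x"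
    unfolding kernel_def nx by (rule ext) (simp add: exp_diff exp_minus field_simps)
  finally show ?thesis by (simp add: scaleR_conv_of_real)
qed

text \<open>By the choice of $x$ both $nx$ and $\pi^2/(6x)$ equal $\pi\sqrt{6n}/6$. The remaining factors are $x^{3/2}$ from the change of
variables, $\sqrt{x/2\pi}$ from the generating function, and the integral $\sqrt{6/\pi}$, divided by $2\pi$.\<close>

theorem hardy_ramanujan:
  "(\<lambda>n. real n * real (num_partitions n) * exp (- (pi * sqrt (6 * real n) / 3))) \<longlonglongrightarrow> 1 / (4 * sqrt 3)"
proof -
  define x where "x n = pi / sqrt (6 * real n)" for n
  define J where "J n = Re (LINT v|lborel. kernel (x n) v)" for n
  define e where "e n = log_gf (x n) - pi\<^sup>2 / (6 * x n) - ln (x n) / 2 + ln (2 * pi) / 2" for n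
  have xpos: "x n > 0" if "n \<ge> 1" for n using that by (simp add: x_def)
  have J: "J \<longlonglongrightarrow> sqrt (6 / pi)"
  proof -
    have "filterlim (\<lambda>n. - ln (x n)) at_top sequentially"
      unfolding x_def by real_asymp
    from tendsto_Re[OF filterlim_compose[OF kernel_integral_limit this]]
    have "(\<lambda>n. Re (LINT v|lborel. kernel (exp (- (- ln (x n)))) v)) \<longlonglongrightarrow> sqrt (6 / pi)" by simp
    moreover have "\<forall>\<^sub>F n in sequentially. Re (LINT v|lborel. kernel (exp (- (- ln (x n)))) v) = J n"
      using eventually_ge_at_top[of 1] by eventually_elim (use xpos in \<open>simp add: J_def\<close>)
    ultimately show ?thesis by (rule Lim_transform_eventually)
  qed
  have e: "e \<longlonglongrightarrow> 0"
  proof (rule Lim_null_comparison)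
    show "\<forall>\<^sub>F n in sequentially. norm (e n) \<le> 2 * x n"
      using eventually_ge_at_top[of 1] by eventually_elim (use log_gf_estimate xpos in \<open>simp add: e_def\<close>)
    show "(\<lambda>n. 2 * x n) \<longlonglongrightarrow> 0" unfolding x_def by real_asymp
  qed
  have "(\<lambda>n. pi / (12 * sqrt (2 * pi)) * exp (e n) * J n) \<longlonglongrightarrow> pi / (12 * sqrt (2 * pi)) * exp 0 * sqrt (6 / pi)"
    by (intro tendsto_intros e J)
  also have "pi / (12 * sqrt (2 * pi)) * exp 0 * sqrt (6 / pi) = 1 / (4 * sqrt 3)"
  proof -
    have "sqrt (6 / pi) / sqrt (2 * pi) = sqrt ((6 / pi) / (2 * pi))" by (simp only: real_sqrt_divide)
    also have "(6 / pi) / (2 * pi) = 3 / pi\<^sup>2" by (simp add: power2_eq_square)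
    also have "sqrt (3 / pi\<^sup>2) = sqrt 3 / pi" by (simp add: real_sqrt_divide)
    finally have "sqrt (6 / pi) / sqrt (2 * pi) = sqrt 3 / pi" .
    moreover have "pi / (12 * sqrt (2 * pi)) * exp 0 * sqrt (6 / pi) = pi / 12 * (sqrt (6 / pi) / sqrt (2 * pi))" by simp
    ultimately have "pi / (12 * sqrt (2 * pi)) * exp 0 * sqrt (6 / pi) = pi / 12 * (sqrt 3 / pi)" by (simp only:)
    also have "\<dots> = sqrt 3 / 12" by simp
    also have "\<dots> = 1 / (4 * sqrt 3)" by (simp add: field_simps)
    finally show ?thesis .
  qed
  finally show ?thesis
  proof (rule Lim_transform_eventually)
    show "\<forall>\<^sub>F n in sequentially. pi / (12 * sqrt (2 * pi)) * exp (e n) * J n =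
        real n * real (num_partitions n) * exp (- (pi * sqrt (6 * real n) / 3))"
      using eventually_ge_at_top[of 1]
    proof eventually_elim
      case (elim n)
      have x: "x n > 0" by (rule xpos[OF elim])
      define S where "S = sqrt (6 * real n)"
      have S: "S > 0" "S\<^sup>2 = 6 * real n" using elim by (auto simp: S_def)
      have xS: "x n = pi / S" by (simp add: x_def S_def)
      have nx: "real n * x n = pi * S / 6" using S by (simp add: xS field_simps power2_eq_square)
      have px: "pi\<^sup>2 / (6 * x n) = pi * S / 6" using S by (simp add: xS field_simps power2_eq_square)
      have "2 * pi * real (num_partitions n) * exp (- (real n * x n)) / exp (log_gf (x n)) = x n powr (3/2) * J n"
        using arg_cong[OF num_partitions_eq_kernel_integral[OF elim, folded x_def], of Re] by (simp add: J_def)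
      then have p: "real (num_partitions n) = x n powr (3/2) * J n * exp (log_gf (x n)) * exp (real n * x n) / (2 * pi)"
        by (simp add: field_simps exp_minus)
      have "log_gf (x n) = pi * S / 6 + ln (x n) / 2 - ln (2 * pi) / 2 + e n" by (simp add: e_def px)
      then have "exp (log_gf (x n)) = exp (pi * S / 6) * exp (ln (x n) / 2) / exp (ln (2 * pi) / 2) * exp (e n)"
        by (simp add: exp_add exp_diff)
      also have "exp (ln (x n) / 2) = x n powr (1/2)" using x by (simp add: powr_def)
      also have "exp (ln (2 * pi) / 2) = sqrt (2 * pi)"
        using powr_half_sqrt[of "2 * pi"] by (simp add: powr_def)
      finally have L: "exp (log_gf (x n)) = exp (pi * S / 6) * x n powr (1/2) / sqrt (2 * pi) * exp (e n)" .
      have x2: "x n powr (3/2) * x n powr (1/2) = pi\<^sup>2 / (6 * real n)"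
      proof -
        have "x n powr (3/2) * x n powr (1/2) = x n powr 2" by (simp add: powr_add[symmetric])
        also have "\<dots> = (x n)\<^sup>2" using x by simp
        finally show ?thesis by (simp add: xS power_divide S)
      qed
      have "real n * real (num_partitions n) * exp (- (pi * S / 3)) =
         real n * (x n powr (3/2) * x n powr (1/2)) * (exp (pi * S / 6) * exp (pi * S / 6) * exp (- (pi * S / 3))) * J n * exp (e n) / (2 * pi * sqrt (2 * pi))"
        unfolding p L nx by (simp add: mult_ac)
      also have "exp (pi * S / 6) * exp (pi * S / 6) * exp (- (pi * S / 3)) = 1" by (simp add: exp_add[symmetric])
      also have "real n * (x n powr (3/2) * x n powr (1/2)) * 1 * J n * exp (e n) / (2 * pi * sqrt (2 * pi)) =
          pi / (12 * sqrt (2 * pi)) * exp (e n) * J n"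
        unfolding x2 using elim by (simp add: field_simps power2_eq_square)
      finally show ?case by (simp add: S_def)
    qed
  qed
qed

section \<open>Asymptotics of the second rank moment\<close>

lemma num_partitions_superpolynomial:
  "(\<lambda>n. real n ^ m / real (num_partitions n)) \<longlonglongrightarrow> 0"
proof -
  define y where "y n = pi * sqrt (6 * real n) / 3" for n
  define a where "a n = real n * real (num_partitions n) * exp (- y n)" for n
  have "filterlim y at_top sequentially" unfolding y_def by real_asymp
  from filterlim_compose[OF tendsto_power_div_exp_0[of "2 * Suc m"] this]
  have 1: "(\<lambda>n. y n ^ (2 * Suc m) / exp (y n)) \<longlonglongrightarrow> 0" .
  have 2: "a \<longlonglongrightarrow> 1 / (4 * sqrt 3)" unfolding a_def y_def by (rule hardy_ramanujan)
  have "(\<lambda>n. (3 / (2 * pi\<^sup>2)) ^ Suc m * (y n ^ (2 * Suc m) / exp (y n)) / a n) \<longlonglongrightarrow> (3 / (2 * pi\<^sup>2)) ^ Suc m * 0 / (1 / (4 * sqrt 3))"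
    by (intro tendsto_intros 1 2) simp
  moreover have "\<forall>\<^sub>F n in sequentially. (3 / (2 * pi\<^sup>2)) ^ Suc m * (y n ^ (2 * Suc m) / exp (y n)) / a n = real n ^ m / real (num_partitions n)"
    using eventually_ge_at_top[of 1]
  proof eventually_elim
    case (elim n)
    have n: "real n > 0" "real (num_partitions n) > 0" using elim num_partitions_pos[of n] by auto
    have "3 / (2 * pi\<^sup>2) * (y n)\<^sup>2 = real n"
      by (simp add: y_def power_divide power_mult_distrib)
    then have "(3 / (2 * pi\<^sup>2)) ^ Suc m * y n ^ (2 * Suc m) = real n ^ Suc m"
      by (metis power_mult power_mult_distrib)
    then have "(3 / (2 * pi\<^sup>2)) ^ Suc m * (y n ^ (2 * Suc m) / exp (y n)) / a n = (real n ^ Suc m / exp (y n)) / a n"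
      by simp
    also have "\<dots> = real n ^ m / real (num_partitions n)"
      using n by (simp add: a_def exp_minus field_simps)
    finally show ?case .
  qed
  ultimately show ?thesis by (simp add: filterlim_cong)
qed

theorem corollary1p3:
  "(\<lambda>n. real_of_int (eta2 n)) \<sim>[at_top]
     (\<lambda>n. 1 / (4 * sqrt 3) * exp (pi / 6 * sqrt (24 * real n - 1)))"
proof (rule asymp_equivI')
  define y where "y n = pi * sqrt (6 * real n) / 3" for n
  have 1: "(\<lambda>n. real_of_int (eta2 n) / (real n * real (num_partitions n))) \<longlonglongrightarrow> 1"
    by (rule eta2_asymp_n_num_partitions) (rule num_partitions_superpolynomial)
  have 2: "(\<lambda>n. real n * real (num_partitions n) * exp (- y n)) \<longlonglongrightarrow> 1 / (4 * sqrt 3)"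
    unfolding y_def by (rule hardy_ramanujan)
  have 3: "(\<lambda>n. exp (y n - pi / 6 * sqrt (24 * real n - 1))) \<longlonglongrightarrow> 1"
  proof -
    have "sqrt (24 * u) = 2 * sqrt (6 * u)" for u
      using real_sqrt_mult[of 4 "6 * u"] by simp
    then have "y = (\<lambda>n. pi / 6 * sqrt (24 * real n))" by (auto simp: y_def)
    moreover have "(\<lambda>n. exp (pi / 6 * sqrt (24 * real n) - pi / 6 * sqrt (24 * real n - 1))) \<longlonglongrightarrow> 1"
      by real_asymp
    ultimately show ?thesis by simp
  qed
  have "(\<lambda>n. real_of_int (eta2 n) / (real n * real (num_partitions n)) *
      (real n * real (num_partitions n) * exp (- y n)) *
      (4 * sqrt 3 * exp (y n - pi / 6 * sqrt (24 * real n - 1)))) \<longlonglongrightarrow> 1 * (1 / (4 * sqrt 3)) * (4 * sqrt 3 * 1)"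
    by (intro tendsto_mult tendsto_const 1 2 3)
  moreover have "\<forall>\<^sub>F n in sequentially. real_of_int (eta2 n) / (real n * real (num_partitions n)) *
      (real n * real (num_partitions n) * exp (- y n)) *
      (4 * sqrt 3 * exp (y n - pi / 6 * sqrt (24 * real n - 1))) =
      real_of_int (eta2 n) / (1 / (4 * sqrt 3) * exp (pi / 6 * sqrt (24 * real n - 1)))"
    using eventually_ge_at_top[of 1]
  proof eventually_elim
    case (elim n)
    have "real n * real (num_partitions n) \<noteq> 0" using elim num_partitions_pos[of n] by simp
    then show ?case unfolding exp_diff exp_minus by simp
  qed
  ultimately show "(\<lambda>n. real_of_int (eta2 n) / (1 / (4 * sqrt 3) * exp (pi / 6 * sqrt (24 * real n - 1)))) \<longlonglongrightarrow> 1"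
    by (simp add: filterlim_cong)
qed

end
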